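(* Let $\Omega\subset\mathbb{R}^2$ be a bounded, simply connected $C^3$ domain. For any $\epsilon, C\ge 0$ there exists a function $u\in C^2(\bar\Omega)$ (with values in $\mathbb{R}^2$), not identically zero, such that $$u=0 \text{ on }\partial\Omega,\qquad\text{and}\qquad \langle u, Au\rangle\le \epsilon\,\|\nabla u\|_{L^2}^2 - C\,\|\nabla\cdot u\|_{L^2}^2 .$$
   Context: $\langle\cdot,\cdot\rangle$ is the standard $L^2(\Omega)$ inner product. $P$ is the Leray projection, i.e. the $L^2$-orthogonal projection of $L^2(\Omega,\mathbb{R}^2)$ onto $H=\{v\in L^2(\Omega,\mathbb{R}^2): \nabla\cdot v=0 \text{ in }\Omega,\ v\cdot\nu=0\text{ on }\partial\Omega\}$, where $\nu$ is the outward unit normal. For $u\in H^2(\Omega,\mathbb{R}^2)$ the Stokes pressure gradient is $\nabla p_s(u)=(I-P)(\Delta u-\nabla\nabla\cdot u)$. The extended Stokes operator is $Au=-\Delta u+\nabla p_s(u)=-P\Delta u-\nabla\nabla\cdot u$, for $u\in H^2\cap H^1_0$. *)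

theory Defs
  imports "HOL-Analysis.Analysis"
begin

section \<open>Classical derivatives and smoothness classes\<close>

definition pd :: "'a::euclidean_space \<Rightarrow> ('a \<Rightarrow> 'b::real_normed_vector) \<Rightarrow> 'a \<Rightarrow> 'b" where
  "pd i f x = frechet_derivative f (at x) i"

definition grad :: "('a::euclidean_space \<Rightarrow> real) \<Rightarrow> 'a \<Rightarrow> 'a" where
  "grad q x = (\<Sum>i\<in>Basis. pd i q x *\<^sub>R i)"

definition divergence :: "('a::euclidean_space \<Rightarrow> 'a) \<Rightarrow> 'a \<Rightarrow> real" where
  "divergence u x = (\<Sum>i\<in>Basis. pd i u x \<bullet> i)"

definition laplacian :: "('a::euclidean_space \<Rightarrow> 'b::real_normed_vector) \<Rightarrow> 'a \<Rightarrow> 'b" where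
  "laplacian u x = (\<Sum>i\<in>Basis. pd i (pd i u) x)"

text \<open>\<open>C\<^sup>k(S)\<close>; meant for open \<open>S\<close>.\<close>

fun Ck_on :: "nat \<Rightarrow> 'a::euclidean_space set \<Rightarrow> ('a \<Rightarrow> 'b::real_normed_vector) \<Rightarrow> bool" where
  "Ck_on 0 S f \<longleftrightarrow> continuous_on S f"
| "Ck_on (Suc k) S f \<longleftrightarrow> (\<forall>x\<in>S. f differentiable (at x)) \<and> (\<forall>i\<in>Basis. Ck_on k S (pd i f))"

text \<open>\<open>C\<^sup>k\<close> up to the boundary of an open set \<open>S\<close>: \<open>f\<close> is continuous on \<open>closure S\<close>, and all
  derivatives of order at most \<open>k\<close> exist in \<open>S\<close> and extend continuously to \<open>closure S\<close>.
  The function \<open>g\<close> is such an extension; only derivatives at points of \<open>S\<close> are used.\<close>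

fun Ck_closure :: "nat \<Rightarrow> 'a::euclidean_space set \<Rightarrow> ('a \<Rightarrow> 'b::real_normed_vector) \<Rightarrow> bool" where
  "Ck_closure 0 S f \<longleftrightarrow> continuous_on (closure S) f"
| "Ck_closure (Suc k) S f \<longleftrightarrow> continuous_on (closure S) f \<and> (\<forall>x\<in>S. f differentiable (at x)) \<and>
     (\<forall>i\<in>Basis. \<exists>g. Ck_closure k S g \<and> (\<forall>x\<in>S. g x = pd i f x))"

definition test_function :: "'a::euclidean_space set \<Rightarrow> ('a \<Rightarrow> real) \<Rightarrow> bool" where
  "test_function S \<phi> \<longleftrightarrow> (\<forall>k. Ck_on k UNIV \<phi>) \<and>
     compact (closure {x. \<phi> x \<noteq> 0}) \<and> closure {x. \<phi> x \<noteq> 0} \<subseteq> S"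


section \<open>Planar domains with \<open>C\<^sup>k\<close> boundary\<close>

text \<open>Near each boundary point the domain is, in some orthonormal coordinate system
  \<open>(e\<^sub>1, e\<^sub>2)\<close>, the set strictly above the graph of a \<open>C\<^sup>k\<close> function.\<close>

definition Ck_domain :: "nat \<Rightarrow> (real^2) set \<Rightarrow> bool" where
  "Ck_domain k \<Omega> \<longleftrightarrow> open \<Omega> \<and> connected \<Omega> \<and> \<Omega> \<noteq> {} \<and>
     (\<forall>x0\<in>frontier \<Omega>. \<exists>r>0. \<exists>e1 e2. \<exists>\<gamma>::real \<Rightarrow> real.
        norm e1 = 1 \<and> norm e2 = 1 \<and> e1 \<bullet> e2 = 0 \<and> Ck_on k UNIV \<gamma> \<and>
        \<Omega> \<inter> ball x0 r = {x \<in> ball x0 r. \<gamma> (x \<bullet> e1) < x \<bullet> e2})"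


section \<open>\<open>L\<^sup>2(\<Omega>)\<close>\<close>

text \<open>Elements of \<open>L\<^sup>2(\<Omega>)\<close> are represented by functions, considered up to equality almost
  everywhere in \<open>\<Omega>\<close>.\<close>

definition L2 :: "'a::euclidean_space set \<Rightarrow> ('a \<Rightarrow> 'b::euclidean_space) set" where
  "L2 \<Omega> = {f. f \<in> borel_measurable (lebesgue_on \<Omega>) \<and>
              integrable (lebesgue_on \<Omega>) (\<lambda>x. (norm (f x))\<^sup>2)}"

definition L2_inner ::
  "'a::euclidean_space set \<Rightarrow> ('a \<Rightarrow> 'b::euclidean_space) \<Rightarrow> ('a \<Rightarrow> 'b) \<Rightarrow> real" where
  "L2_inner \<Omega> f g = (\<integral>x. f x \<bullet> g x \<partial>lebesgue_on \<Omega>)"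

definition L2_norm :: "'a::euclidean_space set \<Rightarrow> ('a \<Rightarrow> 'b::euclidean_space) \<Rightarrow> real" where
  "L2_norm \<Omega> f = sqrt (L2_inner \<Omega> f f)"

definition L2_norm_grad :: "'a::euclidean_space set \<Rightarrow> ('a \<Rightarrow> 'b::euclidean_space) \<Rightarrow> real" where
  "L2_norm_grad \<Omega> u = sqrt (\<Sum>i\<in>Basis. (L2_norm \<Omega> (pd i u))\<^sup>2)"


section \<open>Leray projection and extended Stokes operator\<close>

definition has_weak_div :: "'a::euclidean_space set \<Rightarrow> ('a \<Rightarrow> 'a) \<Rightarrow> ('a \<Rightarrow> real) \<Rightarrow> bool" where
  "has_weak_div \<Omega> v d \<longleftrightarrow> d \<in> L2 \<Omega> \<and>
     (\<forall>\<phi>. test_function \<Omega> \<phi> \<longrightarrow> L2_inner \<Omega> v (grad \<phi>) = - L2_inner \<Omega> d \<phi>)"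

text \<open>A field \<open>v \<in> L\<^sup>2(\<Omega>)\<close> with weak divergence \<open>d \<in> L\<^sup>2(\<Omega>)\<close> has no pointwise boundary values. Its
  normal trace \<open>v \<cdot> \<nu>\<close> is the functional on boundary values given by Green's formula
  \<open>\<langle>v \<cdot> \<nu>, q\<rangle> = \<integral>\<^sub>\<Omega> v \<cdot> \<nabla>q + d q\<close>; it is tested here with \<open>q\<close> that are \<open>C\<^sup>1\<close> up to the boundary,
  which are dense in \<open>H\<^sup>1(\<Omega>)\<close>.\<close>

definition normal_trace ::
  "'a::euclidean_space set \<Rightarrow> ('a \<Rightarrow> 'a) \<Rightarrow> ('a \<Rightarrow> real) \<Rightarrow> ('a \<Rightarrow> real) \<Rightarrow> real" where
  "normal_trace \<Omega> v d q = L2_inner \<Omega> v (grad q) + L2_inner \<Omega> d q"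

definition solenoidal :: "'a::euclidean_space set \<Rightarrow> ('a \<Rightarrow> 'a) set" where
  "solenoidal \<Omega> = {v \<in> L2 \<Omega>. has_weak_div \<Omega> v (\<lambda>_. 0) \<and>
     (\<forall>q. Ck_closure 1 \<Omega> q \<longrightarrow> normal_trace \<Omega> v (\<lambda>_. 0) q = 0)}"

text \<open>The \<open>L\<^sup>2\<close>-orthogonal projection onto \<open>solenoidal \<Omega>\<close>: a representative, unique up to
  equality almost everywhere in \<open>\<Omega>\<close>, for \<open>f \<in> L\<^sup>2(\<Omega>)\<close>.\<close>

definition leray :: "'a::euclidean_space set \<Rightarrow> ('a \<Rightarrow> 'a) \<Rightarrow> 'a \<Rightarrow> 'a" where
  "leray \<Omega> f = (SOME w. w \<in> solenoidal \<Omega> \<and>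
     (\<forall>v\<in>solenoidal \<Omega>. L2_inner \<Omega> (\<lambda>x. f x - w x) v = 0))"

text \<open>The two operators below use classical derivatives, which agree with the weak ones
  for \<open>u\<close> that are \<open>C\<^sup>2\<close> up to the boundary.\<close>

definition stokes_pressure_grad :: "'a::euclidean_space set \<Rightarrow> ('a \<Rightarrow> 'a) \<Rightarrow> 'a \<Rightarrow> 'a" where
  "stokes_pressure_grad \<Omega> u =
     (let f = (\<lambda>x. laplacian u x - grad (divergence u) x) in (\<lambda>x. f x - leray \<Omega> f x))"

definition extended_stokes :: "'a::euclidean_space set \<Rightarrow> ('a \<Rightarrow> 'a) \<Rightarrow> 'a \<Rightarrow> 'a" where
  "extended_stokes \<Omega> u = (\<lambda>x. - laplacian u x + stokes_pressure_grad \<Omega> u x)"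

end

theory Submission
  imports Defs
begin

text \<open>
  Write \<open>rot y\<close> for the rotated gradient of \<open>y\<close>. A divergence-free field \<open>v = rot \<psi>\<close> with vorticity
  \<open>\<omega> = \<Delta>\<psi>\<close> has \<open>\<Delta>v = rot \<omega>\<close>, and \<open>rot \<zeta>\<close> is solenoidal whenever \<open>\<zeta>\<close> vanishes on the boundary. Hence the
  Stokes pressure of \<open>v\<close> depends on the boundary values of \<open>\<omega>\<close> only: it does not decay when \<open>v\<close> is a
  boundary layer whose width, and with it the energy, tends to \<open>0\<close>. Add to such a layer a small
  multiple \<open>t w\<close> of a fixed field \<open>w\<close> supported in the interior whose inner product with this pressure
  gradient is not \<open>0\<close>. As \<open>v\<close> and \<open>w - P w\<close> are orthogonal to gradients and to solenoidal fields
  respectively, \<open>\<langle>u, Au\<rangle>\<close> is up to \<open>O(t\<^sup>2)\<close> and the small energy of \<open>v\<close> linear in \<open>t\<close> with a nonzero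
  coefficient, while the divergence contributes \<open>O(t\<^sup>2)\<close>. So \<open>\<epsilon> = 0\<close> is possible. One layer near a
  single boundary point suffices, which avoids the regularity of the distance function.
\<close>

section \<open>Square-integrable fields and orthogonal projections\<close>

text \<open>\<open>leray\<close> is a SOME-choice, so nothing follows about it until a projection is
  known to exist. After that only two facts are used: \<open>P f\<close> is solenoidal and
  \<open>f - P f\<close> is orthogonal to solenoidal fields. The nonzero coefficient rests on one
  test. The constant field \<open>e1\<close> is the gradient of \<open>x \<bullet> e1\<close>, hence
  orthogonal to all solenoidal fields. Let \<open>F\<close> be a fixed extension of the boundary
  vorticity. Its product with \<open>rot F\<close> is minus the integral of \<open>pd e2 F\<close>,
  and \<open>F\<close> is built to decrease along \<open>e2\<close> inside \<open>\<Omega>\<close>.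
  So \<open>rot F\<close> has a nonzero gradient part, and \<open>w\<close> is \<open>e1\<close> cut
  off near the boundary. Regularity shapes the rest. With \<open>\<gamma>\<close> of class C3 the
  layer field is C2, but its vorticity is only C1, and solenoidality is tested with \<open>q\<close>
  that are merely C1 up to the boundary. Integrations by parts therefore have to avoid second
  derivatives of both factors. The order of choices matters: \<open>F\<close>, \<open>w\<close>, the
  coefficient \<open>c\<close> and the factor \<open>t\<close> are fixed before the width
  \<open>\<delta>\<close>, which is then taken so small that the energy of the layer stays below the
  gain that \<open>t\<close> provides.\<close>

lemma L2_measurable: "f \<in> L2 \<Omega> \<Longrightarrow> f \<in> borel_measurable (lebesgue_on \<Omega>)"
  by (simp add: L2_def)

lemma L2_integrable_inner:
  fixes f g :: "'a::euclidean_space \<Rightarrow> 'b::euclidean_space"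
  assumes "f \<in> L2 \<Omega>" "g \<in> L2 \<Omega>"
  shows "integrable (lebesgue_on \<Omega>) (\<lambda>x. f x \<bullet> g x)"
proof (rule Bochner_Integration.integrable_bound)
  show "integrable (lebesgue_on \<Omega>) (\<lambda>x. (norm (f x))\<^sup>2 + (norm (g x))\<^sup>2)"
    using assms by (simp add: L2_def)
  show "(\<lambda>x. f x \<bullet> g x) \<in> borel_measurable (lebesgue_on \<Omega>)"
    using assms[THEN L2_measurable] by measurable
  show "AE x in lebesgue_on \<Omega>. norm (f x \<bullet> g x) \<le> norm ((norm (f x))\<^sup>2 + (norm (g x))\<^sup>2)"
  proof (rule AE_I2)
    fix x
    have "\<bar>f x \<bullet> g x\<bar> \<le> norm (f x) * norm (g x)"
      by (rule Cauchy_Schwarz_ineq2)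
    also have "2 * (norm (f x) * norm (g x)) \<le> (norm (f x))\<^sup>2 + (norm (g x))\<^sup>2"
      using sum_squares_bound[of "norm (f x)" "norm (g x)"] by (simp add: mult.assoc)
    then have "norm (f x) * norm (g x) \<le> (norm (f x))\<^sup>2 + (norm (g x))\<^sup>2"
      using mult_nonneg_nonneg[OF norm_ge_zero[of "f x"] norm_ge_zero[of "g x"]] by linarith
    finally show "norm (f x \<bullet> g x) \<le> norm ((norm (f x))\<^sup>2 + (norm (g x))\<^sup>2)"
      by simp
  qed
qed

lemma L2_zero: "(\<lambda>_. 0) \<in> L2 \<Omega>"
  by (simp add: L2_def)

lemma L2_add:
  fixes f g :: "'a::euclidean_space \<Rightarrow> 'b::euclidean_space"
  assumes "f \<in> L2 \<Omega>" "g \<in> L2 \<Omega>"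
  shows "(\<lambda>x. f x + g x) \<in> L2 \<Omega>"
proof -
  have "integrable (lebesgue_on \<Omega>) (\<lambda>x. f x \<bullet> f x + 2 * (f x \<bullet> g x) + g x \<bullet> g x)"
    using L2_integrable_inner assms by (intro Bochner_Integration.integrable_add integrable_mult_right) auto
  then show ?thesis
    using assms[THEN L2_measurable]
    by (simp add: L2_def power2_norm_eq_inner inner_add algebra_simps inner_commute)
qed

lemma L2_scaleR:
  fixes f :: "'a::euclidean_space \<Rightarrow> 'b::euclidean_space"
  assumes "f \<in> L2 \<Omega>"
  shows "(\<lambda>x. c *\<^sub>R f x) \<in> L2 \<Omega>"
  using assms by (auto simp: L2_def power_mult_distrib)

lemma L2_diff:
  fixes f g :: "'a::euclidean_space \<Rightarrow> 'b::euclidean_space"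
  assumes "f \<in> L2 \<Omega>" "g \<in> L2 \<Omega>"
  shows "(\<lambda>x. f x - g x) \<in> L2 \<Omega>"
  using L2_add[OF assms(1) L2_scaleR[OF assms(2), of "-1"]] by simp

lemma L2_inner_commute: "L2_inner \<Omega> f g = L2_inner \<Omega> g f"
  by (simp add: L2_inner_def inner_commute)

lemma L2_inner_add_left:
  assumes "f \<in> L2 \<Omega>" "g \<in> L2 \<Omega>" "h \<in> L2 \<Omega>"
  shows "L2_inner \<Omega> (\<lambda>x. f x + g x) h = L2_inner \<Omega> f h + L2_inner \<Omega> g h"
  using assms by (simp add: L2_inner_def inner_add_left L2_integrable_inner)

lemma L2_inner_diff_left:
  assumes "f \<in> L2 \<Omega>" "g \<in> L2 \<Omega>" "h \<in> L2 \<Omega>"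
  shows "L2_inner \<Omega> (\<lambda>x. f x - g x) h = L2_inner \<Omega> f h - L2_inner \<Omega> g h"
  using assms by (simp add: L2_inner_def inner_diff_left L2_integrable_inner)

lemma L2_inner_scaleR_left: "L2_inner \<Omega> (\<lambda>x. c *\<^sub>R f x) h = c * L2_inner \<Omega> f h"
  by (simp add: L2_inner_def)

lemma L2_inner_add_right:
  assumes "f \<in> L2 \<Omega>" "g \<in> L2 \<Omega>" "h \<in> L2 \<Omega>"
  shows "L2_inner \<Omega> f (\<lambda>x. g x + h x) = L2_inner \<Omega> f g + L2_inner \<Omega> f h"
  using assms by (simp add: L2_inner_def inner_add_right L2_integrable_inner)

lemma L2_inner_diff_right:
  assumes "f \<in> L2 \<Omega>" "g \<in> L2 \<Omega>" "h \<in> L2 \<Omega>"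
  shows "L2_inner \<Omega> f (\<lambda>x. g x - h x) = L2_inner \<Omega> f g - L2_inner \<Omega> f h"
  using assms by (simp add: L2_inner_def inner_diff_right L2_integrable_inner)

lemma L2_inner_scaleR_right: "L2_inner \<Omega> f (\<lambda>x. c *\<^sub>R h x) = c * L2_inner \<Omega> f h"
  by (simp add: L2_inner_def)

lemma L2_inner_nonneg: "0 \<le> L2_inner \<Omega> f f"
  by (simp add: L2_inner_def)

lemma L2_norm_sq: "(L2_norm \<Omega> f)\<^sup>2 = L2_inner \<Omega> f f"
  by (simp add: L2_norm_def L2_inner_nonneg)

lemma L2_inner_diff_self:
  assumes "f \<in> L2 \<Omega>" "g \<in> L2 \<Omega>"
  shows "L2_inner \<Omega> (\<lambda>x. f x - g x) (\<lambda>x. f x - g x)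
         = L2_inner \<Omega> f f - 2 * L2_inner \<Omega> f g + L2_inner \<Omega> g g"
  using assms
  by (simp add: L2_inner_diff_left L2_inner_diff_right L2_diff L2_inner_commute[of \<Omega> g f])

text \<open>Expand the squared norms of \<open>a f - g\<close> and \<open>a f + g\<close> and divide
  by \<open>a\<close>. The free weight \<open>a\<close> is later taken as \<open>2^k\<close> to
  balance a factor that decays like \<open>4^-k\<close> against a constant.\<close>

lemma L2_inner_young:
  assumes "f \<in> L2 \<Omega>" "g \<in> L2 \<Omega>" "a > 0"
  shows "2 * \<bar>L2_inner \<Omega> f g\<bar> \<le> a * L2_inner \<Omega> f f + L2_inner \<Omega> g g / a"
proof -
  have "0 \<le> a * L2_inner \<Omega> f f - 2 * s * L2_inner \<Omega> f g + L2_inner \<Omega> g g / a"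
    if s: "s = 1 \<or> s = -1" for s :: real
  proof -
    have "0 \<le> L2_inner \<Omega> (\<lambda>x. a *\<^sub>R f x - s *\<^sub>R g x) (\<lambda>x. a *\<^sub>R f x - s *\<^sub>R g x)"
      by (rule L2_inner_nonneg)
    also have "\<dots> = a * (a * L2_inner \<Omega> f f - 2 * s * L2_inner \<Omega> f g + s * s * L2_inner \<Omega> g g / a)"
      using assms by (simp add: L2_inner_diff_self L2_scaleR L2_inner_scaleR_left
          L2_inner_scaleR_right field_simps)
    finally show ?thesis
      using \<open>a > 0\<close> s by (auto simp: zero_le_mult_iff)
  qed
  from this[of 1] this[of "-1"] show ?thesis
    by (auto simp: abs_if)
qed

text \<open>Fatou's lemma for the squared norms. The bound is asked only from an index
  \<open>n\<close> on, since the projection argument applies it to tails of a sequence.\<close>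

lemma L2_Fatou:
  fixes g :: "'a::euclidean_space \<Rightarrow> 'b::euclidean_space"
  assumes h: "\<And>k. h k \<in> L2 \<Omega>"
    and g: "g \<in> borel_measurable (lebesgue_on \<Omega>)"
    and lim: "AE x in lebesgue_on \<Omega>. (\<lambda>k. h k x) \<longlonglongrightarrow> g x"
    and bound: "\<And>k. k \<ge> n \<Longrightarrow> L2_inner \<Omega> (h k) (h k) \<le> c"
  shows "g \<in> L2 \<Omega>" "L2_inner \<Omega> g g \<le> c"
proof -
  let ?M = "lebesgue_on \<Omega>"
  \<comment> \<open>\<open>ennreal\<close> truncates negative reals to 0, so returning to a real
    inequality at the end requires this sign.\<close>
  have c: "0 \<le> c"
    using L2_inner_nonneg[of \<Omega> "h n"] bound[of n] by linarith
  have [measurable]: "h k \<in> borel_measurable ?M" for k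
    using h by (rule L2_measurable)
  note [measurable] = g
  have *: "(\<integral>\<^sup>+x. ennreal ((norm (h k x))\<^sup>2) \<partial>?M) \<le> ennreal c" if "k \<ge> n" for k
  proof -
    have "(\<integral>\<^sup>+x. ennreal ((norm (h k x))\<^sup>2) \<partial>?M) = ennreal (L2_inner \<Omega> (h k) (h k))"
      using h[of k] by (subst nn_integral_eq_integral)
        (auto simp: L2_def L2_inner_def power2_norm_eq_inner)
    then show ?thesis
      using bound[OF that] by (simp add: ennreal_leI)
  qed
  have "(\<integral>\<^sup>+x. ennreal ((norm (g x))\<^sup>2) \<partial>?M)
      = (\<integral>\<^sup>+x. liminf (\<lambda>k. ennreal ((norm (h k x))\<^sup>2)) \<partial>?M)"
  proof (rule nn_integral_cong_AE)
    show "AE x in ?M. ennreal ((norm (g x))\<^sup>2) = liminf (\<lambda>k. ennreal ((norm (h k x))\<^sup>2))"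
      using lim
    proof eventually_elim
      case (elim x)
      have "(\<lambda>k. ennreal ((norm (h k x))\<^sup>2)) \<longlonglongrightarrow> ennreal ((norm (g x))\<^sup>2)"
        using elim by (intro tendsto_ennrealI tendsto_intros)
      then show ?case
        using lim_imp_Liminf[OF sequentially_bot] by metis
    qed
  qed
  also have "\<dots> \<le> liminf (\<lambda>k. \<integral>\<^sup>+x. ennreal ((norm (h k x))\<^sup>2) \<partial>?M)"
    by (rule nn_integral_liminf) measurable
  also have "\<dots> \<le> ennreal c"
  proof -
    have "liminf (\<lambda>k. \<integral>\<^sup>+x. ennreal ((norm (h k x))\<^sup>2) \<partial>?M)
        \<le> limsup (\<lambda>k. \<integral>\<^sup>+x. ennreal ((norm (h k x))\<^sup>2) \<partial>?M)"
      by (rule Liminf_le_Limsup) simp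
    also have "\<dots> \<le> ennreal c"
      using * by (intro Limsup_bounded) (auto simp: eventually_sequentially)
    finally show ?thesis .
  qed
  finally have le: "(\<integral>\<^sup>+x. ennreal ((norm (g x))\<^sup>2) \<partial>?M) \<le> ennreal c" .
  then have int: "integrable ?M (\<lambda>x. (norm (g x))\<^sup>2)"
    by (intro integrableI_bounded) (auto simp: le_less_trans[OF _ ennreal_less_top])
  then show "g \<in> L2 \<Omega>"
    using g by (simp add: L2_def)
  have "ennreal (L2_inner \<Omega> g g) \<le> ennreal c"
    using le int by (subst (asm) nn_integral_eq_integral)
      (auto simp: L2_inner_def power2_norm_eq_inner)
  then show "L2_inner \<Omega> g g \<le> c"
    using c by (simp add: ennreal_le_iff)
qed

text \<open>The Riesz-Fischer argument for a sequence that is already geometrically Cauchy: on a set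
  of finite measure the increments are summable in L1, so their pointwise sum is finite almost
  everywhere and the sequence telescopes to a limit.\<close>

lemma L2_fast_Cauchy_converges:
  fixes h :: "nat \<Rightarrow> 'a::euclidean_space \<Rightarrow> 'b::euclidean_space"
  assumes \<Omega>: "\<Omega> \<in> lmeasurable" and h: "\<And>k. h k \<in> L2 \<Omega>"
    and fast: "\<And>k. L2_inner \<Omega> (\<lambda>x. h (Suc k) x - h k x) (\<lambda>x. h (Suc k) x - h k x) \<le> A * (1/4)^k"
  obtains g where "g \<in> borel_measurable (lebesgue_on \<Omega>)"
    and "AE x in lebesgue_on \<Omega>. (\<lambda>k. h k x) \<longlonglongrightarrow> g x"
proof -
  let ?M = "lebesgue_on \<Omega>"
  interpret finite_measure ?M
    using \<Omega> by (rule finite_measure_lebesgue_on)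
  have [measurable]: "h k \<in> borel_measurable ?M" for k
    using h by (rule L2_measurable)
  define d where "d k x = norm (h (Suc k) x - h k x)" for k x
  have [measurable]: "d k \<in> borel_measurable ?M" for k
    unfolding d_def by measurable
  define m where "m = measure ?M (space ?M)"
  have A: "0 \<le> A"
    using order_trans[OF L2_inner_nonneg fast[of 0]] by simp
  have m: "0 \<le> m" by (simp add: m_def)
  have le: "(\<integral>\<^sup>+x. ennreal (d k x) \<partial>?M) \<le> ennreal ((A + m) * (1/2)^k)" for k
  proof -
    have dint: "integrable ?M (\<lambda>x. (d k x)\<^sup>2)"
      using L2_diff[OF h h, of "Suc k" k] by (simp add: L2_def d_def)
    have dval: "(\<integral>x. (d k x)\<^sup>2 \<partial>?M) \<le> A * (1/4)^k"
      using fast[of k] by (simp add: L2_inner_def d_def power2_norm_eq_inner)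
    \<comment> \<open>The weight \<open>2^k\<close> turns the bound \<open>4^-k\<close> on the
      square into \<open>2^-k\<close> for the first power; the constant \<open>2^-k\<close>
      integrates to \<open>m * 2^-k\<close>.\<close>
    have "d k x \<le> 2^k * (d k x)\<^sup>2 + (1/2)^k" for x
    proof -
      have "0 \<le> (2^k * d k x - 1)\<^sup>2" by simp
      then have "2 * (2^k * d k x) \<le> (2^k * d k x)\<^sup>2 + 1"
        by (simp add: power2_diff)
      moreover have "0 \<le> 2^k * d k x" by (simp add: d_def)
      ultimately have "2^k * d k x \<le> (2^k * d k x)\<^sup>2 + 1" by linarith
      then have "(1/2)^k * (2^k * d k x) \<le> (1/2)^k * ((2^k * d k x)\<^sup>2 + 1)"
        by (intro mult_left_mono) auto
      then show ?thesis
        by (simp add: field_simps power2_eq_square power_one_over)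
    qed
    then have "(\<integral>\<^sup>+x. ennreal (d k x) \<partial>?M) \<le> (\<integral>\<^sup>+x. ennreal (2^k * (d k x)\<^sup>2 + (1/2)^k) \<partial>?M)"
      by (intro nn_integral_mono ennreal_leI)
    also have "\<dots> = ennreal (\<integral>x. 2^k * (d k x)\<^sup>2 + (1/2)^k \<partial>?M)"
      using dint by (intro nn_integral_eq_integral) auto
    also have "(\<integral>x. 2^k * (d k x)\<^sup>2 + (1/2)^k \<partial>?M) = 2^k * (\<integral>x. (d k x)\<^sup>2 \<partial>?M) + m * (1/2)^k"
      using dint by (simp add: m_def mult.commute)
    also have "\<dots> \<le> 2^k * (A * (1/4)^k) + m * (1/2)^k"
      using dval by (intro add_right_mono mult_left_mono) auto
    also have "\<dots> = (A + m) * (1/2)^k"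
    proof -
      have "(2::real)^k * (1/4)^k = (1/2)^k"
        by (simp flip: power_mult_distrib)
      then show ?thesis
        by (simp add: algebra_simps)
    qed
    finally show ?thesis
      by (simp add: ennreal_leI)
  qed
  have "(\<integral>\<^sup>+x. (\<Sum>k. ennreal (d k x)) \<partial>?M) = (\<Sum>k. \<integral>\<^sup>+x. ennreal (d k x) \<partial>?M)"
    by (rule nn_integral_suminf) measurable
  also have "\<dots> \<le> (\<Sum>k. ennreal ((A + m) * (1/2)^k))"
    using le by (intro suminf_le) auto
  also have "\<dots> = ennreal (\<Sum>k. (A + m) * (1/2)^k)"
    using A m by (intro suminf_ennreal2 summable_mult summable_geometric) auto
  finally have "(\<integral>\<^sup>+x. (\<Sum>k. ennreal (d k x)) \<partial>?M) \<noteq> \<infinity>"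
    by (auto simp: top_unique)
  then have AE: "AE x in ?M. (\<Sum>k. ennreal (d k x)) \<noteq> \<infinity>"
    by (intro nn_integral_PInf_AE) auto
  show thesis
  proof (rule that)
    show "(\<lambda>x. lim (\<lambda>k. h k x)) \<in> borel_measurable ?M"
      by measurable
    show "AE x in ?M. (\<lambda>k. h k x) \<longlonglongrightarrow> lim (\<lambda>k. h k x)"
      using AE
    proof eventually_elim
      case (elim x)
      have "summable (\<lambda>k. d k x)"
        using elim by (intro summable_suminf_not_top) (auto simp: d_def)
      then have "summable (\<lambda>k. h (Suc k) x - h k x)"
        unfolding d_def by (rule summable_norm_cancel)
      then have "convergent (\<lambda>k. \<Sum>i<k. h (Suc i) x - h i x)"
        by (rule summable_iff_convergent[THEN iffD1])
      then have "convergent (\<lambda>k. h k x - h 0 x)"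
        by (simp only: sum_lessThan_telescope[of "\<lambda>i. h i x"])
      then have "convergent (\<lambda>k. (h k x - h 0 x) + h 0 x)"
        by (intro convergent_add convergent_const)
      then show ?case
        by (simp add: convergent_LIMSEQ_iff)
    qed
  qed
qed

text \<open>Minimise the distance to \<open>f\<close> over \<open>H\<close>. Giving \<open>H\<close>
  as the annihilator of a set \<open>Q\<close> makes closedness concrete: the limit of a minimising
  sequence is tested against one \<open>q\<close> at a time.\<close>

lemma L2_projection_exists:
  fixes f :: "'a::euclidean_space \<Rightarrow> 'b::euclidean_space"
  assumes \<Omega>: "\<Omega> \<in> lmeasurable" and Q: "Q \<subseteq> L2 \<Omega>" and f: "f \<in> L2 \<Omega>"
  defines "H \<equiv> {v \<in> L2 \<Omega>. \<forall>q\<in>Q. L2_inner \<Omega> v q = 0}"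
  obtains w where "w \<in> H" "\<And>v. v \<in> H \<Longrightarrow> L2_inner \<Omega> (\<lambda>x. f x - w x) v = 0"
proof -
  let ?N = "\<lambda>g. L2_inner \<Omega> g g"
  define D where "D = (\<lambda>h. ?N (\<lambda>x. f x - h x)) ` H"
  have zero: "(\<lambda>_. 0) \<in> H"
    by (simp add: H_def L2_zero L2_inner_def)
  have HL: "h \<in> L2 \<Omega>" if "h \<in> H" for h
    using that by (simp add: H_def)
  have Hcomb: "(\<lambda>x. a *\<^sub>R u x + b *\<^sub>R v x) \<in> H" if "u \<in> H" "v \<in> H" for u v a b
    using that Q by (auto simp: H_def L2_add L2_scaleR L2_inner_add_left L2_inner_scaleR_left subset_iff)
  have bdd: "bdd_below D"
    unfolding D_def by (rule bdd_belowI2[of _ 0]) (rule L2_inner_nonneg)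
  have ne: "D \<noteq> {}"
    using zero by (auto simp: D_def)
  have low: "Inf D \<le> ?N (\<lambda>x. f x - h x)" if "h \<in> H" for h
    using bdd that by (intro cInf_lower) (auto simp: D_def)
  \<comment> \<open>The rate \<open>(1/4)^k\<close> is the one at which the parallelogram law yields
    the geometric increments needed for almost everywhere convergence, without passing to a
    subsequence.\<close>
  have "\<exists>h\<in>H. ?N (\<lambda>x. f x - h x) < Inf D + (1/4)^k" for k
    using cInf_lessD[OF ne, of "Inf D + (1/4)^k"] by (auto simp: D_def)
  then obtain h where hH: "\<And>k. h k \<in> H"
    and hD: "\<And>k. ?N (\<lambda>x. f x - h k x) < Inf D + (1/4)^k"
    by metis
  have hL: "h k \<in> L2 \<Omega>" for k
    using hH by (rule HL)
  \<comment> \<open>The midpoint of \<open>h j\<close> and \<open>h k\<close> lies in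
    \<open>H\<close>, so it cannot be closer to \<open>f\<close> than the infimum; the parallelogram
    law then bounds the difference.\<close>
  have para: "?N (\<lambda>x. h j x - h k x) \<le> 4 * (1/4)^k" if "k \<le> j" for j k
  proof -
    let ?m = "\<lambda>x. (1/2) *\<^sub>R h j x + (1/2) *\<^sub>R h k x"
    define a b where "a = (\<lambda>x. f x - h j x)" and "b = (\<lambda>x. f x - h k x)"
    have ab: "a \<in> L2 \<Omega>" "b \<in> L2 \<Omega>"
      unfolding a_def b_def by (intro L2_diff f hL)+
    have "Inf D \<le> ?N (\<lambda>x. f x - ?m x)"
      by (intro low Hcomb hH)
    also have "(\<lambda>x. f x - ?m x) = (\<lambda>x. (1/2) *\<^sub>R (a x + b x))"
      unfolding a_def b_def by (rule ext) (simp add: algebra_simps flip: scaleR_left_distrib)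
    also have "?N \<dots> = (1/4) * ?N (\<lambda>x. a x + b x)"
      by (simp only: L2_inner_scaleR_left L2_inner_scaleR_right)
    also have "?N (\<lambda>x. a x + b x) = 2 * ?N a + 2 * ?N b - ?N (\<lambda>x. b x - a x)"
      using ab by (simp add: L2_inner_diff_self L2_inner_add_left L2_inner_add_right L2_add
          L2_inner_commute[of \<Omega> b a])
    also have "(\<lambda>x. b x - a x) = (\<lambda>x. h j x - h k x)"
      by (simp add: a_def b_def)
    finally have "?N (\<lambda>x. h j x - h k x) \<le> 2 * ?N a + 2 * ?N b - 4 * Inf D"
      by simp
    also have "\<dots> \<le> 2 * (1/4)^j + 2 * (1/4)^k"
      using hD[of j] hD[of k] by (simp add: a_def b_def)
    also have "\<dots> \<le> 4 * (1/4)^k"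
      using power_decreasing[OF that, of "1/4::real"] by simp
    finally show ?thesis .
  qed
  obtain g where gm: "g \<in> borel_measurable (lebesgue_on \<Omega>)"
    and lim: "AE x in lebesgue_on \<Omega>. (\<lambda>k. h k x) \<longlonglongrightarrow> g x"
    by (rule L2_fast_Cauchy_converges[OF \<Omega> hL, where A = 4]) (auto intro: para)
  have limf: "AE x in lebesgue_on \<Omega>. (\<lambda>k. u x - h k x) \<longlonglongrightarrow> u x - g x" for u
    using lim by eventually_elim (intro tendsto_intros)
  have fg: "(\<lambda>x. f x - g x) \<in> L2 \<Omega>" "?N (\<lambda>x. f x - g x) \<le> Inf D + (1/4)^n" for n
  proof -
    have "?N (\<lambda>x. f x - h k x) \<le> Inf D + (1/4)^n" if "n \<le> k" for n k
    proof -
      have "(1/4::real)^k \<le> (1/4)^n"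
        using that by (intro power_decreasing) auto
      then show ?thesis
        using hD[of k] by linarith
    qed
    note * = L2_Fatou[where h = "\<lambda>k x. f x - h k x", OF L2_diff[OF f hL] _ limf this]
    show "(\<lambda>x. f x - g x) \<in> L2 \<Omega>" "?N (\<lambda>x. f x - g x) \<le> Inf D + (1/4)^n"
      using gm L2_measurable[OF f] by (auto intro: *)
  qed
  have "?N (\<lambda>x. f x - g x) \<le> Inf D"
  proof (rule LIMSEQ_le_const)
    show "(\<lambda>n. Inf D + (1/4)^n) \<longlonglongrightarrow> Inf D"
      using LIMSEQ_power_zero[of "1/4::real"] by (auto intro!: tendsto_eq_intros)
  qed (use fg(2) in auto)
  have gL: "g \<in> L2 \<Omega>"
    using L2_diff[OF f fg(1)] by simp
  have conv: "?N (\<lambda>x. h k x - g x) \<le> 4 * (1/4)^k" for k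
  proof -
    have *: "?N (\<lambda>x. h k x - h j x) \<le> 4 * (1/4)^k" if "k \<le> j" for j
      using para[OF that] by (simp add: L2_inner_def inner_diff_left inner_diff_right inner_commute algebra_simps)
    show ?thesis
      using gm L2_measurable[OF hL[of k]]
      by (intro L2_Fatou(2)[where h = "\<lambda>j x. h k x - h j x", OF L2_diff[OF hL hL] _ limf *]) auto
  qed
  have gH: "g \<in> H"
  proof -
    have "L2_inner \<Omega> g q = 0" if q: "q \<in> Q" for q
    proof -
      have qL: "q \<in> L2 \<Omega>" using q Q by auto
      \<comment> \<open>Since \<open>h k\<close> is orthogonal to \<open>q\<close>, only the error
        \<open>h k - g\<close> contributes, and Young's inequality with weight \<open>2^k\<close>
        makes both of its terms decay.\<close>
      have "2 * \<bar>L2_inner \<Omega> g q\<bar> \<le> (4 + ?N q) * (1/2)^k" for k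
      proof -
        have "L2_inner \<Omega> (\<lambda>x. h k x - g x) q = - L2_inner \<Omega> g q"
          using hH[of k] q qL gL hL by (simp add: L2_inner_diff_left H_def)
        then have "2 * \<bar>L2_inner \<Omega> g q\<bar> \<le> 2^k * ?N (\<lambda>x. h k x - g x) + ?N q / 2^k"
          using L2_inner_young[OF L2_diff[OF hL[of k] gL] qL, of "2^k"] by simp
        also have "\<dots> \<le> 2^k * (4 * (1/4)^k) + ?N q / 2^k"
          using conv[of k] by (intro add_right_mono mult_left_mono) auto
        also have "\<dots> = (4 + ?N q) * (1/2)^k"
        proof -
          have "(2::real)^k * (1/4)^k = (1/2)^k"
            by (simp flip: power_mult_distrib)
          moreover have "2^k * (4 * (1/4)^k) + ?N q / 2^k = 4 * (2^k * (1/4)^k) + ?N q * (1/2)^k"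
            by (simp add: power_one_over)
          ultimately show ?thesis
            by (simp only: distrib_right)
        qed
        finally show ?thesis .
      qed
      moreover have "(\<lambda>k. (4 + ?N q) * (1/2)^k) \<longlonglongrightarrow> 0"
        using LIMSEQ_power_zero[of "1/2::real"] by (auto intro!: tendsto_eq_intros)
      ultimately have "2 * \<bar>L2_inner \<Omega> g q\<bar> \<le> 0"
        by (intro LIMSEQ_le_const) auto
      then show ?thesis by simp
    qed
    then show ?thesis
      using gL by (simp add: H_def)
  qed
  show thesis
  proof (rule that[OF gH])
    fix v assume v: "v \<in> H"
    let ?r = "\<lambda>x. f x - g x"
    let ?i = "L2_inner \<Omega> ?r v"
    have *: "0 \<le> t * t * ?N v - 2 * t * ?i" for t
    proof -
      have "(\<lambda>x. g x + t *\<^sub>R v x) \<in> H"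
        using Hcomb[OF gH v, of 1 t] by simp
      then have "?N ?r \<le> ?N (\<lambda>x. f x - (g x + t *\<^sub>R v x))"
        using low \<open>?N ?r \<le> Inf D\<close> by (blast intro: order_trans)
      also have "(\<lambda>x. f x - (g x + t *\<^sub>R v x)) = (\<lambda>x. ?r x - t *\<^sub>R v x)"
        by (simp add: algebra_simps)
      also have "?N \<dots> = ?N ?r - 2 * t * ?i + t * t * ?N v"
        using fg(1) HL[OF v] by (subst L2_inner_diff_self)
          (auto simp: L2_scaleR L2_inner_scaleR_left L2_inner_scaleR_right)
      finally show ?thesis by simp
    qed
    \<comment> \<open>The optimal variation would be \<open>?i / ?N v\<close>; adding 1 to the
      denominator covers \<open>?N v = 0\<close> and still leaves a negative factor
      \<open>?N v - 2 * a\<close>.\<close>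
    define a where "a = ?N v + 1"
    have a: "a > 0" unfolding a_def using L2_inner_nonneg[of \<Omega> v] by linarith
    have "0 \<le> (?i / a) * (?i / a) * ?N v - 2 * (?i / a) * ?i" by (rule *)
    also have "\<dots> = (?i / a)\<^sup>2 * (?N v - 2 * a)"
      using a by (simp add: power2_eq_square field_simps)
    finally have "0 \<le> (?i / a)\<^sup>2 * (?N v - 2 * a)" .
    moreover have "?N v - 2 * a < 0"
      using a by (simp add: a_def)
    ultimately have "(?i / a)\<^sup>2 \<le> 0"
      by (metis mult_pos_neg not_less linorder_not_le)
    then show "?i = 0"
      using a by simp
  qed
qed

section \<open>Classical partial derivatives\<close>

lemma pd_eqI: "(f has_derivative D) (at x) \<Longrightarrow> pd e f x = D e"
  unfolding pd_def by (metis frechet_derivative_at)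

lemma has_derivative_pd:
  "f differentiable (at x) \<Longrightarrow> (f has_derivative (\<lambda>h. pd h f x)) (at x)"
  unfolding pd_def by (simp add: frechet_derivative_works[symmetric])

lemma pd_add_direction:
  "f differentiable (at x) \<Longrightarrow> pd (a + b) f x = pd a f x + pd b f x"
  unfolding pd_def by (rule linear_add[OF linear_frechet_derivative])

lemma pd_scaleR_direction:
  "f differentiable (at x) \<Longrightarrow> pd (c *\<^sub>R a) f x = c *\<^sub>R pd a f x"
  unfolding pd_def by (rule linear_cmul[OF linear_frechet_derivative])

lemma pd_sum_direction:
  "f differentiable (at x) \<Longrightarrow> pd (\<Sum>i\<in>I. a i) f x = (\<Sum>i\<in>I. pd (a i) f x)"
  unfolding pd_def by (rule linear_sum[OF linear_frechet_derivative])

lemma pd_Basis_expansion: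
  "f differentiable (at x) \<Longrightarrow> pd e f x = (\<Sum>i\<in>Basis. (e \<bullet> i) *\<^sub>R pd i f x)"
  using pd_sum_direction[of f x "\<lambda>i. (e \<bullet> i) *\<^sub>R i" Basis]
  by (simp add: euclidean_representation pd_scaleR_direction)

lemma pd_cong_open:
  assumes "open S" "x \<in> S" "\<And>y. y \<in> S \<Longrightarrow> f y = g y" "f differentiable (at x)"
  shows "g differentiable (at x)" "pd e g x = pd e f x"
proof -
  have "(g has_derivative (\<lambda>h. pd h f x)) (at x)"
    using has_derivative_transform_within_open[OF has_derivative_pd[OF assms(4)] assms(1-3)] .
  then show "g differentiable (at x)" "pd e g x = pd e f x"
    by (auto simp: differentiable_def intro: pd_eqI)
qed

lemma pd_const [simp]: "pd e (\<lambda>_. c) x = 0"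
  by (rule pd_eqI[where D = "\<lambda>_. 0"]) simp

lemma pd_bounded_linear: "bounded_linear f \<Longrightarrow> pd e f x = f e"
  by (rule pd_eqI) (rule bounded_linear_imp_has_derivative)

lemma pd_add:
  assumes "f differentiable (at x)" "g differentiable (at x)"
  shows "pd e (\<lambda>x. f x + g x) x = pd e f x + pd e g x"
  by (rule pd_eqI[where D = "\<lambda>e. pd e f x + pd e g x"])
     (intro has_derivative_add has_derivative_pd assms)

lemma pd_diff:
  assumes "f differentiable (at x)" "g differentiable (at x)"
  shows "pd e (\<lambda>x. f x - g x) x = pd e f x - pd e g x"
  by (rule pd_eqI[where D = "\<lambda>e. pd e f x - pd e g x"])
     (intro has_derivative_diff has_derivative_pd assms)

lemma pd_scaleR:
  fixes f :: "'a::euclidean_space \<Rightarrow> real"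
  assumes "f differentiable (at x)" "g differentiable (at x)"
  shows "pd e (\<lambda>x. f x *\<^sub>R g x) x = f x *\<^sub>R pd e g x + pd e f x *\<^sub>R g x"
  by (rule pd_eqI[where D = "\<lambda>e. f x *\<^sub>R pd e g x + pd e f x *\<^sub>R g x"])
     (intro has_derivative_scaleR has_derivative_pd assms)

lemma pd_mult:
  fixes f g :: "'a::euclidean_space \<Rightarrow> real"
  assumes "f differentiable (at x)" "g differentiable (at x)"
  shows "pd e (\<lambda>x. f x * g x) x = f x * pd e g x + pd e f x * g x"
  using pd_scaleR[OF assms] by simp

lemma pd_compose_bounded_linear:
  assumes "bounded_linear L" "f differentiable (at x)"
  shows "pd e (\<lambda>x. L (f x)) x = L (pd e f x)"
  by (rule pd_eqI[where D = "\<lambda>e. L (pd e f x)"])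
     (intro bounded_linear.has_derivative[OF assms(1)] has_derivative_pd assms)

lemma pd_compose_real:
  fixes f :: "'a::euclidean_space \<Rightarrow> real" and h :: "real \<Rightarrow> real"
  assumes "f differentiable (at x)" "h differentiable (at (f x))"
  shows "pd e (\<lambda>x. h (f x)) x = pd 1 h (f x) * pd e f x"
proof -
  have "pd e (\<lambda>x. h (f x)) x = pd (pd e f x) h (f x)"
    by (rule pd_eqI[where D = "\<lambda>e. pd (pd e f x) h (f x)"])
       (rule has_derivative_compose[OF has_derivative_pd has_derivative_pd, OF assms])
  also have "\<dots> = pd e f x * pd 1 h (f x)"
    using pd_scaleR_direction[OF assms(2), of "pd e f x" 1] by simp
  finally show ?thesis by (simp add: mult.commute)
qed

lemma has_real_derivative_pd:
  fixes h :: "real \<Rightarrow> real"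
  assumes "h differentiable (at t)"
  shows "(h has_real_derivative pd 1 h t) (at t)"
proof -
  have "pd e h t = pd 1 h t * e" for e
    using pd_scaleR_direction[OF assms, of e 1] by simp
  then have "(\<lambda>e. pd e h t) = (*) (pd 1 h t)"
    by (rule ext)
  then show ?thesis
    using has_derivative_pd[OF assms] by (simp add: has_field_derivative_def)
qed

lemma pd_real_eqI: "(h has_real_derivative d) (at t) \<Longrightarrow> pd 1 h t = d"
  using pd_eqI[of h "(*) d" t 1] by (simp add: has_field_derivative_def)

lemma pd_line_derivative:
  fixes f :: "'a::euclidean_space \<Rightarrow> real"
  assumes "f differentiable (at (x + t *\<^sub>R e))"
  shows "((\<lambda>t. f (x + t *\<^sub>R e)) has_real_derivative pd e f (x + t *\<^sub>R e)) (at t)"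
proof -
  have "((\<lambda>t. f (x + t *\<^sub>R e)) has_derivative (\<lambda>s. pd (s *\<^sub>R e) f (x + t *\<^sub>R e))) (at t)"
    by (rule has_derivative_compose[where f = "\<lambda>t. x + t *\<^sub>R e" and g = f])
       (use has_derivative_pd[OF assms] in \<open>auto intro!: derivative_eq_intros\<close>)
  then show ?thesis
    by (simp add: has_field_derivative_def pd_scaleR_direction[OF assms] mult_commute_abs)
qed


section \<open>Calculus of functions of class \<open>C\<^sup>k\<close> on the whole space\<close>

lemma Ck_on_SucD:
  assumes "Ck_on (Suc k) S f"
  shows "\<And>x. x \<in> S \<Longrightarrow> f differentiable (at x)" "\<And>i. i \<in> Basis \<Longrightarrow> Ck_on k S (pd i f)"
  using assms by auto

lemma Ck_on_SucI:
  assumes "\<And>x. x \<in> S \<Longrightarrow> f differentiable (at x)" "\<And>i. i \<in> Basis \<Longrightarrow> Ck_on k S (pd i f)"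
  shows "Ck_on (Suc k) S f"
  using assms by auto

lemma Ck_on_Suc_imp: "Ck_on (Suc k) S f \<Longrightarrow> Ck_on k S f"
proof (induction k arbitrary: f)
  case 0
  then show ?case
    by (auto simp: continuous_on_eq_continuous_at intro!: differentiable_imp_continuous_within
        continuous_at_imp_continuous_on)
next
  case (Suc k)
  from Suc.prems have "\<And>x. x \<in> S \<Longrightarrow> f differentiable (at x)"
    and "\<And>i. i \<in> Basis \<Longrightarrow> Ck_on (Suc k) S (pd i f)"
    using Ck_on_SucD[of "Suc k"] by blast+
  then show ?case
    using Suc.IH by (intro Ck_on_SucI[of S f k]) simp_all
qed

lemma Ck_on_mono: "Ck_on k S f \<Longrightarrow> j \<le> k \<Longrightarrow> Ck_on j S f"
  by (induction k) (auto simp: le_Suc_eq simp del: Ck_on.simps dest: Ck_on_Suc_imp)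

lemma Ck_on_continuous: "Ck_on k S f \<Longrightarrow> continuous_on S f"
  using Ck_on_mono[of k S f 0] by simp

lemma Ck_on_differentiable: "Ck_on k S f \<Longrightarrow> 1 \<le> k \<Longrightarrow> x \<in> S \<Longrightarrow> f differentiable (at x)"
  using Ck_on_mono[of k S f 1] by simp

lemma Ck_const: "Ck_on k UNIV (\<lambda>_. c)"
proof (induction k arbitrary: c)
  case (Suc k)
  have "pd i (\<lambda>_. c) = (\<lambda>_. 0)" for i :: 'a
    by (rule ext) simp
  with Suc show ?case by auto
qed auto

lemma Ck_bounded_linear:
  assumes "bounded_linear f"
  shows "Ck_on k UNIV f"
proof (cases k)
  case 0
  then show ?thesis
    using assms by (auto intro: linear_continuous_on)
next
  case (Suc j)
  have "pd i f = (\<lambda>_. f i)" for i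
    using assms by (auto simp: pd_bounded_linear)
  then show ?thesis
    using Suc assms Ck_const by (auto intro: bounded_linear_imp_differentiable)
qed

lemma Ck_inner: "Ck_on k UNIV (\<lambda>x::'a::euclidean_space. x \<bullet> e)"
  by (rule Ck_bounded_linear[OF bounded_linear_inner_left])

lemma Ck_add: "Ck_on k UNIV f \<Longrightarrow> Ck_on k UNIV g \<Longrightarrow> Ck_on k UNIV (\<lambda>x. f x + g x)"
proof (induction k arbitrary: f g)
  case 0
  then show ?case by (auto intro: continuous_intros)
next
  case (Suc k)
  then have "pd i (\<lambda>x. f x + g x) = (\<lambda>x. pd i f x + pd i g x)" for i
    by (auto simp: pd_add)
  with Suc show ?case by auto
qed

lemma Ck_sum:
  "(\<And>i. i \<in> I \<Longrightarrow> Ck_on k UNIV (f i)) \<Longrightarrow> Ck_on k UNIV (\<lambda>x. \<Sum>i\<in>I. f i x)"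
  by (induction I rule: infinite_finite_induct) (auto intro: Ck_const Ck_add)

lemma Ck_scaleR:
  fixes f :: "'a::euclidean_space \<Rightarrow> real"
  shows "Ck_on k UNIV f \<Longrightarrow> Ck_on k UNIV g \<Longrightarrow> Ck_on k UNIV (\<lambda>x. f x *\<^sub>R g x)"
proof (induction k arbitrary: f g)
  case 0
  then show ?case by (auto intro: continuous_intros)
next
  case (Suc k)
  then have "pd i (\<lambda>x. f x *\<^sub>R g x) = (\<lambda>x. f x *\<^sub>R pd i g x + pd i f x *\<^sub>R g x)" for i
    by (auto simp: pd_scaleR)
  moreover have "Ck_on k UNIV (\<lambda>x. f x *\<^sub>R pd i g x + pd i f x *\<^sub>R g x)" if "i \<in> Basis" for i
    by (intro Ck_add Suc.IH Ck_on_Suc_imp[OF Suc.prems(1)] Ck_on_Suc_imp[OF Suc.prems(2)]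
        Ck_on_SucD(2)[OF Suc.prems(1) that] Ck_on_SucD(2)[OF Suc.prems(2) that])
  ultimately show ?case
    using Suc.prems by simp
qed

lemma Ck_mult:
  fixes f g :: "'a::euclidean_space \<Rightarrow> real"
  shows "Ck_on k UNIV f \<Longrightarrow> Ck_on k UNIV g \<Longrightarrow> Ck_on k UNIV (\<lambda>x. f x * g x)"
  using Ck_scaleR[of k f g] by simp

lemma Ck_cmult:
  fixes f :: "'a::euclidean_space \<Rightarrow> real"
  shows "Ck_on k UNIV f \<Longrightarrow> Ck_on k UNIV (\<lambda>x. c * f x)"
  by (rule Ck_mult[OF Ck_const])

lemma Ck_diff:
  assumes "Ck_on k UNIV f" "Ck_on k UNIV g"
  shows "Ck_on k UNIV (\<lambda>x. f x - g x)"
  using Ck_add[OF assms(1) Ck_scaleR[OF Ck_const assms(2), of "-1"]] by simp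

lemma Ck_power:
  fixes f :: "'a::euclidean_space \<Rightarrow> real"
  shows "Ck_on k UNIV f \<Longrightarrow> Ck_on k UNIV (\<lambda>x. f x ^ n)"
  by (induction n) (auto intro: Ck_const Ck_mult)

lemma Ck_compose_real:
  fixes f :: "'a::euclidean_space \<Rightarrow> real" and h :: "real \<Rightarrow> real"
  shows "Ck_on k UNIV h \<Longrightarrow> Ck_on k UNIV f \<Longrightarrow> Ck_on k UNIV (\<lambda>x. h (f x))"
proof (induction k arbitrary: h)
  case 0
  then show ?case
    by (auto intro: continuous_on_compose2[of UNIV h UNIV f])
next
  case (Suc k)
  have d: "f differentiable (at x)" "h differentiable (at y)" for x y
    using Suc.prems by auto
  have "pd i (\<lambda>x. h (f x)) = (\<lambda>x. pd 1 h (f x) * pd i f x)" for i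
    by (rule ext) (simp add: pd_compose_real d)
  moreover have "Ck_on k UNIV (\<lambda>x. pd 1 h (f x) * pd i f x)" if "i \<in> Basis" for i
  proof (rule Ck_mult)
    show "Ck_on k UNIV (\<lambda>x. pd 1 h (f x))"
      by (rule Suc.IH[OF _ Ck_on_Suc_imp[OF Suc.prems(2)]]) (use Ck_on_SucD(2)[OF Suc.prems(1)] in simp)
    show "Ck_on k UNIV (pd i f)"
      by (rule Ck_on_SucD(2)[OF Suc.prems(2) that])
  qed
  moreover have "(\<lambda>x. h (f x)) differentiable (at x)" for x
    using differentiable_chain_at[OF d] by (simp add: o_def)
  ultimately show ?case
    by simp
qed

lemma Ck_pd:
  assumes "Ck_on (Suc k) UNIV f"
  shows "Ck_on k UNIV (pd e f)"
proof -
  have "pd e f = (\<lambda>x. \<Sum>i\<in>Basis. (e \<bullet> i) *\<^sub>R pd i f x)"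
    using assms by (auto simp: pd_Basis_expansion)
  moreover have "Ck_on k UNIV (\<lambda>x. \<Sum>i\<in>Basis. (e \<bullet> i) *\<^sub>R pd i f x)"
    using assms by (intro Ck_sum Ck_scaleR Ck_const) auto
  ultimately show ?thesis by simp
qed

lemma Ck_closure_if_Ck: "Ck_on k UNIV f \<Longrightarrow> Ck_closure k S f"
proof (induction k arbitrary: f)
  case 0
  then show ?case by (auto intro: continuous_on_subset)
next
  case (Suc k)
  then show ?case
    using continuous_on_subset[OF Ck_on_continuous[OF Suc.prems] subset_UNIV]
    unfolding Ck_closure.simps(2) Ck_on.simps(2) by blast
qed

lemma has_real_derivative_max_power:
  "((\<lambda>t::real. (max 0 t) ^ Suc (Suc n)) has_real_derivative (real n + 2) * (max 0 t) ^ Suc n) (at t)"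
proof -
  consider "t > 0" | "t < 0" | "t = 0" by linarith
  then show ?thesis
  proof cases
    case 1
    have "((\<lambda>t::real. t ^ Suc (Suc n)) has_real_derivative (real n + 2) * t ^ Suc n) (at t)"
      by (rule DERIV_cong[OF DERIV_pow]) simp
    then have "((\<lambda>t::real. (max 0 t) ^ Suc (Suc n)) has_real_derivative (real n + 2) * t ^ Suc n) (at t)"
      by (rule has_field_derivative_transform_within_open[of _ _ t "{0<..}"])
        (use 1 in \<open>simp_all add: max_absorb2\<close>)
    then show ?thesis
      using 1 by (simp only: max_absorb2 less_imp_le)
  next
    case 2
    have "((\<lambda>t::real. (max 0 t) ^ Suc (Suc n)) has_real_derivative 0) (at t)"
      by (rule has_field_derivative_transform_within_open[of "\<lambda>_. 0" _ t "{..<0}"])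
        (use 2 in \<open>simp_all add: max_absorb1\<close>)
    then show ?thesis
      using 2 by (simp add: max_absorb1)
  next
    case 3
    have "((\<lambda>h::real. (max 0 h) ^ Suc (Suc n) / h) \<longlongrightarrow> 0) (at 0)"
    proof (rule Lim_null_comparison)
      show "\<forall>\<^sub>F h in at (0::real). norm ((max 0 h) ^ Suc (Suc n) / h) \<le> (max 0 h) ^ Suc n"
      proof (rule always_eventually, rule allI)
        fix h :: real
        show "norm ((max 0 h) ^ Suc (Suc n) / h) \<le> (max 0 h) ^ Suc n"
          by (cases "h > 0") (simp_all add: max_absorb1 max_absorb2)
      qed
      have "((\<lambda>h::real. (max 0 h) ^ Suc n) \<longlongrightarrow> (max 0 0) ^ Suc n) (at 0)"
        by (intro tendsto_intros)
      then show "((\<lambda>h::real. (max 0 h) ^ Suc n) \<longlongrightarrow> 0) (at 0)" by simp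
    qed
    then show ?thesis
      unfolding 3 DERIV_def by (simp only: add_0 max.idem power_0_Suc mult_zero_right diff_zero)
  qed
qed

text \<open>Truncated powers are the raw material of every cutoff below; the exponent fixes the
  order of smoothness. Differentiation lowers the exponent by one, which drives the
  induction.\<close>

lemma Ck_max_power: "Ck_on k UNIV (\<lambda>t::real. (max 0 t) ^ Suc k)"
proof (induction k)
  case 0
  then show ?case by (auto intro: continuous_intros)
next
  case (Suc k)
  have "pd 1 (\<lambda>t::real. (max 0 t) ^ Suc (Suc k)) = (\<lambda>t. (real k + 2) * (max 0 t) ^ Suc k)"
    by (rule ext) (rule pd_real_eqI[OF has_real_derivative_max_power])
  moreover have "(\<lambda>t::real. (max 0 t) ^ Suc (Suc k)) differentiable (at t)" for t
    using has_real_derivative_max_power[of k t] by (auto simp: real_differentiable_def)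
  ultimately show ?case
    using Suc by (simp del: power_Suc add: Ck_cmult)
qed

section \<open>Symmetry of second derivatives\<close>

lemma second_difference_mean_value:
  fixes f :: "'a::euclidean_space \<Rightarrow> real"
  assumes f: "Ck_on 2 UNIV f" and h: "h > 0"
  obtains s t where "0 < s" "s < h" "0 < t" "t < h"
    "f (x + h *\<^sub>R a + h *\<^sub>R b) - f (x + h *\<^sub>R a) - f (x + h *\<^sub>R b) + f x
       = h * h * pd b (pd a f) (x + s *\<^sub>R a + t *\<^sub>R b)"
proof -
  have C1: "Ck_on 1 UNIV (pd a f)"
    using f by (intro Ck_pd) (simp add: numeral_2_eq_2)
  have d: "f differentiable (at y)" "pd a f differentiable (at y)" for y
    using Ck_on_differentiable[OF f] Ck_on_differentiable[OF C1] by auto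
  let ?\<phi> = "\<lambda>s. f ((x + h *\<^sub>R b) + s *\<^sub>R a) - f (x + s *\<^sub>R a)"
  have "(?\<phi> has_real_derivative pd a f ((x + h *\<^sub>R b) + s *\<^sub>R a) - pd a f (x + s *\<^sub>R a)) (at s)" for s
    by (intro DERIV_diff pd_line_derivative d)
  then obtain s where s: "0 < s" "s < h"
    "?\<phi> h - ?\<phi> 0 = (h - 0) * (pd a f ((x + h *\<^sub>R b) + s *\<^sub>R a) - pd a f (x + s *\<^sub>R a))"
    using MVT2[OF h, of ?\<phi> "\<lambda>s. pd a f ((x + h *\<^sub>R b) + s *\<^sub>R a) - pd a f (x + s *\<^sub>R a)"]
    by blast
  have "((\<lambda>t. pd a f ((x + s *\<^sub>R a) + t *\<^sub>R b)) has_real_derivative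
      pd b (pd a f) ((x + s *\<^sub>R a) + t *\<^sub>R b)) (at t)" for t
    by (intro pd_line_derivative d)
  then obtain t where t: "0 < t" "t < h"
    "pd a f ((x + s *\<^sub>R a) + h *\<^sub>R b) - pd a f ((x + s *\<^sub>R a) + 0 *\<^sub>R b)
      = (h - 0) * pd b (pd a f) ((x + s *\<^sub>R a) + t *\<^sub>R b)"
    using MVT2[OF h, of "\<lambda>t. pd a f ((x + s *\<^sub>R a) + t *\<^sub>R b)"
        "\<lambda>t. pd b (pd a f) ((x + s *\<^sub>R a) + t *\<^sub>R b)"] by blast
  show thesis
    using s t by (intro that[of s t]) (auto simp: algebra_simps)
qed

text \<open>The second difference quotient is symmetric in \<open>a\<close> and \<open>b\<close>.
  The mean value form, applied in both orders, shows that it converges to either mixed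
  derivative.\<close>

lemma pd_commute:
  fixes f :: "'a::euclidean_space \<Rightarrow> real"
  assumes f: "Ck_on 2 UNIV f"
  shows "pd a (pd b f) x = pd b (pd a f) x"
proof -
  define h :: "nat \<Rightarrow> real" where "h n = 1 / real (Suc n)" for n
  have h: "h n > 0" for n by (simp add: h_def)
  have h0: "h \<longlonglongrightarrow> 0"
    unfolding h_def by (rule LIMSEQ_Suc[OF lim_1_over_n])
  define \<Delta> where "\<Delta> n = (f (x + h n *\<^sub>R a + h n *\<^sub>R b) - f (x + h n *\<^sub>R a) - f (x + h n *\<^sub>R b) + f x)
      / (h n * h n)" for n
  have lim: "(\<lambda>n. D (x + s n *\<^sub>R a + t n *\<^sub>R b)) \<longlonglongrightarrow> D x"
    if "continuous_on UNIV D" and st: "\<And>n. 0 < s n \<and> s n < h n" "\<And>n. 0 < t n \<and> t n < h n"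
    for D :: "'a \<Rightarrow> real" and s t
  proof -
    have "s \<longlonglongrightarrow> 0"
      by (rule tendsto_sandwich[OF _ _ tendsto_const h0]) (use st in \<open>auto intro: less_imp_le always_eventually\<close>)
    moreover have "t \<longlonglongrightarrow> 0"
      by (rule tendsto_sandwich[OF _ _ tendsto_const h0]) (use st in \<open>auto intro: less_imp_le always_eventually\<close>)
    ultimately have "(\<lambda>n. x + s n *\<^sub>R a + t n *\<^sub>R b) \<longlonglongrightarrow> x + 0 *\<^sub>R a + 0 *\<^sub>R b"
      by (intro tendsto_intros)
    then show ?thesis
      using \<open>continuous_on UNIV D\<close>
      by (intro continuous_on_tendsto_compose[where s = UNIV and f = D]) auto
  qed
  have cont: "continuous_on UNIV (pd c (pd d f))" for c d
    using f by (intro Ck_on_continuous[of 0] Ck_pd) (simp add: numeral_2_eq_2)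
  have "\<exists>s t. 0 < s \<and> s < h n \<and> 0 < t \<and> t < h n \<and> \<Delta> n = pd b (pd a f) (x + s *\<^sub>R a + t *\<^sub>R b)" for n
    by (rule second_difference_mean_value[OF f h[of n], of x a b])
      (use h[of n] in \<open>auto simp: \<Delta>_def\<close>)
  then obtain s t where st: "\<And>n. 0 < s n \<and> s n < h n" "\<And>n. 0 < t n \<and> t n < h n"
    "\<And>n. \<Delta> n = pd b (pd a f) (x + s n *\<^sub>R a + t n *\<^sub>R b)"
    by metis
  have 1: "\<Delta> \<longlonglongrightarrow> pd b (pd a f) x"
    using lim[OF cont st(1,2), of b a] by (simp add: st(3)[symmetric])
  have \<Delta>: "\<Delta> n = (f (x + h n *\<^sub>R b + h n *\<^sub>R a) - f (x + h n *\<^sub>R b) - f (x + h n *\<^sub>R a) + f x)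
      / (h n * h n)" for n
    by (simp add: \<Delta>_def algebra_simps)
  have "\<exists>s t. 0 < s \<and> s < h n \<and> 0 < t \<and> t < h n \<and> \<Delta> n = pd a (pd b f) (x + t *\<^sub>R a + s *\<^sub>R b)" for n
    by (rule second_difference_mean_value[OF f h[of n], of x b a])
      (use h[of n] in \<open>auto simp: \<Delta> add.commute[of "_ *\<^sub>R a"] add.assoc\<close>)
  then obtain s t where st: "\<And>n. 0 < s n \<and> s n < h n" "\<And>n. 0 < t n \<and> t n < h n"
    "\<And>n. \<Delta> n = pd a (pd b f) (x + t n *\<^sub>R a + s n *\<^sub>R b)"
    by metis
  have 2: "\<Delta> \<longlonglongrightarrow> pd a (pd b f) x"
    using lim[OF cont st(2,1), of a b] by (simp add: st(3)[symmetric])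
  show ?thesis
    using LIMSEQ_unique[OF 2 1] .
qed

section \<open>Integration by parts\<close>

lemma C1_continuous_pd: "Ck_on 1 UNIV f \<Longrightarrow> continuous_on UNIV (pd e f)"
  using Ck_pd[of 0 f e] by simp

lemma C1_differentiable: "Ck_on 1 UNIV f \<Longrightarrow> f differentiable (at x)"
  by simp

lemma lborel_integral_shift:
  fixes f :: "'a::euclidean_space \<Rightarrow> real"
  assumes "f \<in> borel_measurable borel"
  shows "(\<integral>x. f (x + c) \<partial>lborel) = (\<integral>x. f x \<partial>lborel)"
proof -
  have "(\<integral>x. f x \<partial>lborel) = (\<integral>x. f x \<partial>distr lborel borel ((+) c))"
    by (simp add: lborel_distr_plus)
  also have "\<dots> = (\<integral>x. f (c + x) \<partial>lborel)"
    using assms by (intro integral_distr) auto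
  finally show ?thesis by (simp add: add.commute)
qed

lemma integrable_continuous_bounded_support:
  fixes f :: "'a::euclidean_space \<Rightarrow> real"
  assumes "continuous_on UNIV f" "bounded {x. f x \<noteq> 0}"
  shows "integrable lborel f"
proof -
  obtain R where R: "\<And>x. f x \<noteq> 0 \<Longrightarrow> norm x \<le> R"
    using assms(2) by (auto simp: bounded_iff)
  have "integrable lborel (\<lambda>x. indicator (cball 0 R) x *\<^sub>R f x)"
    using assms(1) by (intro borel_integrable_compact) (auto intro: continuous_on_subset)
  also have "(\<lambda>x. indicator (cball 0 R) x *\<^sub>R f x) = f"
    using R by (auto simp: indicator_def fun_eq_iff)
  finally show ?thesis .
qed

lemma bounded_support_times:
  fixes f g :: "'a::euclidean_space \<Rightarrow> real"
  shows "bounded {x. f x \<noteq> 0} \<Longrightarrow> bounded {x. f x * g x \<noteq> 0}"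
    "bounded {x. f x \<noteq> 0} \<Longrightarrow> bounded {x. g x * f x \<noteq> 0}"
  by (rule bounded_subset, assumption, auto)+

lemma pd_eq_0_outside:
  assumes "closed S" "\<And>x. x \<notin> S \<Longrightarrow> f x = 0" "x \<notin> S"
  shows "pd a f x = 0"
  using pd_cong_open(2)[of "- S" x "\<lambda>_. 0" f a] assms by auto

lemma bounded_support_pd:
  assumes "bounded {x. f x \<noteq> 0}"
  shows "bounded {x. pd a f x \<noteq> 0}"
proof (rule bounded_subset[OF bounded_closure[OF assms]])
  show "{x. pd a f x \<noteq> 0} \<subseteq> closure {x. f x \<noteq> 0}"
  proof (rule subsetI, rule ccontr)
    fix x assume "x \<in> {x. pd a f x \<noteq> 0}" "x \<notin> closure {x. f x \<noteq> 0}"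
    moreover have "f y = 0" if "y \<notin> closure {x. f x \<noteq> 0}" for y
      using that closure_subset[of "{x. f x \<noteq> 0}"] by blast
    ultimately show False
      using pd_eq_0_outside[OF closed_closure, of "{x. f x \<noteq> 0}" f x a] by blast
  qed
qed

lemma continuous_bounded_support_bounded:
  fixes f :: "'a::euclidean_space \<Rightarrow> real"
  assumes "continuous_on UNIV f" "bounded {x. f x \<noteq> 0}"
  obtains M where "\<And>x. \<bar>f x\<bar> \<le> M" "0 \<le> M"
proof -
  have "compact (closure {x. f x \<noteq> 0})"
    using assms(2) by (simp add: compact_closure)
  then have "bounded (f ` closure {x. f x \<noteq> 0})"
    using assms(1) by (intro compact_imp_bounded compact_continuous_image) (auto intro: continuous_on_subset)
  then obtain M where M: "\<And>x. x \<in> closure {x. f x \<noteq> 0} \<Longrightarrow> \<bar>f x\<bar> \<le> M"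
    by (auto simp: bounded_iff)
  have "\<bar>f x\<bar> \<le> max 0 M" for x
    using M[of x] closure_subset[of "{x. f x \<noteq> 0}"] by (cases "f x = 0") force+
  then show thesis
    using that[of "max 0 M"] by auto
qed

lemma difference_quotient_bound:
  fixes f :: "'a::euclidean_space \<Rightarrow> real"
  assumes f: "\<And>x. f differentiable (at x)" and M: "\<And>x. \<bar>pd a f x\<bar> \<le> M"
  shows "\<bar>(f (x + h *\<^sub>R a) - f x) / h\<bar> \<le> M"
proof (cases "h = 0")
  case True
  then show ?thesis using order_trans[OF abs_ge_zero M[of x]] by simp
next
  case False
  have der: "((\<lambda>t. f (x + t *\<^sub>R a)) has_real_derivative pd a f (x + t *\<^sub>R a)) (at t)" for t
    by (rule pd_line_derivative[OF f])
  have "norm (f (x + h *\<^sub>R a) - f (x + 0 *\<^sub>R a)) \<le> M * norm (h - 0)"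
  proof (rule field_differentiable_bound[of UNIV])
    show "((\<lambda>t. f (x + t *\<^sub>R a)) has_field_derivative pd a f (x + t *\<^sub>R a)) (at t within UNIV)" for t
      using der by simp
  qed (use M in auto)
  then show ?thesis
    using False by (simp add: field_simps)
qed

lemma difference_quotient_tendsto:
  fixes f :: "'a::euclidean_space \<Rightarrow> real"
  assumes f: "f differentiable (at x)" and h: "h \<longlonglongrightarrow> 0" "\<And>n::nat. h n \<noteq> 0"
  shows "(\<lambda>n. (f (x + h n *\<^sub>R a) - f x) / h n) \<longlonglongrightarrow> pd a f x"
proof -
  have "((\<lambda>t. f (x + t *\<^sub>R a)) has_real_derivative pd a f x) (at 0)"
    using pd_line_derivative[of f x 0 a] f by simp
  then have "((\<lambda>t. (f (x + t *\<^sub>R a) - f x) / t) \<longlongrightarrow> pd a f x) (at 0)"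
    by (simp add: DERIV_def)
  then show ?thesis
    by (rule filterlim_compose) (use h in \<open>auto simp: filterlim_at\<close>)
qed

lemma null_sequence:
  obtains h :: "nat \<Rightarrow> real" where "h \<longlonglongrightarrow> 0" "\<And>n. 0 < h n" "\<And>n. h n \<le> 1"
proof
  show "(\<lambda>n. 1 / real (Suc n)) \<longlonglongrightarrow> 0"
    by (rule LIMSEQ_Suc[OF lim_1_over_n])
qed auto

text \<open>By translation invariance every difference quotient of \<open>g\<close> has integral 0;
  dominated convergence carries this over to the derivative.\<close>

lemma integral_pd_eq_0:
  fixes g :: "'a::euclidean_space \<Rightarrow> real"
  assumes g: "Ck_on 1 UNIV g" and supp: "bounded {x. g x \<noteq> 0}"
  shows "(\<integral>x. pd a g x \<partial>lborel) = 0"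
proof -
  obtain h :: "nat \<Rightarrow> real" where h: "h \<longlonglongrightarrow> 0" "\<And>n. 0 < h n" "\<And>n. h n \<le> 1"
    by (rule null_sequence) blast
  have gd: "g differentiable (at x)" for x
    using Ck_on_differentiable[OF g] by simp
  have gc: "continuous_on UNIV g"
    using g by (rule Ck_on_continuous)
  have pc: "continuous_on UNIV (pd a g)"
    using g by (intro Ck_on_continuous[of 0] Ck_pd) simp
  have [measurable]: "g \<in> borel_measurable borel" "pd a g \<in> borel_measurable borel"
    using gc pc by (auto intro: borel_measurable_continuous_onI)
  obtain M where M: "\<And>x. \<bar>pd a g x\<bar> \<le> M" "0 \<le> M"
    by (rule continuous_bounded_support_bounded[OF pc bounded_support_pd[OF supp]]) blast
  obtain R where R: "\<And>x. g x \<noteq> 0 \<Longrightarrow> norm x \<le> R"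
    using supp by (auto simp: bounded_iff)
  let ?d = "\<lambda>n x. (g (x + h n *\<^sub>R a) - g x) / h n"
  have "(\<lambda>n. \<integral>x. ?d n x \<partial>lborel) \<longlonglongrightarrow> (\<integral>x. pd a g x \<partial>lborel)"
  proof (rule integral_dominated_convergence)
    \<comment> \<open>Because the steps satisfy \<open>h n \<le> 1\<close>, the supports of all
      shifted copies lie in the ball of radius \<open>R + norm a\<close>.\<close>
    show "integrable lborel (\<lambda>x. M * indicator (cball 0 (R + norm a)) x :: real)"
      using emeasure_lborel_cbox_finite emeasure_bounded_finite[of "cball 0 (R + norm a)"]
      by (intro integrable_mult_right integrable_real_indicator) auto
    show "AE x in lborel. (\<lambda>n. ?d n x) \<longlonglongrightarrow> pd a g x"
      using h by (intro AE_I2 difference_quotient_tendsto gd) (auto simp: less_imp_neq[symmetric])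
    show "AE x in lborel. norm (?d n x) \<le> M * indicator (cball 0 (R + norm a)) x" for n
    proof (rule AE_I2)
      fix x
      show "norm (?d n x) \<le> M * indicator (cball 0 (R + norm a)) x"
      proof (cases "norm x \<le> R + norm a")
        case True
        then show ?thesis
          using difference_quotient_bound[OF gd M(1), of x "h n"] by simp
      next
        case False
        have "norm x \<le> norm (x + h n *\<^sub>R a) + norm (h n *\<^sub>R a)"
          using norm_triangle_ineq4[of "x + h n *\<^sub>R a" "h n *\<^sub>R a"] by simp
        moreover have "norm (h n *\<^sub>R a) \<le> norm a"
          using h(2,3)[of n] by (simp add: mult_left_le_one_le)
        ultimately have "\<not> norm (x + h n *\<^sub>R a) \<le> R"
          using False by linarith
        moreover have "\<not> norm x \<le> R"
          using False norm_ge_zero[of a] by linarith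
        ultimately have "g (x + h n *\<^sub>R a) = 0" "g x = 0"
          using R by blast+
        then show ?thesis
          using M(2) by simp
      qed
    qed
  qed measurable
  moreover have "(\<lambda>n. \<integral>x. ?d n x \<partial>lborel) = (\<lambda>n. 0)"
  proof (rule ext)
    fix n
    have int: "integrable lborel g"
      by (rule integrable_continuous_bounded_support[OF gc supp])
    have int2: "integrable lborel (\<lambda>x. g (x + h n *\<^sub>R a))"
    proof (rule integrable_continuous_bounded_support)
      show "continuous_on UNIV (\<lambda>x. g (x + h n *\<^sub>R a))"
        by (intro continuous_on_compose2[OF gc] continuous_intros) auto
      have "{x. g (x + h n *\<^sub>R a) \<noteq> 0} \<subseteq> (\<lambda>x. - (h n *\<^sub>R a) + x) ` {x. g x \<noteq> 0}"
        by (auto simp: image_iff intro!: exI[of _ "_ + h n *\<^sub>R a"])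
      then show "bounded {x. g (x + h n *\<^sub>R a) \<noteq> 0}"
        using bounded_translation[OF supp] bounded_subset by blast
    qed
    show "(\<integral>x. ?d n x \<partial>lborel) = 0"
      using int int2 lborel_integral_shift[of g "h n *\<^sub>R a"] by simp
  qed
  ultimately have "(\<lambda>n. 0) \<longlonglongrightarrow> (\<integral>x. pd a g x \<partial>lborel)"
    by (simp only:)
  then show ?thesis
    by (simp add: LIMSEQ_const_iff)
qed

lemma integral_by_parts:
  fixes f g :: "'a::euclidean_space \<Rightarrow> real"
  assumes f: "Ck_on 1 UNIV f" and g: "Ck_on 1 UNIV g" and supp: "bounded {x. f x \<noteq> 0}"
  shows "(\<integral>x. pd a f x * g x \<partial>lborel) = - (\<integral>x. f x * pd a g x \<partial>lborel)"
proof -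
  have c: "continuous_on UNIV f" "continuous_on UNIV g"
    "continuous_on UNIV (pd a f)" "continuous_on UNIV (pd a g)"
    by (rule Ck_on_continuous[OF f] Ck_on_continuous[OF g] C1_continuous_pd[OF f] C1_continuous_pd[OF g])+
  have "0 = (\<integral>x. pd a (\<lambda>x. f x * g x) x \<partial>lborel)"
    using f g supp by (intro integral_pd_eq_0[symmetric] Ck_mult bounded_support_times)
  also have "\<dots> = (\<integral>x. f x * pd a g x + pd a f x * g x \<partial>lborel)"
    using f g by (intro Bochner_Integration.integral_cong) (auto simp: pd_mult)
  also have "\<dots> = (\<integral>x. f x * pd a g x \<partial>lborel) + (\<integral>x. pd a f x * g x \<partial>lborel)"
    using c supp by (intro Bochner_Integration.integral_add integrable_continuous_bounded_support
        continuous_intros bounded_support_times bounded_support_pd)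
  finally show ?thesis by simp
qed

lemma pd_shift: 
  assumes "f differentiable (at (x + c))"
  shows "(\<lambda>x. f (x + c)) differentiable (at x)" "pd a (\<lambda>x. f (x + c)) x = pd a f (x + c)"
proof -
  have "((\<lambda>x. f (x + c)) has_derivative (\<lambda>h. pd h f (x + c))) (at x)"
    by (rule has_derivative_compose[where f = "\<lambda>x. x + c" and g = f])
       (use has_derivative_pd[OF assms] in \<open>auto intro!: derivative_eq_intros\<close>)
  then show "(\<lambda>x. f (x + c)) differentiable (at x)" "pd a (\<lambda>x. f (x + c)) x = pd a f (x + c)"
    by (auto simp: differentiable_def intro: pd_eqI)
qed

lemma Ck_shift: "Ck_on 1 UNIV f \<Longrightarrow> Ck_on 1 UNIV (\<lambda>x. f (x + c))"
proof -
  assume f: "Ck_on 1 UNIV f"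
  then have "pd i (\<lambda>x. f (x + c)) = (\<lambda>x. pd i f (x + c))" for i
    by (intro ext pd_shift(2)) simp
  moreover have "continuous_on UNIV (\<lambda>x. pd i f (x + c))" for i
    by (intro continuous_on_compose2[OF C1_continuous_pd[OF f]] continuous_intros) auto
  ultimately show ?thesis
    using f by (simp add: pd_shift(1))
qed

text \<open>Since \<open>f\<close> and \<open>g\<close> are only of class \<open>C\<^sup>1\<close>, the derivative in direction \<open>a\<close> is moved across as
  a difference quotient, which commutes with the derivative in direction \<open>b\<close>.\<close>

lemma integral_pd_pd_swap:
  fixes f g :: "'a::euclidean_space \<Rightarrow> real"
  assumes f: "Ck_on 1 UNIV f" and g: "Ck_on 1 UNIV g"
    and sf: "bounded {x. f x \<noteq> 0}" and sg: "bounded {x. g x \<noteq> 0}"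
  shows "(\<integral>x. pd a f x * pd b g x \<partial>lborel) = (\<integral>x. pd b f x * pd a g x \<partial>lborel)"
proof -
  obtain h :: "nat \<Rightarrow> real" where h: "h \<longlonglongrightarrow> 0" "\<And>n. 0 < h n" "\<And>n. h n \<le> 1"
    by (rule null_sequence) blast
  have h0: "h n \<noteq> 0" for n using h(2)[of n] by simp
  have d: "f differentiable (at x)" "g differentiable (at x)" for x
    using Ck_on_differentiable f g by auto
  have c: "continuous_on UNIV f" "continuous_on UNIV g"
    "continuous_on UNIV (pd e f)" "continuous_on UNIV (pd e g)" for e
    by (rule Ck_on_continuous[OF f] Ck_on_continuous[OF g] C1_continuous_pd[OF f] C1_continuous_pd[OF g])+
  have [measurable]: "f \<in> borel_measurable borel" "g \<in> borel_measurable borel"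
    "pd e f \<in> borel_measurable borel" "pd e g \<in> borel_measurable borel" for e
    using c by (auto intro: borel_measurable_continuous_onI)
  obtain Mf where Mf: "\<And>x. \<bar>pd a f x\<bar> \<le> Mf" "0 \<le> Mf"
    by (rule continuous_bounded_support_bounded[OF c(3) bounded_support_pd[OF sf]]) blast
  obtain Mg where Mg: "\<And>x. \<bar>pd a g x\<bar> \<le> Mg" "0 \<le> Mg"
    by (rule continuous_bounded_support_bounded[OF c(4) bounded_support_pd[OF sg]]) blast
  have sh: "continuous_on UNIV (\<lambda>x. u (x + c))" if "continuous_on UNIV u" for u :: "'a \<Rightarrow> real" and c
    by (intro continuous_on_compose2[OF that] continuous_intros) auto
  let ?F = "\<lambda>n x. (f (x + h n *\<^sub>R a) - f x) / h n"
  \<comment> \<open>Up to sign, the adjoint of the forward quotient \<open>?F\<close> is the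
    backward quotient. The sign cancels against the one from integrating by parts in direction
    \<open>b\<close>.\<close>
  let ?G = "\<lambda>n x. (g (x + (- h n) *\<^sub>R a) - g x) / (- h n)"
  have eq: "(\<integral>x. ?F n x * pd b g x \<partial>lborel) = (\<integral>x. pd b f x * ?G n x \<partial>lborel)" for n
  proof -
    have F: "Ck_on 1 UNIV (?F n)"
      using Ck_cmult[OF Ck_diff[OF Ck_shift[OF f] f], of "1 / h n"] by simp
    have pF: "pd b (?F n) x = (pd b f (x + h n *\<^sub>R a) - pd b f x) / h n" for x
    proof -
      have "pd b (\<lambda>x. (1 / h n) *\<^sub>R (f (x + h n *\<^sub>R a) - f x)) x
          = (1 / h n) *\<^sub>R pd b (\<lambda>x. f (x + h n *\<^sub>R a) - f x) x"
        by (rule pd_compose_bounded_linear[OF bounded_linear_scaleR_right])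
          (intro differentiable_diff pd_shift d)
      also have "pd b (\<lambda>x. f (x + h n *\<^sub>R a) - f x) x = pd b f (x + h n *\<^sub>R a) - pd b f x"
        by (simp add: pd_diff pd_shift d)
      finally show ?thesis by simp
    qed
    have i1: "integrable lborel (\<lambda>x. pd b f (x + h n *\<^sub>R a) * g x)"
      and i2: "integrable lborel (\<lambda>x. pd b f x * g x)"
      and i3: "integrable lborel (\<lambda>x. pd b f x * g (x + (- h n) *\<^sub>R a))"
      by (intro integrable_continuous_bounded_support bounded_support_times(2) sg
          bounded_support_times(1) bounded_support_pd sf continuous_intros c sh)+
    have "(\<integral>x. ?F n x * pd b g x \<partial>lborel) = - (\<integral>x. g x * pd b (?F n) x \<partial>lborel) "
      using integral_by_parts[OF g F sg, of b] by (simp add: mult.commute)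
    also have "(\<integral>x. g x * pd b (?F n) x \<partial>lborel)
        = (\<integral>x. (1 / h n) * (pd b f (x + h n *\<^sub>R a) * g x - pd b f x * g x) \<partial>lborel)"
      by (intro Bochner_Integration.integral_cong refl) (simp add: pF field_simps)
    also have "\<dots> = (1 / h n) * ((\<integral>x. pd b f (x + h n *\<^sub>R a) * g x \<partial>lborel) - (\<integral>x. pd b f x * g x \<partial>lborel))"
      using i1 i2 by simp
    also have "(\<integral>x. pd b f (x + h n *\<^sub>R a) * g x \<partial>lborel)
        = (\<integral>x. pd b f x * g (x + (- h n) *\<^sub>R a) \<partial>lborel)"
      using lborel_integral_shift[of "\<lambda>x. pd b f x * g (x + (- h n) *\<^sub>R a)" "h n *\<^sub>R a"] by simp
    also have "- ((1 / h n) * ((\<integral>x. pd b f x * g (x + (- h n) *\<^sub>R a) \<partial>lborel) - (\<integral>x. pd b f x * g x \<partial>lborel)))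
        = (\<integral>x. (- 1 / h n) * (pd b f x * g (x + (- h n) *\<^sub>R a) - pd b f x * g x) \<partial>lborel)"
      using i2 i3 by simp
    also have "\<dots> = (\<integral>x. pd b f x * ?G n x \<partial>lborel)"
      using h0[of n] by (intro Bochner_Integration.integral_cong refl) (simp add: field_simps)
    finally show ?thesis .
  qed
  have L: "(\<lambda>n. \<integral>x. ?F n x * pd b g x \<partial>lborel) \<longlonglongrightarrow> (\<integral>x. pd a f x * pd b g x \<partial>lborel)"
  proof (rule integral_dominated_convergence)
    show "integrable lborel (\<lambda>x. Mf * \<bar>pd b g x\<bar>)"
      by (intro integrable_mult_right integrable_abs integrable_continuous_bounded_support c
          bounded_support_pd sg)
    show "AE x in lborel. (\<lambda>n. ?F n x * pd b g x) \<longlonglongrightarrow> pd a f x * pd b g x"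
      by (intro AE_I2 tendsto_intros difference_quotient_tendsto d h h0)
    show "AE x in lborel. norm (?F n x * pd b g x) \<le> Mf * \<bar>pd b g x\<bar>" for n
      unfolding real_norm_def abs_mult
      by (intro AE_I2 mult_right_mono difference_quotient_bound d Mf) auto
  qed measurable
  have R: "(\<lambda>n. \<integral>x. pd b f x * ?G n x \<partial>lborel) \<longlonglongrightarrow> (\<integral>x. pd b f x * pd a g x \<partial>lborel)"
  proof (rule integral_dominated_convergence)
    show "integrable lborel (\<lambda>x. \<bar>pd b f x\<bar> * Mg)"
      by (intro integrable_mult_left integrable_abs integrable_continuous_bounded_support c
          bounded_support_pd sf)
    have "(\<lambda>n. - h n) \<longlonglongrightarrow> 0"
      using tendsto_minus[OF h(1)] by simp
    then show "AE x in lborel. (\<lambda>n. pd b f x * ?G n x) \<longlonglongrightarrow> pd b f x * pd a g x"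
      using h0 by (intro AE_I2 tendsto_mult tendsto_const difference_quotient_tendsto d) auto
    show "AE x in lborel. norm (pd b f x * ?G n x) \<le> \<bar>pd b f x\<bar> * Mg" for n
      unfolding real_norm_def abs_mult
      by (intro AE_I2 mult_left_mono difference_quotient_bound d Mg) auto
  qed measurable
  show ?thesis
    using LIMSEQ_unique[OF L] R by (simp only: eq)
qed

section \<open>Cutoff functions and functions with zero trace\<close>

lemma Ck_dist_sq: "Ck_on k UNIV (\<lambda>y::'a::euclidean_space. (dist y c)\<^sup>2)"
proof -
  have "(dist y c)\<^sup>2 = (\<Sum>i\<in>Basis. (y \<bullet> i - c \<bullet> i) ^ 2)" for y :: 'a
  proof -
    have "(dist y c)\<^sup>2 = (\<Sum>i\<in>Basis. ((y - c) \<bullet> i) * ((y - c) \<bullet> i))"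
      unfolding dist_norm power2_norm_eq_inner by (rule euclidean_inner)
    then show ?thesis
      by (simp only: inner_diff_left power2_eq_square)
  qed
  moreover have "Ck_on k UNIV (\<lambda>y::'a. \<Sum>i\<in>Basis. (y \<bullet> i - c \<bullet> i) ^ 2)"
    by (intro Ck_sum Ck_power Ck_diff Ck_const Ck_bounded_linear bounded_linear_inner_left)
  ultimately show ?thesis by simp
qed

text \<open>\<open>T\<close> is 1 on an open neighbourhood \<open>U\<close> of \<open>K\<close>, not
  just on \<open>K\<close>: then multiplying by \<open>T\<close> does not change derivatives at
  points of \<open>K\<close>.\<close>

lemma smooth_Urysohn:
  fixes K \<Omega> :: "'a::euclidean_space set"
  assumes K: "compact K" and \<Omega>: "open \<Omega>" "K \<subseteq> \<Omega>"
  obtains T :: "'a \<Rightarrow> real" and U L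
  where "Ck_on k UNIV T" "\<And>x. 0 \<le> T x" "\<And>x. T x \<le> 1" "open U" "K \<subseteq> U" "\<And>x. x \<in> U \<Longrightarrow> T x = 1"
    "compact L" "L \<subseteq> \<Omega>" "\<And>x. x \<notin> L \<Longrightarrow> T x = 0"
proof -
  have "\<exists>r>0. cball x r \<subseteq> \<Omega>" if "x \<in> K" for x
    using \<Omega> that open_contains_cball by blast
  then obtain r where r: "\<And>x. x \<in> K \<Longrightarrow> 0 < r x" "\<And>x. x \<in> K \<Longrightarrow> cball x (r x) \<subseteq> \<Omega>"
    by metis
  obtain F where F: "F \<subseteq> K" "finite F" "K \<subseteq> (\<Union>x\<in>F. ball x (r x / 2))"
    using compactE_image[OF K, of K "\<lambda>x. ball x (r x / 2)"] r(1) by force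
  define \<beta> where "\<beta> x y = (max 0 (1 - (dist y x)\<^sup>2 / (r x)\<^sup>2)) ^ Suc k" for x y
  \<comment> \<open>Within half the radius of some centre, \<open>1 - (dist y x / r x)^2\<close>
    exceeds 3/4. The factor \<open>(4/3) ^ Suc k\<close> therefore lifts \<open>\<sigma>\<close>
    above 1 on \<open>K\<close>.\<close>
  define \<sigma> where "\<sigma> y = (4/3) ^ Suc k * (\<Sum>x\<in>F. \<beta> x y)" for y
  \<comment> \<open>A second truncated power flattens the function to the value 1 wherever
    \<open>\<sigma>\<close> exceeds 1, while keeping class Ck.\<close>
  define T where "T y = 1 - (max 0 (1 - \<sigma> y)) ^ Suc k" for y
  have \<sigma>k: "Ck_on k UNIV \<sigma>"
    unfolding \<sigma>_def \<beta>_def divide_inverse mult.commute[of _ "inverse _"]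
    by (intro Ck_cmult Ck_sum Ck_compose_real[OF Ck_max_power] Ck_diff Ck_const Ck_dist_sq)
  have \<beta>0: "0 \<le> \<beta> x y" for x y
    by (simp add: \<beta>_def)
  have \<sigma>0: "0 \<le> \<sigma> y" for y
    by (simp add: \<sigma>_def sum_nonneg \<beta>0)
  show thesis
  proof (rule that)
    show "Ck_on k UNIV T"
      unfolding T_def by (intro Ck_diff Ck_const Ck_compose_real[OF Ck_max_power] \<sigma>k)
    show "0 \<le> T x" for x
      using \<sigma>0[of x] power_le_one[of "max 0 (1 - \<sigma> x)" "Suc k"] by (simp add: T_def)
    show "T x \<le> 1" for x
      by (simp add: T_def)
    show "open {y. 1 < \<sigma> y}"
      using Ck_on_continuous[OF \<sigma>k] by (intro open_Collect_less continuous_intros)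
    show "T x = 1" if "x \<in> {y. 1 < \<sigma> y}" for x
      using that by (simp add: T_def)
    show "K \<subseteq> {y. 1 < \<sigma> y}"
    proof
      fix y assume "y \<in> K"
      then obtain x where x: "x \<in> F" "dist y x < r x / 2"
        using F(3) by (auto simp: dist_commute)
      have rx: "0 < r x" using x F r by auto
      have "(dist y x)\<^sup>2 < (r x / 2)\<^sup>2"
        using x(2) by (intro power_strict_mono) auto
      then have "3/4 < 1 - (dist y x)\<^sup>2 / (r x)\<^sup>2"
        using rx by (simp add: field_simps)
      then have "3/4 < max 0 (1 - (dist y x)\<^sup>2 / (r x)\<^sup>2)"
        by (rule less_le_trans[OF _ max.cobounded2])
      then have "(3/4) ^ Suc k < \<beta> x y"
        unfolding \<beta>_def by (rule power_strict_mono) simp_all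
      also have "\<beta> x y \<le> (\<Sum>x\<in>F. \<beta> x y)"
        using x F \<beta>0 by (intro member_le_sum) auto
      finally have "(4/3) ^ Suc k * (3/4) ^ Suc k < \<sigma> y"
        unfolding \<sigma>_def by (intro mult_strict_left_mono) auto
      moreover have "(4/3) ^ Suc k * (3/4) ^ Suc k = (1::real)"
        unfolding power_mult_distrib[symmetric] by simp
      ultimately show "y \<in> {y. 1 < \<sigma> y}"
        by simp
    qed
    show "compact (\<Union>x\<in>F. cball x (r x))"
      using F by (intro compact_UN) auto
    show "(\<Union>x\<in>F. cball x (r x)) \<subseteq> \<Omega>"
      using F(1) r(2) by blast
    fix y assume y: "y \<notin> (\<Union>x\<in>F. cball x (r x))"
    have "\<beta> x y = 0" if "x \<in> F" for x
    proof -
      have rx: "0 < r x" "r x < dist y x"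
        using that y F r by (auto simp: dist_commute)
      then have "(r x)\<^sup>2 < (dist y x)\<^sup>2"
        by (intro power_strict_mono) auto
      then have "1 - (dist y x)\<^sup>2 / (r x)\<^sup>2 \<le> 0"
        using rx by (simp add: field_simps)
      then show ?thesis
        by (simp add: \<beta>_def max_absorb1)
    qed
    then show "T y = 0"
      by (simp add: T_def \<sigma>_def)
  qed
qed

lemma borel_measurable_lebesgue_on_continuous:
  fixes f :: "'a::euclidean_space \<Rightarrow> 'b::euclidean_space"
  shows "continuous_on \<Omega> f \<Longrightarrow> open \<Omega> \<Longrightarrow> f \<in> borel_measurable (lebesgue_on \<Omega>)"
  by (intro continuous_imp_measurable_on_sets_lebesgue) auto

lemma tendsto_integral_lebesgue_on:
  fixes s :: "nat \<Rightarrow> 'a::euclidean_space \<Rightarrow> real"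
  assumes \<Omega>: "\<Omega> \<in> lmeasurable" and s: "\<And>n. s n \<in> borel_measurable (lebesgue_on \<Omega>)"
    and bound: "\<And>n x. x \<in> \<Omega> \<Longrightarrow> \<bar>s n x\<bar> \<le> B" and lim: "\<And>x. x \<in> \<Omega> \<Longrightarrow> (\<lambda>n. s n x) \<longlonglongrightarrow> f x"
  shows "(\<lambda>n. \<integral>x. s n x \<partial>lebesgue_on \<Omega>) \<longlonglongrightarrow> (\<integral>x. f x \<partial>lebesgue_on \<Omega>)"
proof -
  interpret finite_measure "lebesgue_on \<Omega>"
    using \<Omega> by (rule finite_measure_lebesgue_on)
  show ?thesis
  proof (rule integral_dominated_convergence[where w = "\<lambda>_. B"])
    show "f \<in> borel_measurable (lebesgue_on \<Omega>)"
      by (rule borel_measurable_LIMSEQ_metric[OF s]) (use lim in simp)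
  qed (use s bound lim in auto)
qed

lemma integral_lebesgue_on_eq_lborel:
  fixes f :: "'a::euclidean_space \<Rightarrow> real"
  assumes "open \<Omega>" "continuous_on UNIV f" "\<And>x. x \<notin> \<Omega> \<Longrightarrow> f x = 0"
  shows "(\<integral>x. f x \<partial>lebesgue_on \<Omega>) = (\<integral>x. f x \<partial>lborel)"
proof -
  have "(\<integral>x. f x \<partial>lebesgue_on \<Omega>) = (\<integral>x. (if x \<in> \<Omega> then f x else 0) \<partial>lebesgue)"
    using assms(1) by (subst Lebesgue_Measure.integral_restrict_UNIV) auto
  also have "(\<lambda>x. if x \<in> \<Omega> then f x else 0) = f"
    using assms(3) by auto
  also have "integral\<^sup>L lebesgue f = integral\<^sup>L lborel f"
    using assms(2) by (intro integral_completion) (auto intro: borel_measurable_continuous_onI)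
  finally show ?thesis .
qed

lemma continuous_bounded_on_bounded:
  fixes f :: "'a::euclidean_space \<Rightarrow> real"
  assumes "continuous_on (closure \<Omega>) f" "bounded \<Omega>"
  obtains B where "\<And>x. x \<in> \<Omega> \<Longrightarrow> \<bar>f x\<bar> \<le> B" "0 \<le> B"
proof -
  have "compact (f ` closure \<Omega>)"
    using assms by (intro compact_continuous_image) (auto simp: compact_closure)
  then obtain B where B: "\<And>x. x \<in> closure \<Omega> \<Longrightarrow> \<bar>f x\<bar> \<le> B"
    using compact_imp_bounded by (force simp: bounded_iff)
  show thesis
  proof (rule that)
    show "\<bar>f x\<bar> \<le> max 0 B" if "x \<in> \<Omega>" for x
      using B[of x] that closure_subset by fastforce
  qed simp
qed

text \<open>Continuous extensions are given for the basis directions only; the combination with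
  coefficients \<open>e \<bullet> i\<close> serves every direction \<open>e\<close>.\<close>

lemma Ck_closure_1_pd:
  fixes q :: "'a::euclidean_space \<Rightarrow> real"
  assumes q: "Ck_closure 1 \<Omega> q" and "bounded \<Omega>"
  obtains B where "\<And>x. x \<in> \<Omega> \<Longrightarrow> \<bar>pd e q x\<bar> \<le> B" "continuous_on \<Omega> (pd e q)"
proof -
  have qd: "\<And>x. x \<in> \<Omega> \<Longrightarrow> q differentiable (at x)"
    and "\<forall>i\<in>Basis. \<exists>g. continuous_on (closure \<Omega>) g \<and> (\<forall>x\<in>\<Omega>. g x = pd i q x)"
    using q by auto
  then obtain g where g: "\<And>i. i \<in> Basis \<Longrightarrow> continuous_on (closure \<Omega>) (g i)"
    "\<And>i x. i \<in> Basis \<Longrightarrow> x \<in> \<Omega> \<Longrightarrow> g i x = pd i q x"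
    by metis
  define G where "G x = (\<Sum>i\<in>Basis. (e \<bullet> i) * g i x)" for x
  have G: "continuous_on (closure \<Omega>) G"
    unfolding G_def by (intro continuous_intros g)
  have eq: "G x = pd e q x" if "x \<in> \<Omega>" for x
    using that g(2) by (simp add: G_def pd_Basis_expansion[OF qd[OF that], of e])
  obtain B where "\<And>x. x \<in> \<Omega> \<Longrightarrow> \<bar>G x\<bar> \<le> B"
    by (rule continuous_bounded_on_bounded[OF G \<open>bounded \<Omega>\<close>]) blast
  moreover have "continuous_on \<Omega> G"
    using G closure_subset by (rule continuous_on_subset)
  ultimately show thesis
    using that[of B] eq by (simp cong: continuous_on_cong)
qed

text \<open>\<open>\<Omega>\<close> and the complement of \<open>L\<close> form an open cover of the
  space: the product rule holds on the first, and the function is 0 on the second. The case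
  distinction is there because \<open>q\<close> is arbitrary outside
  \<open>\<Omega>\<close>.\<close>

lemma C1_cutoff:
  fixes q T :: "'a::euclidean_space \<Rightarrow> real"
  assumes \<Omega>: "open \<Omega>" and qd: "\<And>x. x \<in> \<Omega> \<Longrightarrow> q differentiable (at x)"
    and qc: "\<And>i. i \<in> Basis \<Longrightarrow> continuous_on \<Omega> (pd i q)"
    and T: "Ck_on 1 UNIV T" and L: "compact L" "L \<subseteq> \<Omega>" "\<And>x. x \<notin> L \<Longrightarrow> T x = 0"
  shows "Ck_on 1 UNIV (\<lambda>x. if x \<in> \<Omega> then T x * q x else 0)"
proof -
  let ?Q = "\<lambda>x. if x \<in> \<Omega> then T x * q x else 0"
  have oL: "open (- L)" using L(1) by (simp add: compact_imp_closed open_Compl)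
  have un: "\<Omega> \<union> - L = UNIV" using L by auto
  have 1: "?Q differentiable (at x)" "pd e ?Q x = T x * pd e q x + pd e T x * q x" if "x \<in> \<Omega>" for x e
  proof -
    have "(\<lambda>x. T x * q x) differentiable (at x)"
      using T qd[OF that] by (intro differentiable_mult) auto
    note * = pd_cong_open[OF \<Omega> that _ this, of ?Q]
    show "?Q differentiable (at x)"
      by (rule *) simp
    show "pd e ?Q x = T x * pd e q x + pd e T x * q x"
      using T qd[OF that] by (subst *(2)) (auto simp: pd_mult)
  qed
  have 2: "?Q differentiable (at x)" "pd e ?Q x = 0" if "x \<notin> L" for x e
    using pd_cong_open(1)[OF oL, of x "\<lambda>_. 0" ?Q] pd_cong_open(2)[OF oL, of x "\<lambda>_. 0" ?Q e] that L
    by auto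
  have "continuous_on UNIV (pd i ?Q)" if i: "i \<in> Basis" for i
  proof -
    have "continuous_on \<Omega> (\<lambda>x. T x * pd i q x + pd i T x * q x)"
    proof (intro continuous_intros qc i)
      show "continuous_on \<Omega> T" "continuous_on \<Omega> (pd i T)"
        using Ck_on_continuous[OF T] C1_continuous_pd[OF T] by (auto intro: continuous_on_subset)
      show "continuous_on \<Omega> q"
        using qd by (intro continuous_at_imp_continuous_on ballI differentiable_imp_continuous_within) auto
    qed
    then have "continuous_on \<Omega> (pd i ?Q)"
      by (rule continuous_on_eq) (simp add: 1)
    moreover have "continuous_on (- L) (pd i ?Q)"
      by (rule continuous_on_eq[of _ "\<lambda>_. 0"]) (auto simp: 2)
    ultimately have "continuous_on (\<Omega> \<union> - L) (pd i ?Q)"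
      using \<Omega> oL by (intro continuous_on_open_Un)
    then show ?thesis by (simp only: un)
  qed
  moreover have "?Q differentiable (at x)" for x
    using 1(1)[of x] 2(1)[of x] L(2) by blast
  ultimately show ?thesis
    by simp
qed

text \<open>A substitute for membership in \<open>H\<^sup>1\<^sub>0(\<Omega>)\<close>: approximability by compactly supported functions,
  boundedly and pointwise together with the first derivatives.\<close>

definition null_trace :: "'a::euclidean_space set \<Rightarrow> ('a \<Rightarrow> real) \<Rightarrow> bool" where
  "null_trace \<Omega> y \<longleftrightarrow> Ck_on 1 UNIV y \<and> (\<exists>Y. 
     (\<forall>n::nat. Ck_on 1 UNIV (Y n) \<and> (\<exists>K. compact K \<and> K \<subseteq> \<Omega> \<and> (\<forall>x. x \<notin> K \<longrightarrow> Y n x = 0))) \<and>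
     (\<exists>B. \<forall>n. \<forall>x\<in>\<Omega>. \<bar>Y n x\<bar> \<le> B) \<and> (\<forall>a. \<exists>B. \<forall>n. \<forall>x\<in>\<Omega>. \<bar>pd a (Y n) x\<bar> \<le> B) \<and>
     (\<forall>x\<in>\<Omega>. (\<lambda>n. Y n x) \<longlonglongrightarrow> y x) \<and> (\<forall>a. \<forall>x\<in>\<Omega>. (\<lambda>n. pd a (Y n) x) \<longlonglongrightarrow> pd a y x))"

lemma null_traceE:
  assumes "null_trace \<Omega> y"
  obtains Y K where "Ck_on 1 UNIV y" "\<And>n::nat. Ck_on 1 UNIV (Y n)" "\<And>n. compact (K n)" "\<And>n. K n \<subseteq> \<Omega>"
    "\<And>n x. x \<notin> K n \<Longrightarrow> Y n x = 0"
    "\<exists>B. \<forall>n. \<forall>x\<in>\<Omega>. \<bar>Y n x\<bar> \<le> B" "\<And>a. \<exists>B. \<forall>n. \<forall>x\<in>\<Omega>. \<bar>pd a (Y n) x\<bar> \<le> B"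
    "\<And>x. x \<in> \<Omega> \<Longrightarrow> (\<lambda>n. Y n x) \<longlonglongrightarrow> y x"
    "\<And>a x. x \<in> \<Omega> \<Longrightarrow> (\<lambda>n. pd a (Y n) x) \<longlonglongrightarrow> pd a y x"
  using assms unfolding null_trace_def by metis

lemma null_trace_compact_support:
  assumes y: "Ck_on 1 UNIV y" and K: "compact K" "K \<subseteq> \<Omega>" "\<And>x. x \<notin> K \<Longrightarrow> y x = 0"
  shows "null_trace \<Omega> y"
proof -
  have s: "bounded {x. y x \<noteq> 0}"
    using K by (intro bounded_subset[OF compact_imp_bounded[OF K(1)]]) auto
  have "\<exists>B. \<forall>n::nat. \<forall>x\<in>\<Omega>. \<bar>y x\<bar> \<le> B"
    using continuous_bounded_support_bounded[OF Ck_on_continuous[OF y] s] by metis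
  moreover have "\<exists>B. \<forall>n::nat. \<forall>x\<in>\<Omega>. \<bar>pd a y x\<bar> \<le> B" for a
    using continuous_bounded_support_bounded[OF C1_continuous_pd[OF y] bounded_support_pd[OF s]] by metis
  ultimately show ?thesis
    unfolding null_trace_def using y K by (intro conjI exI[of _ "\<lambda>_. y"]) blast+
qed

lemma null_trace_add:
  assumes "null_trace \<Omega> y" "null_trace \<Omega> z"
  shows "null_trace \<Omega> (\<lambda>x. y x + z x)"
proof -
  obtain Y K where Y: "Ck_on 1 UNIV y" "\<And>n::nat. Ck_on 1 UNIV (Y n)" "\<And>n. compact (K n)" "\<And>n. K n \<subseteq> \<Omega>"
    "\<And>n x. x \<notin> K n \<Longrightarrow> Y n x = 0"
    "\<exists>B. \<forall>n. \<forall>x\<in>\<Omega>. \<bar>Y n x\<bar> \<le> B" "\<And>a. \<exists>B. \<forall>n. \<forall>x\<in>\<Omega>. \<bar>pd a (Y n) x\<bar> \<le> B"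
    "\<And>x. x \<in> \<Omega> \<Longrightarrow> (\<lambda>n. Y n x) \<longlonglongrightarrow> y x"
    "\<And>a x. x \<in> \<Omega> \<Longrightarrow> (\<lambda>n. pd a (Y n) x) \<longlonglongrightarrow> pd a y x"
    using assms(1) by (rule null_traceE) blast
  obtain Z L where Z: "Ck_on 1 UNIV z" "\<And>n::nat. Ck_on 1 UNIV (Z n)" "\<And>n. compact (L n)" "\<And>n. L n \<subseteq> \<Omega>"
    "\<And>n x. x \<notin> L n \<Longrightarrow> Z n x = 0"
    "\<exists>B. \<forall>n. \<forall>x\<in>\<Omega>. \<bar>Z n x\<bar> \<le> B" "\<And>a. \<exists>B. \<forall>n. \<forall>x\<in>\<Omega>. \<bar>pd a (Z n) x\<bar> \<le> B"
    "\<And>x. x \<in> \<Omega> \<Longrightarrow> (\<lambda>n. Z n x) \<longlonglongrightarrow> z x"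
    "\<And>a x. x \<in> \<Omega> \<Longrightarrow> (\<lambda>n. pd a (Z n) x) \<longlonglongrightarrow> pd a z x"
    using assms(2) by (rule null_traceE) blast
  have bnd: "\<exists>B. \<forall>n. \<forall>x\<in>\<Omega>. \<bar>f n x + g n x\<bar> \<le> B"
    if "\<exists>B. \<forall>n. \<forall>x\<in>\<Omega>. \<bar>f n x\<bar> \<le> B" "\<exists>B. \<forall>n. \<forall>x\<in>\<Omega>. \<bar>g n x\<bar> \<le> B" for f g :: "nat \<Rightarrow> 'a \<Rightarrow> real"
  proof -
    obtain A B where "\<forall>n. \<forall>x\<in>\<Omega>. \<bar>f n x\<bar> \<le> A" "\<forall>n. \<forall>x\<in>\<Omega>. \<bar>g n x\<bar> \<le> B"
      using \<open>\<exists>B. \<forall>n. \<forall>x\<in>\<Omega>. \<bar>f n x\<bar> \<le> B\<close> \<open>\<exists>B. \<forall>n. \<forall>x\<in>\<Omega>. \<bar>g n x\<bar> \<le> B\<close> by blast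
    then show ?thesis
      by (intro exI[of _ "A + B"]) (fastforce intro: order_trans[OF abs_triangle_ineq] add_mono)
  qed
  have p: "pd a (\<lambda>x. Y n x + Z n x) x = pd a (Y n) x + pd a (Z n) x"
    "pd a (\<lambda>x. y x + z x) x = pd a y x + pd a z x" for a n x
    using Y(1,2) Z(1,2) by (auto intro!: pd_add)
  show ?thesis
    unfolding null_trace_def
  proof (intro conjI exI[of _ "\<lambda>n x. Y n x + Z n x"] allI ballI)
    show "Ck_on 1 UNIV (\<lambda>x. y x + z x)" "Ck_on 1 UNIV (\<lambda>x. Y n x + Z n x)" for n
      using Y Z by (auto intro!: Ck_add simp del: Ck_on.simps One_nat_def)
    show "\<exists>K. compact K \<and> K \<subseteq> \<Omega> \<and> (\<forall>x. x \<notin> K \<longrightarrow> Y n x + Z n x = 0)" for n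
      using Y(3-5) Z(3-5) by (intro exI[of _ "K n \<union> L n"]) auto
    show "\<exists>B. \<forall>n. \<forall>x\<in>\<Omega>. \<bar>Y n x + Z n x\<bar> \<le> B"
      by (intro bnd Y Z)
    show "\<exists>B. \<forall>n. \<forall>x\<in>\<Omega>. \<bar>pd a (\<lambda>x. Y n x + Z n x) x\<bar> \<le> B" for a
      unfolding p by (intro bnd Y Z)
    show "(\<lambda>n. Y n x + Z n x) \<longlonglongrightarrow> y x + z x" if "x \<in> \<Omega>" for x
      using that by (intro tendsto_add Y Z)
    show "(\<lambda>n. pd a (\<lambda>x. Y n x + Z n x) x) \<longlonglongrightarrow> pd a (\<lambda>x. y x + z x) x" if "x \<in> \<Omega>" for x a
      unfolding p using that by (intro tendsto_add Y Z)
  qed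
qed

text \<open>For each approximant \<open>Y n\<close> the identity is the one on the whole space; the
  bounded pointwise convergence of \<open>Y n\<close> and its derivatives passes to the limit on
  \<open>\<Omega>\<close>.\<close>

lemma null_trace_by_parts:
  assumes y: "null_trace \<Omega> y" and z: "Ck_on 1 UNIV z" and \<Omega>: "open \<Omega>" "bounded \<Omega>"
  shows "(\<integral>x. pd a y x * z x \<partial>lebesgue_on \<Omega>) = - (\<integral>x. y x * pd a z x \<partial>lebesgue_on \<Omega>)"
proof -
  obtain Y K where Y: "Ck_on 1 UNIV y" "\<And>n::nat. Ck_on 1 UNIV (Y n)" "\<And>n. compact (K n)" "\<And>n. K n \<subseteq> \<Omega>"
    "\<And>n x. x \<notin> K n \<Longrightarrow> Y n x = 0"
    "\<exists>B. \<forall>n. \<forall>x\<in>\<Omega>. \<bar>Y n x\<bar> \<le> B" "\<And>a. \<exists>B. \<forall>n. \<forall>x\<in>\<Omega>. \<bar>pd a (Y n) x\<bar> \<le> B"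
    "\<And>x. x \<in> \<Omega> \<Longrightarrow> (\<lambda>n. Y n x) \<longlonglongrightarrow> y x"
    "\<And>a x. x \<in> \<Omega> \<Longrightarrow> (\<lambda>n. pd a (Y n) x) \<longlonglongrightarrow> pd a y x"
    using y by (rule null_traceE) blast
  have lm: "\<Omega> \<in> lmeasurable"
    using \<Omega> by (simp add: lmeasurable_open)
  have cz: "continuous_on UNIV z" "continuous_on UNIV (pd a z)"
    using z by (auto intro: Ck_on_continuous C1_continuous_pd simp del: Ck_on.simps One_nat_def)
  have cY: "continuous_on UNIV (Y n)" "continuous_on UNIV (pd a (Y n))" for n
    using Ck_on_continuous[OF Y(2)] C1_continuous_pd[OF Y(2)] by auto
  obtain A where A: "\<And>x. x \<in> \<Omega> \<Longrightarrow> \<bar>z x\<bar> \<le> A" "0 \<le> A"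
    by (rule continuous_bounded_on_bounded[OF continuous_on_subset[OF cz(1) subset_UNIV] \<Omega>(2)]) blast
  obtain A' where A': "\<And>x. x \<in> \<Omega> \<Longrightarrow> \<bar>pd a z x\<bar> \<le> A'" "0 \<le> A'"
    by (rule continuous_bounded_on_bounded[OF continuous_on_subset[OF cz(2) subset_UNIV] \<Omega>(2)]) blast
  obtain B where B: "\<And>n x. x \<in> \<Omega> \<Longrightarrow> \<bar>Y n x\<bar> \<le> B" using Y(6) by blast
  obtain B' where B': "\<And>n x. x \<in> \<Omega> \<Longrightarrow> \<bar>pd a (Y n) x\<bar> \<le> B'" using Y(7)[of a] by blast
  have meas: "f \<in> borel_measurable (lebesgue_on \<Omega>)" if "continuous_on UNIV f" for f :: "'a \<Rightarrow> real"
    using that \<Omega> by (intro borel_measurable_lebesgue_on_continuous) (auto intro: continuous_on_subset)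
  have 1: "(\<lambda>n. \<integral>x. pd a (Y n) x * z x \<partial>lebesgue_on \<Omega>) \<longlonglongrightarrow> (\<integral>x. pd a y x * z x \<partial>lebesgue_on \<Omega>)"
  proof (rule tendsto_integral_lebesgue_on[OF lm, where B = "B' * A"])
    show "(\<lambda>x. pd a (Y n) x * z x) \<in> borel_measurable (lebesgue_on \<Omega>)" for n
      by (intro meas continuous_intros cY cz)
    show "\<bar>pd a (Y n) x * z x\<bar> \<le> B' * A" if "x \<in> \<Omega>" for n x
      unfolding abs_mult using A B' that order_trans[OF abs_ge_zero B'] by (intro mult_mono) auto
    show "(\<lambda>n. pd a (Y n) x * z x) \<longlonglongrightarrow> pd a y x * z x" if "x \<in> \<Omega>" for x
      using that by (intro tendsto_intros Y)
  qed
  have 2: "(\<lambda>n. \<integral>x. Y n x * pd a z x \<partial>lebesgue_on \<Omega>) \<longlonglongrightarrow> (\<integral>x. y x * pd a z x \<partial>lebesgue_on \<Omega>)"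
  proof (rule tendsto_integral_lebesgue_on[OF lm, where B = "B * A'"])
    show "(\<lambda>x. Y n x * pd a z x) \<in> borel_measurable (lebesgue_on \<Omega>)" for n
      by (intro meas continuous_intros cY cz)
    show "\<bar>Y n x * pd a z x\<bar> \<le> B * A'" if "x \<in> \<Omega>" for n x
      unfolding abs_mult using A' B that order_trans[OF abs_ge_zero B] by (intro mult_mono) auto
    show "(\<lambda>n. Y n x * pd a z x) \<longlonglongrightarrow> y x * pd a z x" if "x \<in> \<Omega>" for x
      using that by (intro tendsto_intros Y)
  qed
  have "(\<integral>x. pd a (Y n) x * z x \<partial>lebesgue_on \<Omega>) = - (\<integral>x. Y n x * pd a z x \<partial>lebesgue_on \<Omega>)" for n
  proof -
    have out: "Y n x = 0" "pd a (Y n) x = 0" if "x \<notin> \<Omega>" for x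
      using that Y(4)[of n] Y(5)[of _ n] pd_eq_0_outside[OF compact_imp_closed[OF Y(3)[of n]], of "Y n" x a]
      by blast+
    have supp: "bounded {x. Y n x \<noteq> 0}"
      using Y(5)[of _ n] by (intro bounded_subset[OF compact_imp_bounded[OF Y(3)[of n]]]) auto
    have "(\<integral>x. pd a (Y n) x * z x \<partial>lebesgue_on \<Omega>) = (\<integral>x. pd a (Y n) x * z x \<partial>lborel)"
      using out \<Omega> by (intro integral_lebesgue_on_eq_lborel continuous_intros cY cz) auto
    also have "\<dots> = - (\<integral>x. Y n x * pd a z x \<partial>lborel)"
      by (rule integral_by_parts[OF Y(2) z supp])
    also have "(\<integral>x. Y n x * pd a z x \<partial>lborel) = (\<integral>x. Y n x * pd a z x \<partial>lebesgue_on \<Omega>)"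
      using out \<Omega> by (intro integral_lebesgue_on_eq_lborel[symmetric] continuous_intros cY cz) auto
    finally show ?thesis .
  qed
  with 1 have "(\<lambda>n. - (\<integral>x. Y n x * pd a z x \<partial>lebesgue_on \<Omega>)) \<longlonglongrightarrow> (\<integral>x. pd a y x * z x \<partial>lebesgue_on \<Omega>)"
    by simp
  from LIMSEQ_unique[OF this tendsto_minus[OF 2]] show ?thesis .
qed

text \<open>This is what makes \<open>rot y\<close> solenoidal. As \<open>q\<close> is controlled
  only inside \<open>\<Omega>\<close>, it is replaced for each \<open>n\<close> by a compactly
  supported \<open>Q\<close> that agrees with it near the support of \<open>Y n\<close>; the
  identity on the whole space applies to \<open>Y n\<close> and \<open>Q\<close>.\<close>

lemma null_trace_pd_swap:
  assumes y: "null_trace \<Omega> y" and q: "Ck_closure 1 \<Omega> q" and \<Omega>: "open \<Omega>" "bounded \<Omega>"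
  shows "(\<integral>x. pd a y x * pd b q x \<partial>lebesgue_on \<Omega>) = (\<integral>x. pd b y x * pd a q x \<partial>lebesgue_on \<Omega>)"
proof -
  obtain Y K where Y: "Ck_on 1 UNIV y" "\<And>n::nat. Ck_on 1 UNIV (Y n)" "\<And>n. compact (K n)" "\<And>n. K n \<subseteq> \<Omega>"
    "\<And>n x. x \<notin> K n \<Longrightarrow> Y n x = 0"
    "\<exists>B. \<forall>n. \<forall>x\<in>\<Omega>. \<bar>Y n x\<bar> \<le> B" "\<And>a. \<exists>B. \<forall>n. \<forall>x\<in>\<Omega>. \<bar>pd a (Y n) x\<bar> \<le> B"
    "\<And>x. x \<in> \<Omega> \<Longrightarrow> (\<lambda>n. Y n x) \<longlonglongrightarrow> y x"
    "\<And>a x. x \<in> \<Omega> \<Longrightarrow> (\<lambda>n. pd a (Y n) x) \<longlonglongrightarrow> pd a y x"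
    using y by (rule null_traceE) blast
  have lm: "\<Omega> \<in> lmeasurable"
    using \<Omega> by (simp add: lmeasurable_open)
  have cq: "continuous_on \<Omega> (pd e q)" and bq: "\<exists>B. \<forall>x\<in>\<Omega>. \<bar>pd e q x\<bar> \<le> B" for e
    using Ck_closure_1_pd[OF q \<Omega>(2), of e] by metis+
  have cY: "continuous_on UNIV (Y n)" "continuous_on UNIV (pd e (Y n))" for n e
    using Ck_on_continuous[OF Y(2)] C1_continuous_pd[OF Y(2)] by auto
  have lim: "(\<lambda>n. \<integral>x. pd c (Y n) x * pd d q x \<partial>lebesgue_on \<Omega>)
      \<longlonglongrightarrow> (\<integral>x. pd c y x * pd d q x \<partial>lebesgue_on \<Omega>)" for c d
  proof -
    obtain A where A: "\<And>x. x \<in> \<Omega> \<Longrightarrow> \<bar>pd d q x\<bar> \<le> A" using bq[of d] by blast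
    obtain B where B: "\<And>n x. x \<in> \<Omega> \<Longrightarrow> \<bar>pd c (Y n) x\<bar> \<le> B" using Y(7)[of c] by blast
    show ?thesis
    proof (rule tendsto_integral_lebesgue_on[OF lm, where B = "B * A"])
      show "(\<lambda>x. pd c (Y n) x * pd d q x) \<in> borel_measurable (lebesgue_on \<Omega>)" for n
        by (intro borel_measurable_lebesgue_on_continuous \<Omega> continuous_intros cq
            continuous_on_subset[OF cY(2)] subset_UNIV)
      show "\<bar>pd c (Y n) x * pd d q x\<bar> \<le> B * A" if "x \<in> \<Omega>" for n x
        unfolding abs_mult using A B that order_trans[OF abs_ge_zero B] by (intro mult_mono) auto
      show "(\<lambda>n. pd c (Y n) x * pd d q x) \<longlonglongrightarrow> pd c y x * pd d q x" if "x \<in> \<Omega>" for x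
        using that by (intro tendsto_intros Y)
    qed
  qed
  have "(\<integral>x. pd a (Y n) x * pd b q x \<partial>lebesgue_on \<Omega>) = (\<integral>x. pd b (Y n) x * pd a q x \<partial>lebesgue_on \<Omega>)" for n
  proof -
    obtain T :: "'a \<Rightarrow> real" and U L where T: "Ck_on 1 UNIV T" "open U" "K n \<subseteq> U"
      "\<And>x. x \<in> U \<Longrightarrow> T x = 1" "compact L" "L \<subseteq> \<Omega>" "\<And>x. x \<notin> L \<Longrightarrow> T x = 0"
      by (rule smooth_Urysohn[OF Y(3)[of n] \<Omega>(1) Y(4)[of n], of 1]) blast
    define Q where "Q x = (if x \<in> \<Omega> then T x * q x else 0)" for x
    have Q: "Ck_on 1 UNIV Q"
      unfolding Q_def using q by (intro C1_cutoff[OF \<Omega>(1) _ cq T(1,5-7)]) auto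
    have out: "pd e (Y n) x = 0" if "x \<notin> K n" for x e
      using that Y(5)[of _ n] by (intro pd_eq_0_outside[OF compact_imp_closed[OF Y(3)[of n]]])
    have QK: "pd e Q x = pd e q x" if "x \<in> K n" for e x
    proof (rule pd_cong_open(2))
      show "open (U \<inter> \<Omega>)" "x \<in> U \<inter> \<Omega>"
        using T(2,3) \<Omega>(1) that Y(4)[of n] by blast+
      show "q y = Q y" if "y \<in> U \<inter> \<Omega>" for y
        using that T by (simp add: Q_def)
      show "q differentiable (at x)"
        using q that Y(4)[of n] by auto
    qed
    have sY: "bounded {x. Y n x \<noteq> 0}"
      using Y(5)[of _ n] by (intro bounded_subset[OF compact_imp_bounded[OF Y(3)[of n]]]) auto
    have sQ: "bounded {x. Q x \<noteq> 0}"
      using T(7) by (intro bounded_subset[OF compact_imp_bounded[OF T(5)]]) (auto simp: Q_def)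
    have tr: "(\<integral>x. pd c (Y n) x * pd d q x \<partial>lebesgue_on \<Omega>) = (\<integral>x. pd c (Y n) x * pd d Q x \<partial>lborel)" for c d
    proof -
      have "pd c (Y n) x * pd d q x = pd c (Y n) x * pd d Q x" for x
        using out QK by (cases "x \<in> K n") auto
      then have "(\<integral>x. pd c (Y n) x * pd d q x \<partial>lebesgue_on \<Omega>) = (\<integral>x. pd c (Y n) x * pd d Q x \<partial>lebesgue_on \<Omega>)"
        by (simp only:)
      also have "\<dots> = (\<integral>x. pd c (Y n) x * pd d Q x \<partial>lborel)"
        using out Y(4)[of n]
        by (intro integral_lebesgue_on_eq_lborel \<Omega> continuous_intros cY C1_continuous_pd Q) auto
      finally show ?thesis .
    qed
    show ?thesis
      unfolding tr by (rule integral_pd_pd_swap[OF Y(2) Q sY sQ])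
  qed
  with lim[of a b] have "(\<lambda>n. \<integral>x. pd b (Y n) x * pd a q x \<partial>lebesgue_on \<Omega>)
      \<longlonglongrightarrow> (\<integral>x. pd a y x * pd b q x \<partial>lebesgue_on \<Omega>)"
    by simp
  from LIMSEQ_unique[OF this lim] show ?thesis .
qed

section \<open>Fields concentrated near a boundary point\<close>

lemma common_bound:
  assumes "finite S" "\<And>f. f \<in> S \<Longrightarrow> continuous_on UNIV f \<and> bounded {t. f t \<noteq> 0}"
  shows "\<exists>M\<ge>0. \<forall>f\<in>S. \<forall>t. \<bar>f (t::'b::euclidean_space) :: real\<bar> \<le> M"
  using assms
proof (induction S rule: finite_induct)
  case (insert f S)
  then obtain M where M: "0 \<le> M" "\<forall>f\<in>S. \<forall>t. \<bar>f t\<bar> \<le> M" by auto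
  obtain N where N: "\<And>t. \<bar>f t\<bar> \<le> N"
    using continuous_bounded_support_bounded[of f] insert.prems by (metis insertI1)
  show ?case
    using M N by (intro exI[of _ "max M N"]) (fastforce simp: le_max_iff_disj)
qed auto

text \<open>The exponent 4 yields class C3, the smoothness of the boundary. The explicit form makes
  the sign of the derivative visible.\<close>

definition bump :: "real \<Rightarrow> real" where
  "bump t = (max 0 (1 - t\<^sup>2)) ^ 4"

lemma Ck_bump: "Ck_on 3 UNIV bump"
  using Ck_compose_real[OF Ck_max_power[of 3], of "\<lambda>t::real. 1 - t ^ 2"]
    Ck_diff[OF Ck_const Ck_power[OF Ck_bounded_linear[OF bounded_linear_ident]], of 3 "1::real" 2]
  by (simp add: bump_def[abs_def] del: Ck_on.simps)

lemma bump_simps: "0 \<le> bump t" "bump 0 = 1" "1 \<le> \<bar>t\<bar> \<Longrightarrow> bump t = 0"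
  using abs_square_le_1[of t] by (auto simp: bump_def max_def abs_square_eq_1)

lemma pd_bump: "pd 1 bump t = - 8 * t * (max 0 (1 - t\<^sup>2)) ^ 3"
proof -
  have "((\<lambda>t::real. 1 - t\<^sup>2) has_real_derivative - 2 * t) (at t)"
    by (auto intro!: derivative_eq_intros)
  from DERIV_chain2[OF has_real_derivative_max_power[of 2] this]
  have "((\<lambda>t::real. (max 0 (1 - t\<^sup>2)) ^ 4) has_real_derivative (4 * (max 0 (1 - t\<^sup>2)) ^ 3) * (- 2 * t)) (at t)"
    by (simp add: numeral_eq_Suc)
  then show ?thesis
    unfolding bump_def[abs_def] by (auto dest!: pd_real_eqI)
qed

lemma Ck_scale: "Ck_on k UNIV f \<Longrightarrow> Ck_on k UNIV (\<lambda>t::real. f (t / d) :: real)"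
  using Ck_compose_real[of k f "\<lambda>t. t / d"] by (simp add: Ck_bounded_linear bounded_linear_divide)

lemma pd_scale:
  fixes f :: "real \<Rightarrow> real"
  assumes "f differentiable (at (t / d))"
  shows "pd 1 (\<lambda>t. c * f (t / d)) t = (c / d) * pd 1 f (t / d)"
proof -
  have "((\<lambda>t. t / d) has_real_derivative 1 / d) (at t)"
    by (rule DERIV_cong[OF DERIV_cdivide[OF DERIV_ident]]) simp
  from DERIV_cmult[OF DERIV_chain2[OF has_real_derivative_pd[OF assms] this], of c]
  show ?thesis
    by (auto dest!: pd_real_eqI)
qed

section \<open>Graph coordinates at a boundary point\<close>

locale graph_chart =
  fixes \<Omega> :: "(real^2) set" and x0 e1 e2 :: "real^2" and r :: real and \<gamma> :: "real \<Rightarrow> real"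
  assumes open_\<Omega>: "open \<Omega>" and x0: "x0 \<in> frontier \<Omega>"
    and orthonormal: "e1 \<bullet> e1 = 1" "e2 \<bullet> e2 = 1" "e1 \<bullet> e2 = 0"
    and \<gamma>: "Ck_on 3 UNIV \<gamma>" and r: "0 < r"
    and chart: "\<Omega> \<inter> ball x0 r = {x \<in> ball x0 r. \<gamma> (x \<bullet> e1) < x \<bullet> e2}"
begin

text \<open>Height over the graph measured along \<open>e2\<close>. Unlike the distance, it visibly
  inherits the class of \<open>\<gamma>\<close>, and its derivative along \<open>e2\<close> is
  1.\<close>

definition \<rho> :: "real^2 \<Rightarrow> real" where
  "\<rho> x = x \<bullet> e2 - \<gamma> (x \<bullet> e1)"

lemma e2_e1: "e2 \<bullet> e1 = 0"
  using orthonormal(3) by (simp add: inner_commute)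

lemma Ck_\<rho>: "Ck_on 3 UNIV \<rho>"
  unfolding \<rho>_def[abs_def] by (intro Ck_diff Ck_inner Ck_compose_real[OF \<gamma>])

lemma Ck_of_\<rho>:
  fixes f :: "real \<Rightarrow> real"
  shows "Ck_on k UNIV f \<Longrightarrow> k \<le> 3 \<Longrightarrow> Ck_on k UNIV (\<lambda>x. f (\<rho> x))"
  by (rule Ck_compose_real[where f = \<rho>]) (auto intro: Ck_on_mono[OF Ck_\<rho>] simp del: Ck_on.simps)

lemma Ck_of_s:
  fixes f :: "real \<Rightarrow> real"
  shows "Ck_on k UNIV f \<Longrightarrow> Ck_on k UNIV (\<lambda>x. f (x \<bullet> e1))"
  by (rule Ck_compose_real[where f = "\<lambda>x. x \<bullet> e1"]) (simp_all add: Ck_inner del: Ck_on.simps)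

lemma \<gamma>_differentiable: "\<gamma> differentiable (at t)"
  using Ck_on_differentiable[OF \<gamma>] by simp

lemma \<rho>_differentiable: "\<rho> differentiable (at x)"
  using Ck_on_differentiable[OF Ck_\<rho>] by simp

lemma continuous_\<rho>: "continuous_on S \<rho>"
  using Ck_on_continuous[OF Ck_\<rho>] by (rule continuous_on_subset) simp

lemma pd_of_s:
  assumes "f differentiable (at (x \<bullet> e1))"
  shows "pd e (\<lambda>x. f (x \<bullet> e1) :: real) x = pd 1 f (x \<bullet> e1) * (e \<bullet> e1)"
  using assms by (subst pd_compose_real[where h = f and f = "\<lambda>x. x \<bullet> e1"])
    (auto simp: pd_bounded_linear bounded_linear_inner_left intro: bounded_linear_imp_differentiable)

lemma pd_\<rho>: "pd e \<rho> x = e \<bullet> e2 - pd 1 \<gamma> (x \<bullet> e1) * (e \<bullet> e1)"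
proof -
  have "(\<lambda>x::real^2. x \<bullet> e2) differentiable (at x)"
    by (rule bounded_linear_imp_differentiable[OF bounded_linear_inner_left])
  moreover have "(\<lambda>x. \<gamma> (x \<bullet> e1)) differentiable (at x)"
    using Ck_on_differentiable[OF Ck_of_s[OF \<gamma>]] by simp
  ultimately show ?thesis
    unfolding \<rho>_def[abs_def]
    by (subst pd_diff) (auto simp: pd_of_s \<gamma>_differentiable pd_bounded_linear bounded_linear_inner_left)
qed

lemma pd_of_\<rho>:
  assumes "f differentiable (at (\<rho> x))"
  shows "pd e (\<lambda>x. f (\<rho> x) :: real) x = pd 1 f (\<rho> x) * (e \<bullet> e2 - pd 1 \<gamma> (x \<bullet> e1) * (e \<bullet> e1))"
  using assms by (subst pd_compose_real[where h = f and f = \<rho>]) (auto intro: \<rho>_differentiable simp add: pd_\<rho>)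

text \<open>Sums of products of a function of \<open>x \<bullet> e1\<close> and a function of
  \<open>\<rho>\<close> are closed under both derivatives, so the second derivatives of the layer
  follow by applying these formulas again.\<close>

lemma pd_product:
  fixes A m :: "real \<Rightarrow> real"
  assumes A: "Ck_on 1 UNIV A" and m: "Ck_on 1 UNIV m"
  shows "pd e1 (\<lambda>x. A (x \<bullet> e1) * m (\<rho> x)) x
      = pd 1 A (x \<bullet> e1) * m (\<rho> x) - (A (x \<bullet> e1) * pd 1 \<gamma> (x \<bullet> e1)) * pd 1 m (\<rho> x)"
    and "pd e2 (\<lambda>x. A (x \<bullet> e1) * m (\<rho> x)) x = A (x \<bullet> e1) * pd 1 m (\<rho> x)"
proof -
  have d: "(\<lambda>x. A (x \<bullet> e1)) differentiable (at x)" "(\<lambda>x. m (\<rho> x)) differentiable (at x)"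
    using C1_differentiable[OF Ck_of_s[OF A]] C1_differentiable[OF Ck_of_\<rho>[OF m]] by auto
  note * = pd_mult[OF d] pd_of_s[OF C1_differentiable[OF A]] pd_of_\<rho>[OF C1_differentiable[OF m]]
  show "pd e1 (\<lambda>x. A (x \<bullet> e1) * m (\<rho> x)) x
      = pd 1 A (x \<bullet> e1) * m (\<rho> x) - (A (x \<bullet> e1) * pd 1 \<gamma> (x \<bullet> e1)) * pd 1 m (\<rho> x)"
    using orthonormal by (simp add: * algebra_simps)
  show "pd e2 (\<lambda>x. A (x \<bullet> e1) * m (\<rho> x)) x = A (x \<bullet> e1) * pd 1 m (\<rho> x)"
    using orthonormal e2_e1 by (simp add: *)
qed

lemma in_\<Omega>_iff:
  assumes "x \<in> ball x0 r"
  shows "x \<in> \<Omega> \<longleftrightarrow> 0 < \<rho> x"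
proof -
  have "x \<in> \<Omega> \<inter> ball x0 r \<longleftrightarrow> x \<in> {x \<in> ball x0 r. \<gamma> (x \<bullet> e1) < x \<bullet> e2}"
    by (simp only: chart)
  then show ?thesis
    using assms by (simp add: \<rho>_def del: mem_ball)
qed

text \<open>\<open>\<Omega>\<close> is open, so a frontier point is outside it and
  \<open>\<rho>\<close> is not positive there; a negative value would persist nearby and keep
  \<open>\<Omega>\<close> away from the point.\<close>

lemma \<rho>_frontier:
  assumes "x \<in> frontier \<Omega>" "x \<in> ball x0 r"
  shows "\<rho> x = 0"
proof -
  have "x \<notin> \<Omega>"
    using assms(1) open_\<Omega> by (simp add: frontier_def interior_open)
  then have "\<rho> x \<le> 0"
    using in_\<Omega>_iff[OF assms(2)] by simp
  moreover have "\<not> \<rho> x < 0"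
  proof
    assume neg: "\<rho> x < 0"
    let ?N = "{y. \<rho> y < 0} \<inter> ball x0 r"
    have "open ?N"
      by (intro open_Int open_Collect_less continuous_\<rho> continuous_on_const open_ball)
    moreover have "x \<in> ?N" using neg assms(2) by blast
    moreover have "x \<in> closure \<Omega>"
      using assms(1) by (simp add: frontier_def)
    ultimately obtain y where "y \<in> \<Omega>" "y \<in> ?N"
      using open_Int_closure_eq_empty[of ?N \<Omega>] by blast
    then show False
      using in_\<Omega>_iff[of y] by simp
  qed
  ultimately show ?thesis by simp
qed

lemma \<rho>_x0: "\<rho> x0 = 0"
  using r by (intro \<rho>_frontier x0) simp

end

text \<open>The curved box of half-width \<open>\<alpha>\<close> and half-height \<open>h\<close>
  lies inside the chart ball. A function vanishing outside the box therefore meets no other part of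
  the boundary.\<close>

locale boundary_chart = graph_chart +
  fixes \<alpha> h :: real
  assumes bounded_\<Omega>: "bounded \<Omega>" and \<alpha>: "0 < \<alpha>" and h: "0 < h"
    and patch_in_ball:
      "\<And>x. \<bar>x \<bullet> e1 - x0 \<bullet> e1\<bar> \<le> \<alpha> \<Longrightarrow> \<bar>x \<bullet> e2 - \<gamma> (x \<bullet> e1)\<bar> \<le> h \<Longrightarrow> x \<in> ball x0 r"
begin

definition patch :: "(real^2) set" where
  "patch = {x. \<bar>x \<bullet> e1 - x0 \<bullet> e1\<bar> \<le> \<alpha> \<and> \<bar>\<rho> x\<bar> \<le> h}"

lemma patch_subset: "patch \<subseteq> ball x0 r"
  using patch_in_ball by (auto simp: patch_def \<rho>_def simp del: mem_ball)

lemma compact_patch: "compact patch"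
proof -
  have "closed patch"
    unfolding patch_def by (intro closed_Collect_conj closed_Collect_le continuous_intros continuous_\<rho>)
  moreover have "bounded patch"
    using patch_subset bounded_ball bounded_subset by blast
  ultimately show ?thesis
    by (simp add: compact_eq_bounded_closed)
qed

lemma \<rho>_pos: "x \<in> \<Omega> \<Longrightarrow> x \<in> patch \<Longrightarrow> 0 < \<rho> x"
  using in_\<Omega>_iff[of x] patch_subset by blast

lemma in_\<Omega>_if_\<rho>_pos: "x \<in> patch \<Longrightarrow> 0 < \<rho> x \<Longrightarrow> x \<in> \<Omega>"
  using in_\<Omega>_iff[of x] patch_subset by blast

text \<open>A function vanishing on the graph is \<open>O(\<rho>)\<close>, hence can be cut off at height \<open>1/n\<close> above the
  graph without the derivatives blowing up.\<close>

lemma null_trace_chart: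
  assumes y: "Ck_on 1 UNIV y" and out: "\<And>x. x \<notin> patch \<Longrightarrow> y x = 0" and graph: "\<And>x. \<rho> x = 0 \<Longrightarrow> y x = 0"
  shows "null_trace \<Omega> y"
proof -
  \<comment> \<open>A C1 step from 0 (for \<open>t \<le> 1\<close>) to 1 (for
    \<open>t \<ge> 2\<close>), made of two truncated squares.\<close>
  define \<theta> :: "real \<Rightarrow> real" where "\<theta> t = 1 - (max 0 (1 - (max 0 (t - 1)) ^ 2)) ^ 2" for t
  have pp: "Ck_on 1 UNIV (\<lambda>t::real. (max 0 t) ^ 2)"
    using Ck_max_power[of 1] by (simp add: numeral_2_eq_2 del: Ck_on.simps)
  have \<theta>: "Ck_on 1 UNIV \<theta>"
    unfolding \<theta>_def[abs_def]
    by (intro Ck_diff Ck_const Ck_compose_real[OF pp] Ck_bounded_linear bounded_linear_ident)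
  have \<theta>1: "\<theta> t = 1" if "2 \<le> t" for t
  proof -
    have "1 \<le> (t - 1)\<^sup>2"
      using that power_mono[of 1 "t - 1" 2] by simp
    then show ?thesis
      using that by (simp add: \<theta>_def max_absorb1 max_absorb2)
  qed
  have \<theta>0: "\<theta> t = 0" if "t \<le> 1" for t
    using that by (simp add: \<theta>_def max_def)
  have \<theta>'1: "pd 1 \<theta> t = 0" if "2 < t" for t
    using that \<theta>1 pd_cong_open(2)[of "{2<..}" t "\<lambda>_. 1" \<theta> 1] by auto
  have \<theta>'0: "pd 1 \<theta> t = 0" if "t < 1" for t
    using that \<theta>0 pd_cong_open(2)[of "{..<1}" t "\<lambda>_. 0" \<theta> 1] by auto
  have \<theta>b: "\<bar>\<theta> t\<bar> \<le> 1" for t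
  proof -
    have "(max 0 (1 - (max 0 (t - 1)) ^ 2)) ^ 2 \<le> 1"
      by (rule power_le_one) auto
    then show ?thesis
      unfolding \<theta>_def by simp
  qed
  \<comment> \<open>The dangerous term of the cut-off derivative is \<open>y\<close> times
    \<open>n\<close> times \<open>\<theta>'(n \<rho>)\<close>. As \<open>y\<close> is
    \<open>O(\<rho>)\<close>, it is governed by \<open>t * \<theta>'(t)\<close> at
    \<open>t = n \<rho>\<close>, which is bounded uniformly in \<open>n\<close>.\<close>
  have "bounded {t. t * pd 1 \<theta> t \<noteq> 0}"
    by (rule bounded_subset[OF bounded_closed_interval[of 1 2]])
      (use \<theta>'0 \<theta>'1 in \<open>force simp: not_less[symmetric]\<close>)
  then obtain \<Theta> where \<Theta>: "\<And>t. \<bar>t * pd 1 \<theta> t\<bar> \<le> \<Theta>" "0 \<le> \<Theta>"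
    by (rule continuous_bounded_support_bounded[rotated])
      (auto intro!: continuous_intros C1_continuous_pd[OF \<theta>])
  have sy: "bounded {x. y x \<noteq> 0}"
    using out by (intro bounded_subset[OF compact_imp_bounded[OF compact_patch]]) auto
  obtain M0 where M0: "\<And>x. \<bar>y x\<bar> \<le> M0" "0 \<le> M0"
    by (rule continuous_bounded_support_bounded[OF Ck_on_continuous[OF y] sy]) blast
  obtain M where M: "\<And>x. \<bar>pd e2 y x\<bar> \<le> M" "0 \<le> M"
    by (rule continuous_bounded_support_bounded[OF C1_continuous_pd[OF y] bounded_support_pd[OF sy]]) blast
  have yd: "y differentiable (at x)" for x
    using y by (rule C1_differentiable)
  \<comment> \<open>Moving from \<open>x\<close> along \<open>e2\<close> by
    \<open>- \<rho> x\<close> reaches the graph, where \<open>y\<close> vanishes; the difference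
    quotient over that segment is bounded by \<open>M\<close>.\<close>
  have y\<rho>: "\<bar>y x\<bar> \<le> M * \<bar>\<rho> x\<bar>" for x
  proof (cases "\<rho> x = 0")
    case True
    then show ?thesis using graph by simp
  next
    case False
    let ?z = "x - \<rho> x *\<^sub>R e2"
    have "\<rho> ?z = 0"
      using orthonormal e2_e1 by (simp add: \<rho>_def inner_diff_left)
    then have "y ?z = 0" by (rule graph)
    then have "\<bar>y x / \<rho> x\<bar> \<le> M"
      using difference_quotient_bound[OF yd M(1), of ?z "\<rho> x"] by simp
    then show ?thesis
      using False by (simp add: field_simps)
  qed
  let ?n = "\<lambda>n::nat. real (Suc n)"
  let ?Y = "\<lambda>n x. y x * \<theta> (?n n * \<rho> x)"
  have Tn: "Ck_on 1 UNIV (\<lambda>x. \<theta> (?n n * \<rho> x))" for n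
    by (intro Ck_compose_real[OF \<theta>] Ck_cmult Ck_on_mono[OF Ck_\<rho>]) simp
  have pT: "pd a (\<lambda>x. \<theta> (?n n * \<rho> x)) x = pd 1 \<theta> (?n n * \<rho> x) * (?n n * pd a \<rho> x)" for n x a
  proof -
    have d: "(\<lambda>x. ?n n * \<rho> x) differentiable (at x)"
      using \<rho>_differentiable by (intro differentiable_mult) auto
    have "pd a (\<lambda>x. ?n n *\<^sub>R \<rho> x) x = ?n n *\<^sub>R pd a \<rho> x"
      by (rule pd_compose_bounded_linear[OF bounded_linear_scaleR_right \<rho>_differentiable])
    then show ?thesis
      by (subst pd_compose_real[OF d C1_differentiable[OF \<theta>]]) simp
  qed
  have pY: "pd a (?Y n) x = y x * (pd 1 \<theta> (?n n * \<rho> x) * (?n n * pd a \<rho> x)) + pd a y x * \<theta> (?n n * \<rho> x)"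
    for n x a
    by (subst pd_mult[OF yd C1_differentiable[OF Tn]]) (simp only: pT)
  have outpd: "pd a y x = 0" if "x \<notin> patch" for x a
    by (rule pd_eq_0_outside[OF compact_imp_closed[OF compact_patch] out that])
  show ?thesis
    unfolding null_trace_def
  proof (intro conjI exI[of _ ?Y] allI ballI)
    show "Ck_on 1 UNIV y" by (rule y)
    fix n :: nat
    show "Ck_on 1 UNIV (?Y n)"
      by (intro Ck_mult y Tn)
    show "\<exists>K. compact K \<and> K \<subseteq> \<Omega> \<and> (\<forall>x. x \<notin> K \<longrightarrow> ?Y n x = 0)"
    proof (intro exI[of _ "patch \<inter> {x. 1 \<le> ?n n * \<rho> x}"] conjI allI impI)
      show "compact (patch \<inter> {x. 1 \<le> ?n n * \<rho> x})"
        by (intro compact_Int_closed compact_patch closed_Collect_le continuous_intros continuous_\<rho>)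
      show "patch \<inter> {x. 1 \<le> ?n n * \<rho> x} \<subseteq> \<Omega>"
      proof
        fix x assume x: "x \<in> patch \<inter> {x. 1 \<le> ?n n * \<rho> x}"
        then have "0 < ?n n * \<rho> x" by simp
        then have "0 < \<rho> x"
          by (simp only: zero_less_mult_iff) auto
        with x show "x \<in> \<Omega>"
          using in_\<Omega>_if_\<rho>_pos by simp
      qed
      show "?Y n x = 0" if "x \<notin> patch \<inter> {x. 1 \<le> ?n n * \<rho> x}" for x
        using that out \<theta>0[of "?n n * \<rho> x"] by fastforce
    qed
  next
    have "\<bar>?Y n x\<bar> \<le> M0" for n x
      using mult_mono[OF M0(1)[of x] \<theta>b[of "?n n * \<rho> x"]] M0(2) by (simp add: abs_mult)
    then show "\<exists>B. \<forall>n. \<forall>x\<in>\<Omega>. \<bar>?Y n x\<bar> \<le> B" by blast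
  next
    fix a
    obtain P where P: "\<And>x. \<bar>pd a y x\<bar> \<le> P" "0 \<le> P"
      by (rule continuous_bounded_support_bounded[OF C1_continuous_pd[OF y] bounded_support_pd[OF sy]]) blast
    have "continuous_on UNIV (pd a \<rho>)"
      by (rule C1_continuous_pd[OF Ck_on_mono[OF Ck_\<rho>]]) simp
    then have "continuous_on (closure patch) (pd a \<rho>)"
      by (rule continuous_on_subset) simp
    then obtain R where R: "\<And>x. x \<in> patch \<Longrightarrow> \<bar>pd a \<rho> x\<bar> \<le> R" "0 \<le> R"
      by (rule continuous_bounded_on_bounded[OF _ compact_imp_bounded[OF compact_patch]]) blast
    have "\<bar>pd a (?Y n) x\<bar> \<le> M * \<Theta> * R + P" for n x
    proof (cases "x \<in> patch")
      case True
      have "\<bar>y x * (pd 1 \<theta> (?n n * \<rho> x) * (?n n * pd a \<rho> x))\<bar>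
          = (\<bar>y x\<bar> * \<bar>?n n * pd 1 \<theta> (?n n * \<rho> x)\<bar>) * \<bar>pd a \<rho> x\<bar>"
        by (simp add: abs_mult)
      also have "\<dots> \<le> ((M * \<bar>\<rho> x\<bar>) * \<bar>?n n * pd 1 \<theta> (?n n * \<rho> x)\<bar>) * R"
        using y\<rho> R M True by (intro mult_mono mult_nonneg_nonneg) auto
      also have "\<dots> = M * \<bar>(?n n * \<rho> x) * pd 1 \<theta> (?n n * \<rho> x)\<bar> * R"
        by (simp add: abs_mult)
      also have "\<dots> \<le> M * \<Theta> * R"
        using \<Theta> M R by (intro mult_mono mult_nonneg_nonneg) auto
      finally have 1: "\<bar>y x * (pd 1 \<theta> (?n n * \<rho> x) * (?n n * pd a \<rho> x))\<bar> \<le> M * \<Theta> * R" .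
      have "\<bar>pd a y x * \<theta> (?n n * \<rho> x)\<bar> \<le> P"
        using mult_mono[OF P(1)[of x] \<theta>b[of "?n n * \<rho> x"]] P(2) by (simp add: abs_mult)
      with 1 show ?thesis
        unfolding pY by linarith
    next
      case False
      then show ?thesis
        unfolding pY using out outpd M \<Theta> R P by simp
    qed
    then show "\<exists>B. \<forall>n. \<forall>x\<in>\<Omega>. \<bar>pd a (?Y n) x\<bar> \<le> B" by blast
  next
    fix x assume x: "x \<in> \<Omega>"
    have ev: "\<forall>\<^sub>F n in sequentially. 2 < ?n n * \<rho> x" if "x \<in> patch"
    proof -
      have "0 < \<rho> x" using x that by (rule \<rho>_pos)
      then obtain N where "2 / \<rho> x < real N" using reals_Archimedean2 by blast
      then have "2 < ?n n * \<rho> x" if "N \<le> n" for n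
      proof -
        have "2 < real N * \<rho> x" using \<open>2 / \<rho> x < real N\<close> \<open>0 < \<rho> x\<close> by (simp add: field_simps)
        also have "\<dots> \<le> ?n n * \<rho> x" using that \<open>0 < \<rho> x\<close> by (intro mult_right_mono) auto
        finally show ?thesis .
      qed
      then show ?thesis by (auto simp: eventually_sequentially)
    qed
    show "(\<lambda>n. ?Y n x) \<longlonglongrightarrow> y x"
    proof (cases "x \<in> patch")
      case True
      have "\<forall>\<^sub>F n in sequentially. ?Y n x = y x"
        using ev[OF True] by eventually_elim (simp add: \<theta>1)
      then show ?thesis by (rule tendsto_eventually)
    qed (simp add: out)
    show "(\<lambda>n. pd a (?Y n) x) \<longlonglongrightarrow> pd a y x" for a
    proof (cases "x \<in> patch")
      case True
      have "\<forall>\<^sub>F n in sequentially. pd a (?Y n) x = pd a y x"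
        using ev[OF True]
      proof eventually_elim
        case (elim n)
        show ?case
          unfolding pY \<theta>1[OF less_imp_le[OF elim]] \<theta>'1[OF elim] by simp
      qed
      then show ?thesis by (rule tendsto_eventually)
    next
      case False
      show ?thesis
        unfolding pY out[OF False] outpd[OF False] by simp
    qed
  qed
qed

end

section \<open>The boundary layer, its vorticity and its energy\<close>

context boundary_chart
begin

definition B :: "real \<Rightarrow> real" where
  "B s = bump ((s - x0 \<bullet> e1) / \<alpha>)"

text \<open>The factor \<open>t\<^sup>2\<close> makes value and slope vanish at 0, so the velocity
  of the layer vanishes on the graph, while the second derivative 2 at 0 leaves a vorticity
  there.\<close>

definition \<mu> :: "real \<Rightarrow> real" where
  "\<mu> t = t\<^sup>2 * bump t"

text \<open>The stream function of the boundary layer of width \<open>\<delta>\<close>: its second derivatives are bounded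
  uniformly in \<open>\<delta>\<close>, and on the boundary its Laplacian does not depend on \<open>\<delta>\<close>.\<close>

definition \<psi> :: "real \<Rightarrow> real^2 \<Rightarrow> real" where
  "\<psi> \<delta> x = B (x \<bullet> e1) * (\<delta>\<^sup>2 * \<mu> (\<rho> x / \<delta>))"

text \<open>A \<open>\<delta>\<close>-independent extension of the boundary vorticity. On the graph
  the Laplacian of the layer is \<open>B\<close> times \<open>\<mu>''(0) = 2\<close> times the
  squared gradient \<open>1 + \<gamma>'^2\<close> of \<open>\<rho>\<close>; \<open>bump\<close>
  spreads this over the fixed height \<open>h\<close>.\<close>

definition F :: "real^2 \<Rightarrow> real" where
  "F x = (2 * B (x \<bullet> e1) * (1 + (pd 1 \<gamma> (x \<bullet> e1))\<^sup>2)) * bump (\<rho> x / h)"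

abbreviation \<gamma>1 where "\<gamma>1 \<equiv> pd 1 \<gamma>"
definition B\<gamma> :: "real \<Rightarrow> real" where "B\<gamma> s = B s * \<gamma>1 s"
abbreviation \<mu>1 where "\<mu>1 \<equiv> pd 1 \<mu>"
abbreviation \<mu>2 where "\<mu>2 \<equiv> pd 1 \<mu>1"

lemma Ck_B: "Ck_on 3 UNIV B"
proof -
  have "Ck_on 3 UNIV (\<lambda>s. (1 / \<alpha>) * (s - x0 \<bullet> e1))"
    by (intro Ck_cmult Ck_diff Ck_const Ck_bounded_linear bounded_linear_ident)
  from Ck_compose_real[OF Ck_bump this] show ?thesis
    by (simp add: B_def[abs_def] del: Ck_on.simps)
qed

lemma Ck_\<mu>: "Ck_on 3 UNIV \<mu>"
  unfolding \<mu>_def[abs_def]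
  by (rule Ck_mult[OF Ck_power[OF Ck_bounded_linear[OF bounded_linear_ident]] Ck_bump])

lemma Ck_\<gamma>1: "Ck_on 2 UNIV \<gamma>1"
  by (rule Ck_pd) (use \<gamma> in \<open>simp only: numeral_3_eq_3 numeral_2_eq_2\<close>)

lemma Ck_B\<gamma>: "Ck_on 2 UNIV B\<gamma>"
  unfolding B\<gamma>_def[abs_def] by (intro Ck_mult Ck_\<gamma>1 Ck_on_mono[OF Ck_B]) simp

lemma Ck_B1: "Ck_on 2 UNIV (pd 1 B)"
  by (rule Ck_pd) (use Ck_B in \<open>simp only: numeral_3_eq_3 numeral_2_eq_2\<close>)

lemma Ck_\<mu>1: "Ck_on 2 UNIV \<mu>1"
  by (rule Ck_pd) (use Ck_\<mu> in \<open>simp only: numeral_3_eq_3 numeral_2_eq_2\<close>)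

lemma Ck_\<mu>2: "Ck_on 1 UNIV \<mu>2"
  by (rule Ck_pd) (use Ck_\<mu>1 in \<open>simp only: One_nat_def numeral_2_eq_2\<close>)

lemma Ck_\<psi>: "Ck_on 3 UNIV (\<psi> \<delta>)"
proof -
  have "Ck_on 3 UNIV (\<lambda>t. \<delta>\<^sup>2 * \<mu> (t / \<delta>))"
    by (intro Ck_cmult Ck_scale Ck_\<mu>)
  from Ck_mult[OF Ck_of_s[OF Ck_B] Ck_of_\<rho>[OF this]] show ?thesis
    by (simp add: \<psi>_def[abs_def] del: Ck_on.simps)
qed

lemma B_outside: "\<alpha> < \<bar>s - x0 \<bullet> e1\<bar> \<Longrightarrow> B s = 0"
  using \<alpha> unfolding B_def by (intro bump_simps) (simp add: field_simps)

lemma \<mu>_outside: "1 < \<bar>t\<bar> \<Longrightarrow> \<mu> t = 0" "1 < \<bar>t\<bar> \<Longrightarrow> \<mu>1 t = 0" "1 < \<bar>t\<bar> \<Longrightarrow> \<mu>2 t = 0"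
proof -
  have 0: "\<mu> t = 0" if "t \<notin> {-1..1}" for t
    using that bump_simps(3)[of t] unfolding \<mu>_def by auto
  have 1: "\<mu>1 t = 0" if "t \<notin> {-1..1}" for t
    by (rule pd_eq_0_outside[OF _ 0 that]) auto
  have 2: "\<mu>2 t = 0" if "t \<notin> {-1..1}" for t
    by (rule pd_eq_0_outside[OF _ 1 that]) auto
  assume "1 < \<bar>t\<bar>"
  then have "t \<notin> {-1..1}" by auto
  then show "\<mu> t = 0" "\<mu>1 t = 0" "\<mu>2 t = 0"
    using 0 1 2 by blast+
qed

lemma \<mu>_at_0: "\<mu> 0 = 0" "\<mu>1 0 = 0" "\<mu>2 0 = 2"
proof -
  have d: "(bump has_real_derivative pd 1 bump t) (at t)" for t
    by (rule has_real_derivative_pd[OF Ck_on_differentiable[OF Ck_bump]]) auto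
  have C: "Ck_on 2 UNIV (pd 1 bump)"
    by (rule Ck_pd) (use Ck_bump in \<open>simp only: numeral_3_eq_3 numeral_2_eq_2\<close>)
  have d': "(pd 1 bump has_real_derivative pd 1 (pd 1 bump) t) (at t)" for t
    by (rule has_real_derivative_pd[OF Ck_on_differentiable[OF C]]) auto
  have 1: "\<mu>1 t = 2 * t * bump t + t\<^sup>2 * pd 1 bump t" for t
    unfolding \<mu>_def[abs_def]
    by (rule pd_real_eqI) (auto intro!: derivative_eq_intros d)
  then have "\<mu>1 = (\<lambda>t. 2 * t * bump t + t\<^sup>2 * pd 1 bump t)" by (rule ext)
  moreover have "pd 1 (\<lambda>t. 2 * t * bump t + t\<^sup>2 * pd 1 bump t) 0 = 2 * bump 0"
    by (rule pd_real_eqI) (auto intro!: derivative_eq_intros d d')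
  ultimately show "\<mu>2 0 = 2" by (simp add: bump_simps)
  show "\<mu> 0 = 0" "\<mu>1 0 = 0"
    by (simp_all add: \<mu>_def 1)
qed

lemma \<psi>_outside:
  assumes "0 < \<delta>" "\<delta> \<le> h" "x \<notin> patch"
  shows "\<psi> \<delta> x = 0"
proof (cases "\<bar>x \<bullet> e1 - x0 \<bullet> e1\<bar> \<le> \<alpha>")
  case True
  then have "h < \<bar>\<rho> x\<bar>"
    using assms(3) by (simp add: patch_def)
  then have "1 < \<bar>\<rho> x / \<delta>\<bar>"
    using assms by (simp add: field_simps)
  then show ?thesis
    by (simp add: \<psi>_def \<mu>_outside)
next
  case False
  then show ?thesis
    by (simp add: \<psi>_def B_outside)
qed

text \<open>Each derivative of the rescaled profile costs a factor \<open>1 / \<delta>\<close>. The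
  prefactor \<open>\<delta>\<^sup>2\<close> compensates two of them, so \<open>m2\<close> carries no
  power of \<open>\<delta>\<close>.\<close>

lemma \<psi>_derivatives:
  assumes \<delta>: "0 < \<delta>"
  defines "m0 \<equiv> (\<lambda>t. \<delta>\<^sup>2 * \<mu> (t / \<delta>))" and "m1 \<equiv> (\<lambda>t. \<delta> * \<mu>1 (t / \<delta>))" and "m2 \<equiv> (\<lambda>t. \<mu>2 (t / \<delta>))"
  shows "pd e1 (\<psi> \<delta>) = (\<lambda>x. pd 1 B (x \<bullet> e1) * m0 (\<rho> x) - B\<gamma> (x \<bullet> e1) * m1 (\<rho> x))" (is ?p1)
    and "pd e2 (\<psi> \<delta>) = (\<lambda>x. B (x \<bullet> e1) * m1 (\<rho> x))" (is ?p2)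
    and "pd e1 (pd e1 (\<psi> \<delta>)) = (\<lambda>x. (pd 1 (pd 1 B) (x \<bullet> e1) * m0 (\<rho> x)
        - (pd 1 B (x \<bullet> e1) * \<gamma>1 (x \<bullet> e1)) * m1 (\<rho> x))
        - (pd 1 B\<gamma> (x \<bullet> e1) * m1 (\<rho> x) - (B\<gamma> (x \<bullet> e1) * \<gamma>1 (x \<bullet> e1)) * m2 (\<rho> x)))" (is ?p11)
    and "pd e2 (pd e1 (\<psi> \<delta>)) = (\<lambda>x. pd 1 B (x \<bullet> e1) * m1 (\<rho> x) - B\<gamma> (x \<bullet> e1) * m2 (\<rho> x))" (is ?p21)
    and "pd e1 (pd e2 (\<psi> \<delta>)) = (\<lambda>x. pd 1 B (x \<bullet> e1) * m1 (\<rho> x) - B\<gamma> (x \<bullet> e1) * m2 (\<rho> x))" (is ?p12)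
    and "pd e2 (pd e2 (\<psi> \<delta>)) = (\<lambda>x. B (x \<bullet> e1) * m2 (\<rho> x))" (is ?p22)
proof -
  have m: "pd 1 m0 = m1" "pd 1 m1 = m2"
  proof -
    have "pd 1 m0 t = m1 t" for t
      unfolding m0_def m1_def using \<delta> Ck_on_differentiable[OF Ck_\<mu>]
      by (subst pd_scale) (simp_all add: power2_eq_square)
    moreover have "pd 1 m1 t = m2 t" for t
      unfolding m1_def m2_def using \<delta> Ck_on_differentiable[OF Ck_\<mu>1]
      by (subst pd_scale) simp_all
    ultimately show "pd 1 m0 = m1" "pd 1 m1 = m2" by auto
  qed
  have C1: "Ck_on 1 UNIV m0" "Ck_on 1 UNIV m1" "Ck_on 1 UNIV m2"
    unfolding m0_def m1_def m2_def
    using Ck_on_mono[OF Ck_\<mu>] Ck_on_mono[OF Ck_\<mu>1] Ck_\<mu>2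
    by (auto intro!: Ck_cmult Ck_scale simp del: Ck_on.simps One_nat_def)
  have CB: "Ck_on 1 UNIV B" "Ck_on 1 UNIV (pd 1 B)" "Ck_on 1 UNIV B\<gamma>"
    by (rule Ck_on_mono[OF Ck_B] Ck_on_mono[OF Ck_B1] Ck_on_mono[OF Ck_B\<gamma>], simp)+
  have d: "(\<lambda>x. A (x \<bullet> e1) * k (\<rho> x)) differentiable (at x)"
    if "Ck_on 1 UNIV A" "Ck_on 1 UNIV k" for A k :: "real \<Rightarrow> real" and x
    by (intro C1_differentiable Ck_mult Ck_of_s Ck_of_\<rho> that) simp
  have \<psi>: "\<psi> \<delta> = (\<lambda>x. B (x \<bullet> e1) * m0 (\<rho> x))"
    by (simp add: \<psi>_def[abs_def] m0_def)
  show 1: ?p1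
    unfolding \<psi> by (rule ext) (simp only: pd_product CB C1 m B\<gamma>_def)
  show 2: ?p2
    unfolding \<psi> by (rule ext) (simp only: pd_product CB C1 m)
  show ?p11
    unfolding 1
    by (rule ext) (simp only: pd_diff[OF d[OF CB(2) C1(1)] d[OF CB(3) C1(2)]] pd_product CB C1 m)
  show ?p21
    unfolding 1
    by (rule ext) (simp only: pd_diff[OF d[OF CB(2) C1(1)] d[OF CB(3) C1(2)]] pd_product CB C1 m)
  show ?p12
    unfolding 2 by (rule ext) (simp only: pd_product CB C1 m B\<gamma>_def)
  show ?p22
    unfolding 2 by (rule ext) (simp only: pd_product CB C1 m)
qed

lemma Ck_F: "Ck_on 1 UNIV F"
proof -
  have "Ck_on 1 UNIV (\<lambda>s. 2 * B s * (1 + (\<gamma>1 s)\<^sup>2))"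
    by (intro Ck_mult Ck_add Ck_const Ck_power Ck_on_mono[OF Ck_B] Ck_on_mono[OF Ck_\<gamma>1]) simp_all
  from Ck_of_s[OF this] show ?thesis
    unfolding F_def[abs_def]
    by (rule Ck_mult) (intro Ck_of_\<rho> Ck_scale Ck_on_mono[OF Ck_bump]; simp)
qed

lemma F_outside:
  assumes "x \<notin> patch"
  shows "F x = 0"
proof (cases "\<bar>x \<bullet> e1 - x0 \<bullet> e1\<bar> \<le> \<alpha>")
  case True
  then have "h < \<bar>\<rho> x\<bar>"
    using assms by (simp add: patch_def)
  then have "1 \<le> \<bar>\<rho> x / h\<bar>"
    using h by (simp add: field_simps)
  then show ?thesis
    by (simp add: F_def bump_simps)
next
  case False
  then show ?thesis
    by (simp add: F_def B_outside)
qed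

text \<open>At height 0 the profiles \<open>m0\<close> and \<open>m1\<close> vanish, and only the
  \<open>m2\<close> terms survive with the value \<open>\<mu>''(0) = 2\<close>.\<close>

lemma on_graph:
  assumes "0 < \<delta>" "\<rho> x = 0"
  shows "\<psi> \<delta> x = 0" "pd e1 (\<psi> \<delta>) x = 0" "pd e2 (\<psi> \<delta>) x = 0"
    "pd e1 (pd e1 (\<psi> \<delta>)) x + pd e2 (pd e2 (\<psi> \<delta>)) x = F x"
proof -
  show "\<psi> \<delta> x = 0" "pd e1 (\<psi> \<delta>) x = 0" "pd e2 (\<psi> \<delta>) x = 0"
    unfolding \<psi>_derivatives(1,2)[OF assms(1)] \<psi>_def assms(2) by (simp_all add: \<mu>_at_0)
  have "pd e1 (pd e1 (\<psi> \<delta>)) x + pd e2 (pd e2 (\<psi> \<delta>)) x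
      = (B (x \<bullet> e1) * \<gamma>1 (x \<bullet> e1) * \<gamma>1 (x \<bullet> e1)) * 2 + B (x \<bullet> e1) * 2"
    unfolding \<psi>_derivatives(3,6)[OF assms(1)] assms(2) by (simp add: \<mu>_at_0 B\<gamma>_def)
  also have "\<dots> = F x"
    unfolding F_def assms(2) by (simp add: bump_simps power2_eq_square distrib_left)
  finally show "pd e1 (pd e1 (\<psi> \<delta>)) x + pd e2 (pd e2 (\<psi> \<delta>)) x = F x" .
qed

lemma pd_e2_F: "pd e2 F x = (2 * B (x \<bullet> e1) * (1 + (\<gamma>1 (x \<bullet> e1))\<^sup>2)) * (pd 1 bump (\<rho> x / h) / h)"
proof -
  have 1: "Ck_on 1 UNIV (\<lambda>s. 2 * B s * (1 + (\<gamma>1 s)\<^sup>2))"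
    by (intro Ck_mult Ck_add Ck_const Ck_power Ck_on_mono[OF Ck_B] Ck_on_mono[OF Ck_\<gamma>1]) simp_all
  have 2: "Ck_on 1 UNIV (\<lambda>t. bump (t / h))"
    by (intro Ck_scale Ck_on_mono[OF Ck_bump]) simp
  have "pd 1 (\<lambda>t. 1 * bump (t / h)) t = (1 / h) * pd 1 bump (t / h)" for t
    by (rule pd_scale[OF Ck_on_differentiable[OF Ck_bump]]) auto
  then show ?thesis
    unfolding F_def[abs_def] by (subst pd_product(2)[OF 1 2]) simp
qed

text \<open>Inside \<open>\<Omega>\<close> the height \<open>\<rho>\<close> is positive on the
  patch, and \<open>bump\<close> does not increase at positive arguments.\<close>

lemma pd_e2_F_nonpos:
  assumes "x \<in> \<Omega>"
  shows "pd e2 F x \<le> 0"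
proof (cases "x \<in> patch")
  case True
  then have "0 < \<rho> x"
    using assms by (intro \<rho>_pos)
  then have "pd 1 bump (\<rho> x / h) \<le> 0"
    using h by (simp add: pd_bump)
  then show ?thesis
    unfolding pd_e2_F using h
    by (intro mult_nonneg_nonpos) (simp_all add: B_def bump_simps divide_nonpos_pos)
next
  case False
  then show ?thesis
    using pd_eq_0_outside[OF compact_imp_closed[OF compact_patch] F_outside] by simp
qed

text \<open>The origin of the nonzero coefficient in the final estimate: the derivative has one sign
  on \<open>\<Omega>\<close> and is strictly negative near one point.\<close>

lemma integral_pd_e2_F_neg: "(\<integral>x. pd e2 F x \<partial>lebesgue_on \<Omega>) < 0"
proof -
  \<comment> \<open>At half height above \<open>x0\<close> the tangential factor \<open>B\<close> is
    1 and \<open>bump\<close> has a strictly negative slope.\<close>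
  define x1 where "x1 = x0 + (h / 2) *\<^sub>R e2"
  have s1: "x1 \<bullet> e1 = x0 \<bullet> e1" and r1: "\<rho> x1 = h / 2"
    using \<rho>_x0 orthonormal e2_e1 by (simp_all add: x1_def \<rho>_def inner_add_left)
  have x1: "x1 \<in> \<Omega>"
    using h \<alpha> by (intro in_\<Omega>_if_\<rho>_pos) (simp_all add: patch_def s1 r1)
  have cont: "continuous_on UNIV (pd e2 F)"
    by (rule C1_continuous_pd[OF Ck_F])
  have "pd 1 bump (1/2) < 0"
    by (simp add: pd_bump power2_eq_square)
  moreover have "0 < 1 + (\<gamma>1 (x0 \<bullet> e1))\<^sup>2"
    by (intro add_pos_nonneg) auto
  ultimately have neg: "pd e2 F x1 < 0"
    unfolding pd_e2_F s1 r1 using h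
    by (intro mult_pos_neg divide_neg_pos) (simp_all add: B_def bump_simps)
  define c where "c = - pd e2 F x1 / 2"
  have c: "0 < c" using neg by (simp add: c_def)
  have "open ({x. pd e2 F x < - c} \<inter> \<Omega>)"
    by (intro open_Int open_Collect_less cont continuous_on_const open_\<Omega>)
  moreover have "x1 \<in> {x. pd e2 F x < - c} \<inter> \<Omega>"
    using x1 neg by (simp add: c_def)
  ultimately obtain d where d: "0 < d" "ball x1 d \<subseteq> {x. pd e2 F x < - c} \<inter> \<Omega>"
    using open_contains_ball by blast
  have lm: "\<Omega> \<in> lmeasurable"
    using open_\<Omega> bounded_\<Omega> by (simp add: lmeasurable_open)
  interpret finite_measure "lebesgue_on \<Omega>"
    using lm by (rule finite_measure_lebesgue_on)
  have bs: "ball x1 d \<in> sets (lebesgue_on \<Omega>)"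
    using d(2) open_\<Omega> by (auto simp: sets_restrict_space_iff)
  obtain M where M: "\<And>x. x \<in> \<Omega> \<Longrightarrow> \<bar>pd e2 F x\<bar> \<le> M"
    by (rule continuous_bounded_on_bounded[OF continuous_on_subset[OF cont subset_UNIV] bounded_\<Omega>]) blast
  have int: "integrable (lebesgue_on \<Omega>) (pd e2 F)"
    using M by (intro integrable_const_bound[of _ M] borel_measurable_lebesgue_on_continuous
        continuous_on_subset[OF cont] open_\<Omega>) auto
  have "(\<integral>x. pd e2 F x \<partial>lebesgue_on \<Omega>) \<le> (\<integral>x. - c * indicator (ball x1 d) x \<partial>lebesgue_on \<Omega>)"
  proof (rule integral_mono[OF int])
    show "integrable (lebesgue_on \<Omega>) (\<lambda>x. - c * indicator (ball x1 d) x)"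
      using bs by (intro integrable_mult_right integrable_real_indicator) (auto simp: emeasure_eq_measure)
    show "pd e2 F x \<le> - c * indicator (ball x1 d) x" if "x \<in> space (lebesgue_on \<Omega>)" for x
      using that d(2) pd_e2_F_nonpos[of x] by (auto simp: indicator_def simp del: mem_ball)
  qed
  also have "\<dots> = - c * measure (lebesgue_on \<Omega>) (ball x1 d)"
    using d(2) by (simp add: Int_absorb2)
  also have "measure (lebesgue_on \<Omega>) (ball x1 d) = measure lebesgue (ball x1 d)"
    using d(2) open_\<Omega> by (intro measure_restrict_space) auto
  also have "- c * measure lebesgue (ball x1 d) < 0"
    using c content_ball_pos[OF d(1), of x1] by simp
  finally show ?thesis .
qed

text \<open>The squared Frobenius norm of the Hessian in the frame. For
  \<open>\<psi> \<delta>\<close> it is the energy density of the layer field; both mixed terms are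
  kept so that it matches that density term by term.\<close>

definition hess_sq :: "(real^2 \<Rightarrow> real) \<Rightarrow> real^2 \<Rightarrow> real" where
  "hess_sq f x = (pd e1 (pd e1 f) x)\<^sup>2 + (pd e2 (pd e1 f) x)\<^sup>2 + (pd e1 (pd e2 f) x)\<^sup>2 + (pd e2 (pd e2 f) x)\<^sup>2"

text \<open>All second derivatives are sums of products of two functions from a finite list with
  bounded support, multiplied by 1, \<open>\<delta>\<close> or \<open>\<delta>\<^sup>2\<close>, none
  of which exceeds 1.\<close>

lemma hess_sq_bounded: "\<exists>C. \<forall>\<delta> x. 0 < \<delta> \<longrightarrow> \<delta> \<le> 1 \<longrightarrow> hess_sq (\<psi> \<delta>) x \<le> C"
proof -
  let ?S = "{B, pd 1 B, pd 1 (pd 1 B), B\<gamma>, pd 1 B\<gamma>, \<lambda>s. pd 1 B s * \<gamma>1 s, \<lambda>s. B\<gamma> s * \<gamma>1 s, \<mu>, \<mu>1, \<mu>2}"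
  have c\<gamma>: "continuous_on UNIV \<gamma>1"
    by (rule Ck_on_continuous[OF Ck_\<gamma>1])
  have cB: "continuous_on UNIV B" "continuous_on UNIV (pd 1 B)" "continuous_on UNIV (pd 1 (pd 1 B))"
    "continuous_on UNIV (pd 1 B\<gamma>)" "continuous_on UNIV B\<gamma>"
    by (rule Ck_on_continuous[OF Ck_B] Ck_on_continuous[OF Ck_B1]
        C1_continuous_pd[OF Ck_on_mono[OF Ck_B1]] C1_continuous_pd[OF Ck_on_mono[OF Ck_B\<gamma>]]
        Ck_on_continuous[OF Ck_B\<gamma>]; simp)+
  have c\<mu>: "continuous_on UNIV \<mu>" "continuous_on UNIV \<mu>1" "continuous_on UNIV \<mu>2"
    by (rule Ck_on_continuous[OF Ck_\<mu>] Ck_on_continuous[OF Ck_\<mu>1] Ck_on_continuous[OF Ck_\<mu>2])+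
  have sB: "bounded {s. B s \<noteq> 0}"
  proof (rule bounded_subset)
    show "{s. B s \<noteq> 0} \<subseteq> cball (x0 \<bullet> e1) \<alpha>"
      using B_outside by (force simp: dist_real_def abs_minus_commute not_less[symmetric])
  qed simp
  have sB1: "bounded {s. pd 1 B s \<noteq> 0}" "bounded {s. pd 1 (pd 1 B) s \<noteq> 0}"
    by (intro bounded_support_pd sB)+
  have sB\<gamma>: "bounded {s. B\<gamma> s \<noteq> 0}"
    unfolding B\<gamma>_def by (rule bounded_support_times(1)[OF sB])
  have s\<mu>: "bounded {t. \<mu> t \<noteq> 0}"
  proof (rule bounded_subset)
    show "{t. \<mu> t \<noteq> 0} \<subseteq> cball 0 1"
      using \<mu>_outside(1) by (force simp: not_less[symmetric])
  qed simp
  have s\<mu>1: "bounded {t. \<mu>1 t \<noteq> 0}" "bounded {t. \<mu>2 t \<noteq> 0}"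
    by (intro bounded_support_pd s\<mu>)+
  have "\<exists>M\<ge>0. \<forall>f\<in>?S. \<forall>t. \<bar>f t\<bar> \<le> M"
  proof (rule common_bound)
    fix f assume "f \<in> ?S"
    then show "continuous_on UNIV f \<and> bounded {t. f t \<noteq> 0}"
      using c\<gamma> cB c\<mu> sB sB1 sB\<gamma> s\<mu> s\<mu>1 bounded_support_pd[OF sB\<gamma>, of 1]
        bounded_support_times(1)[OF sB1(1), of \<gamma>1] bounded_support_times(1)[OF sB\<gamma>, of \<gamma>1]
      by (elim insertE emptyE) (simp_all add: continuous_on_mult)
  qed simp
  then obtain M where M: "0 \<le> M" "\<forall>f\<in>?S. \<forall>t. \<bar>f t\<bar> \<le> M" by blast
  have bd: "\<bar>a\<bar> \<le> M \<Longrightarrow> 0 \<le> c \<Longrightarrow> c \<le> 1 \<Longrightarrow> \<bar>u\<bar> \<le> M \<Longrightarrow> \<bar>a * (c * u)\<bar> \<le> M * M" for a c u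
    unfolding abs_mult using M(1)
    by (intro mult_mono) (auto intro: order_trans[OF mult_left_le_one_le])
  \<comment> \<open>The factor 4 counts the products in the second derivative along
    \<open>e1\<close>; the other second derivatives have fewer.\<close>
  have "hess_sq (\<psi> \<delta>) x \<le> (4 * (M * M))\<^sup>2 + (4 * (M * M))\<^sup>2 + (4 * (M * M))\<^sup>2 + (4 * (M * M))\<^sup>2"
    if \<delta>: "0 < \<delta>" "\<delta> \<le> 1" for \<delta> x
  proof -
    have \<delta>2: "\<delta>\<^sup>2 \<le> 1" using \<delta> by (simp add: power_le_one)
    have MM: "0 \<le> M * M" using M(1) by simp
    have sq: "y\<^sup>2 \<le> (4 * (M * M))\<^sup>2" if "\<bar>y\<bar> \<le> 4 * (M * M)" for y
      using that by (rule abs_le_square_iff[THEN iffD1, OF order_trans]) simp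
    have b1: "\<bar>pd 1 (pd 1 B) s * (\<delta>\<^sup>2 * \<mu> t)\<bar> \<le> M * M" for s t
      using M(2) \<delta> \<delta>2 by (intro bd) auto
    have b2: "\<bar>(pd 1 B s * \<gamma>1 s) * (\<delta> * \<mu>1 t)\<bar> \<le> M * M" for s t
      using M(2) \<delta> \<delta>2 by (intro bd) auto
    have b3: "\<bar>pd 1 B\<gamma> s * (\<delta> * \<mu>1 t)\<bar> \<le> M * M" for s t
      using M(2) \<delta> \<delta>2 by (intro bd) auto
    have b4: "\<bar>(B\<gamma> s * \<gamma>1 s) * \<mu>2 t\<bar> \<le> M * M" for s t
      using bd[of "B\<gamma> s * \<gamma>1 s" 1 "\<mu>2 t"] M(2) by auto
    have b5: "\<bar>pd 1 B s * (\<delta> * \<mu>1 t)\<bar> \<le> M * M" for s t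
      using M(2) \<delta> \<delta>2 by (intro bd) auto
    have b6: "\<bar>B\<gamma> s * \<mu>2 t\<bar> \<le> M * M" for s t
      using bd[of "B\<gamma> s" 1 "\<mu>2 t"] M(2) by auto
    have b7: "\<bar>B s * \<mu>2 t\<bar> \<le> M * M" for s t
      using bd[of "B s" 1 "\<mu>2 t"] M(2) by auto
    let ?s = "x \<bullet> e1" and ?t = "\<rho> x / \<delta>"
    have "\<bar>pd e1 (pd e1 (\<psi> \<delta>)) x\<bar> \<le> 4 * (M * M)"
      unfolding \<psi>_derivatives(3)[OF \<delta>(1)]
      using b1[of ?s ?t] b2[of ?s ?t] b3[of ?s ?t] b4[of ?s ?t] by linarith
    moreover have "\<bar>pd e2 (pd e1 (\<psi> \<delta>)) x\<bar> \<le> 4 * (M * M)"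
      unfolding \<psi>_derivatives(4)[OF \<delta>(1)]
      using b5[of ?s ?t] b6[of ?s ?t] MM by linarith
    moreover have "\<bar>pd e1 (pd e2 (\<psi> \<delta>)) x\<bar> \<le> 4 * (M * M)"
      unfolding \<psi>_derivatives(5)[OF \<delta>(1)]
      using b5[of ?s ?t] b6[of ?s ?t] MM by linarith
    moreover have "\<bar>pd e2 (pd e2 (\<psi> \<delta>)) x\<bar> \<le> 4 * (M * M)"
      unfolding \<psi>_derivatives(6)[OF \<delta>(1)]
      using b7[of ?s ?t] MM by linarith
    ultimately show ?thesis
      unfolding hess_sq_def by (intro add_mono sq)
  qed
  then show ?thesis by blast
qed

lemma hess_sq_eq_0: "0 < \<delta> \<Longrightarrow> \<delta> < \<bar>\<rho> x\<bar> \<Longrightarrow> hess_sq (\<psi> \<delta>) x = 0"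
proof -
  assume "0 < \<delta>" "\<delta> < \<bar>\<rho> x\<bar>"
  then have "1 < \<bar>\<rho> x / \<delta>\<bar>" by (simp add: field_simps)
  then show ?thesis
    unfolding hess_sq_def \<psi>_derivatives(3-6)[OF \<open>0 < \<delta>\<close>] by (simp only: \<mu>_outside) simp
qed

lemma hess_sq_outside:
  assumes "0 < \<delta>" "\<delta> \<le> h" "x \<notin> patch"
  shows "hess_sq (\<psi> \<delta>) x = 0"
proof -
  note closed = compact_imp_closed[OF compact_patch]
  have 1: "pd a (\<psi> \<delta>) y = 0" if "y \<notin> patch" for a y
    by (rule pd_eq_0_outside[OF closed \<psi>_outside[OF assms(1,2)] that])
  have "pd b (pd a (\<psi> \<delta>)) x = 0" for a b
    by (rule pd_eq_0_outside[OF closed 1 assms(3)])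
  then show ?thesis
    by (simp add: hess_sq_def)
qed

lemma continuous_hess_sq: "continuous_on UNIV (hess_sq (\<psi> \<delta>))"
proof -
  have "Ck_on 1 UNIV (pd b (\<psi> \<delta>))" for b
  proof (rule Ck_on_mono)
    show "Ck_on 2 UNIV (pd b (\<psi> \<delta>))"
      by (rule Ck_pd) (use Ck_\<psi>[of \<delta>] in \<open>simp only: numeral_3_eq_3 numeral_2_eq_2\<close>)
  qed simp
  then have "continuous_on UNIV (pd a (pd b (\<psi> \<delta>)))" for a b
    by (rule C1_continuous_pd)
  then show ?thesis
    unfolding hess_sq_def[abs_def] by (intro continuous_intros)
qed

text \<open>Each point of \<open>\<Omega>\<close> in the patch has positive height and drops out of
  the layer once \<open>\<delta>\<close> is below that height. So the uniformly bounded densities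
  tend to 0 pointwise, and dominated convergence applies.\<close>

lemma integral_hess_sq_small:
  assumes "0 < \<eta>"
  obtains \<delta> where "0 < \<delta>" "\<delta> \<le> h" "(\<integral>x. hess_sq (\<psi> \<delta>) x \<partial>lebesgue_on \<Omega>) < \<eta>"
proof -
  obtain d :: "nat \<Rightarrow> real" where d: "d \<longlonglongrightarrow> 0" "\<And>n. 0 < d n" "\<And>n. d n \<le> 1"
    by (rule null_sequence) blast
  \<comment> \<open>The factor \<open>min 1 h\<close> enforces both \<open>\<delta> \<le> 1\<close>,
    for the uniform bound, and \<open>\<delta> \<le> h\<close>, for the support in the
    patch.\<close>
  define w where "w n = d n * min 1 h" for n
  have w: "w \<longlonglongrightarrow> 0" "\<And>n. 0 < w n" "\<And>n. w n \<le> 1" "\<And>n. w n \<le> h"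
  proof -
    show "w \<longlonglongrightarrow> 0"
      unfolding w_def using tendsto_mult_right[OF d(1), of "min 1 h"] by simp
    show "0 < w n" for n
      using d(2) h by (simp add: w_def)
    have *: "w n \<le> 1 * min 1 h" for n
      unfolding w_def using d(3) h by (intro mult_right_mono) auto
    show "w n \<le> 1" "w n \<le> h" for n
      using *[of n] by auto
  qed
  obtain C where C: "\<And>\<delta> x. 0 < \<delta> \<Longrightarrow> \<delta> \<le> 1 \<Longrightarrow> hess_sq (\<psi> \<delta>) x \<le> C"
    using hess_sq_bounded by blast
  have nonneg: "0 \<le> hess_sq f x" for f x
    by (simp add: hess_sq_def)
  have "(\<lambda>n. \<integral>x. hess_sq (\<psi> (w n)) x \<partial>lebesgue_on \<Omega>) \<longlonglongrightarrow> (\<integral>x. 0 \<partial>lebesgue_on \<Omega>)"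
  proof (rule tendsto_integral_lebesgue_on)
    show "\<Omega> \<in> lmeasurable"
      using open_\<Omega> bounded_\<Omega> by (simp add: lmeasurable_open)
    show "hess_sq (\<psi> (w n)) \<in> borel_measurable (lebesgue_on \<Omega>)" for n
      by (intro borel_measurable_lebesgue_on_continuous open_\<Omega>
          continuous_on_subset[OF continuous_hess_sq subset_UNIV])
    show "\<bar>hess_sq (\<psi> (w n)) x\<bar> \<le> C" for n x
      using C[OF w(2,3)] nonneg by simp
    show "(\<lambda>n. hess_sq (\<psi> (w n)) x) \<longlonglongrightarrow> 0" if "x \<in> \<Omega>" for x
    proof (cases "x \<in> patch")
      case True
      have "0 < \<rho> x" using that True by (rule \<rho>_pos)
      then have "\<forall>\<^sub>F n in sequentially. w n < \<rho> x"
        by (rule order_tendstoD(2)[OF w(1)])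
      then have "\<forall>\<^sub>F n in sequentially. hess_sq (\<psi> (w n)) x = 0"
        by eventually_elim (use w(2) in \<open>auto intro: hess_sq_eq_0\<close>)
      then show ?thesis by (rule tendsto_eventually)
    next
      case False
      then show ?thesis
        using hess_sq_outside[OF w(2,4)] by simp
    qed
  qed
  then have "\<forall>\<^sub>F n in sequentially. (\<integral>x. hess_sq (\<psi> (w n)) x \<partial>lebesgue_on \<Omega>) < \<eta>"
    using assms by (auto dest: order_tendstoD(2))
  then obtain n where "(\<integral>x. hess_sq (\<psi> (w n)) x \<partial>lebesgue_on \<Omega>) < \<eta>"
    by (auto simp: eventually_sequentially)
  then show thesis
    using that[of "w n"] w by blast
qed

end

section \<open>The Stokes operator and the Leray projection\<close>

lemma L2_bounded:
  fixes f :: "'a::euclidean_space \<Rightarrow> 'b::euclidean_space"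
  assumes \<Omega>: "\<Omega> \<in> lmeasurable" and f: "f \<in> borel_measurable (lebesgue_on \<Omega>)"
    and B: "\<And>x. x \<in> \<Omega> \<Longrightarrow> norm (f x) \<le> B"
  shows "f \<in> L2 \<Omega>"
proof -
  interpret finite_measure "lebesgue_on \<Omega>"
    using \<Omega> by (rule finite_measure_lebesgue_on)
  have "integrable (lebesgue_on \<Omega>) (\<lambda>x. (norm (f x))\<^sup>2)"
    using f B by (intro integrable_const_bound[of _ "B\<^sup>2"]) (auto intro!: AE_I2 power_mono)
  then show ?thesis
    using f by (simp add: L2_def)
qed

lemma L2_continuous:
  fixes f :: "'a::euclidean_space \<Rightarrow> 'b::euclidean_space"
  assumes "open \<Omega>" "bounded \<Omega>" "continuous_on UNIV f"
  shows "f \<in> L2 \<Omega>"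
proof -
  have "compact (f ` closure \<Omega>)"
    using assms by (intro compact_continuous_image) (auto simp: compact_closure intro: continuous_on_subset)
  then obtain B where B: "\<And>x. x \<in> closure \<Omega> \<Longrightarrow> norm (f x) \<le> B"
    using compact_imp_bounded by (force simp: bounded_iff)
  show ?thesis
  proof (rule L2_bounded)
    show "f \<in> borel_measurable (lebesgue_on \<Omega>)"
      using assms by (intro borel_measurable_lebesgue_on_continuous) (auto intro: continuous_on_subset)
    show "norm (f x) \<le> B" if "x \<in> \<Omega>" for x
      using that B closure_subset by blast
  qed (use assms in \<open>simp add: lmeasurable_open\<close>)
qed

lemma inner_grad: "q differentiable (at x) \<Longrightarrow> z \<bullet> grad q x = pd z q x"
  by (simp add: grad_def inner_sum_right pd_Basis_expansion[of q x z] mult.commute)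

lemma pd_L2:
  fixes q :: "'a::euclidean_space \<Rightarrow> real"
  assumes "open \<Omega>" "bounded \<Omega>" "Ck_closure 1 \<Omega> q"
  shows "pd e q \<in> L2 \<Omega>"
proof -
  obtain B where B: "\<And>x. x \<in> \<Omega> \<Longrightarrow> \<bar>pd e q x\<bar> \<le> B" and c: "continuous_on \<Omega> (pd e q)"
    by (rule Ck_closure_1_pd[OF assms(3,2)]) blast
  show ?thesis
    using assms B borel_measurable_lebesgue_on_continuous[OF c assms(1)]
    by (intro L2_bounded) (auto simp: lmeasurable_open)
qed

lemma grad_L2:
  fixes q :: "'a::euclidean_space \<Rightarrow> real"
  assumes "open \<Omega>" "bounded \<Omega>" "Ck_closure 1 \<Omega> q"
  shows "grad q \<in> L2 \<Omega>"
proof -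
  have "(\<lambda>x. \<Sum>i\<in>I. pd i q x *\<^sub>R i) \<in> L2 \<Omega>" if "finite I" for I
    using that
  proof (induction I rule: finite_induct)
    case (insert i I)
    have "(\<lambda>x. pd i q x *\<^sub>R i) \<in> L2 \<Omega>"
    proof -
      have "integrable (lebesgue_on \<Omega>) (\<lambda>x. (pd i q x)\<^sup>2 * (norm i)\<^sup>2)"
        using pd_L2[OF assms, of i] by (intro integrable_mult_left) (simp add: L2_def)
      then show ?thesis
        using L2_measurable[OF pd_L2[OF assms, of i]] by (simp add: L2_def power_mult_distrib)
    qed
    then show ?case
      using insert by (simp add: L2_add)
  qed (simp add: L2_zero)
  then show ?thesis
    unfolding grad_def[abs_def] by simp
qed

text \<open>Test functions are C1 up to the boundary, so the vanishing normal trace already contains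
  the weak divergence condition. This presents \<open>solenoidal\<close> as an annihilator of
  gradients, the form required by the projection theorem.\<close>

lemma solenoidal_iff:
  "v \<in> solenoidal \<Omega> \<longleftrightarrow> v \<in> L2 \<Omega> \<and> (\<forall>q. Ck_closure 1 \<Omega> q \<longrightarrow> L2_inner \<Omega> v (grad q) = 0)"
proof -
  have z: "L2_inner \<Omega> (\<lambda>_. 0) q = 0" for q :: "'a \<Rightarrow> real"
    by (simp add: L2_inner_def)
  have "has_weak_div \<Omega> v (\<lambda>_. 0)" if "\<forall>q. Ck_closure 1 \<Omega> q \<longrightarrow> L2_inner \<Omega> v (grad q) = 0"
    unfolding has_weak_div_def
  proof (intro conjI allI impI)
    fix \<phi> assume "test_function \<Omega> \<phi>"
    then have "Ck_closure 1 \<Omega> \<phi>"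
      by (intro Ck_closure_if_Ck) (simp add: test_function_def del: Ck_on.simps)
    then show "L2_inner \<Omega> v (grad \<phi>) = - L2_inner \<Omega> (\<lambda>_. 0) \<phi>"
      using that by (simp add: z del: Ck_closure.simps)
  qed (rule L2_zero)
  then show ?thesis
    by (auto simp: solenoidal_def normal_trace_def z simp del: Ck_closure.simps One_nat_def)
qed

lemma leray:
  fixes f :: "'a::euclidean_space \<Rightarrow> 'a"
  assumes "open \<Omega>" "bounded \<Omega>" "f \<in> L2 \<Omega>"
  shows "leray \<Omega> f \<in> solenoidal \<Omega>"
    and "\<And>v. v \<in> solenoidal \<Omega> \<Longrightarrow> L2_inner \<Omega> (\<lambda>x. f x - leray \<Omega> f x) v = 0"
proof -
  let ?Q = "grad ` {q. Ck_closure 1 \<Omega> q}"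
  have lm: "\<Omega> \<in> lmeasurable"
    using assms by (simp add: lmeasurable_open)
  have Q: "?Q \<subseteq> L2 \<Omega>"
    using grad_L2[OF assms(1,2)] by blast
  have H: "solenoidal \<Omega> = {v \<in> L2 \<Omega>. \<forall>q\<in>?Q. L2_inner \<Omega> v q = 0}"
    by (auto simp: solenoidal_iff simp del: Ck_closure.simps One_nat_def)
  have "\<exists>w. w \<in> solenoidal \<Omega> \<and> (\<forall>v\<in>solenoidal \<Omega>. L2_inner \<Omega> (\<lambda>x. f x - w x) v = 0)"
    unfolding H by (rule L2_projection_exists[OF lm Q assms(3)]) blast
  from someI_ex[OF this] show "leray \<Omega> f \<in> solenoidal \<Omega>"
    "\<And>v. v \<in> solenoidal \<Omega> \<Longrightarrow> L2_inner \<Omega> (\<lambda>x. f x - leray \<Omega> f x) v = 0"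
    unfolding leray_def by blast+
qed

lemma solenoidal_L2: "v \<in> solenoidal \<Omega> \<Longrightarrow> v \<in> L2 \<Omega>"
  by (simp add: solenoidal_def)

lemma Ck_compose_bounded_linear:
  assumes L: "bounded_linear L"
  shows "Ck_on k UNIV f \<Longrightarrow> Ck_on k UNIV (\<lambda>x. L (f x))"
proof (induction k arbitrary: f)
  case 0
  then show ?case
    by (auto intro: continuous_on_compose2[OF linear_continuous_on[OF L, of UNIV]])
next
  case (Suc k)
  then have "pd i (\<lambda>x. L (f x)) = (\<lambda>x. L (pd i f x))" for i
    by (intro ext pd_compose_bounded_linear[OF L]) simp
  moreover have "(\<lambda>x. L (f x)) differentiable (at x)" for x
    using Suc.prems bounded_linear.has_derivative[OF L] by (fastforce simp: differentiable_def)
  ultimately show ?case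
    using Suc by simp
qed

lemma Ck_pd_2: "Ck_on 2 UNIV f \<Longrightarrow> Ck_on 1 UNIV (pd e f)"
  by (rule Ck_pd) (simp only: One_nat_def numeral_2_eq_2)

lemma pd_linear_combination:
  assumes "f differentiable (at x)" "g differentiable (at x)"
  shows "pd e (\<lambda>x. f x + c *\<^sub>R g x) x = pd e f x + c *\<^sub>R pd e g x"
  by (rule pd_eqI[where D = "\<lambda>e. pd e f x + c *\<^sub>R pd e g x"])
     (intro has_derivative_add has_derivative_scaleR_right has_derivative_pd assms)

lemma laplacian_linear_combination:
  assumes "Ck_on 2 UNIV f" "Ck_on 2 UNIV g"
  shows "laplacian (\<lambda>x. f x + c *\<^sub>R g x) x = laplacian f x + c *\<^sub>R laplacian g x"
proof -
  have "pd i (\<lambda>x. f x + c *\<^sub>R g x) = (\<lambda>x. pd i f x + c *\<^sub>R pd i g x)" for i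
    using Ck_on_differentiable[OF assms(1)] Ck_on_differentiable[OF assms(2)]
    by (intro ext pd_linear_combination) auto
  moreover have "pd i (\<lambda>x. pd i f x + c *\<^sub>R pd i g x) x = pd i (pd i f) x + c *\<^sub>R pd i (pd i g) x" for i
    using assms by (intro pd_linear_combination C1_differentiable Ck_pd_2)
  ultimately show ?thesis
    by (simp add: laplacian_def sum.distrib scaleR_sum_right)
qed

lemma divergence_linear_combination:
  assumes "Ck_on 1 UNIV f" "Ck_on 1 UNIV g"
  shows "divergence (\<lambda>x. f x + c *\<^sub>R g x) x = divergence f x + c * divergence g x"
  using pd_linear_combination[OF C1_differentiable[OF assms(1)] C1_differentiable[OF assms(2)]]
  by (simp add: divergence_def inner_add_left sum.distrib sum_distrib_left)

lemma Ck_divergence: "Ck_on 2 UNIV u \<Longrightarrow> Ck_on 1 UNIV (divergence u)"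
  unfolding divergence_def[abs_def]
  by (intro Ck_sum Ck_compose_bounded_linear[OF bounded_linear_inner_left] Ck_pd_2)

lemma continuous_laplacian: "Ck_on 2 UNIV u \<Longrightarrow> continuous_on UNIV (laplacian u)"
  unfolding laplacian_def[abs_def] by (intro continuous_on_sum C1_continuous_pd Ck_pd_2)

lemma continuous_grad: "Ck_on 1 UNIV q \<Longrightarrow> continuous_on UNIV (grad q)"
  unfolding grad_def[abs_def] by (intro continuous_intros C1_continuous_pd)

lemma integrable_continuous_lebesgue_on:
  fixes f :: "'a::euclidean_space \<Rightarrow> real"
  assumes "open \<Omega>" "bounded \<Omega>" "continuous_on UNIV f"
  shows "integrable (lebesgue_on \<Omega>) f"
  using L2_integrable_inner[OF L2_continuous[OF assms] L2_continuous[OF assms(1,2) continuous_on_const[of _ 1]]]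
  by simp

text \<open>Integration by parts is done component by component; the null trace of each component
  removes the boundary term.\<close>

lemma Green_identity:
  fixes u :: "'a::euclidean_space \<Rightarrow> 'a"
  assumes \<Omega>: "open \<Omega>" "bounded \<Omega>" and u: "Ck_on 2 UNIV u" and nt: "\<And>j. null_trace \<Omega> (\<lambda>x. u x \<bullet> j)"
  shows "L2_inner \<Omega> u (laplacian u) = - (\<Sum>i\<in>Basis. L2_inner \<Omega> (pd i u) (pd i u))"
proof -
  have u1: "Ck_on 1 UNIV u"
    using u by (rule Ck_on_mono) simp
  have comp: "Ck_on 1 UNIV (\<lambda>x. pd i u x \<bullet> j)" for i j
    by (intro Ck_compose_bounded_linear[OF bounded_linear_inner_left] Ck_pd_2 u)
  have p1: "pd i (\<lambda>x. u x \<bullet> j) x = pd i u x \<bullet> j" for i j x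
    by (rule pd_compose_bounded_linear[OF bounded_linear_inner_left C1_differentiable[OF u1]])
  have p2: "pd i (\<lambda>x. pd i u x \<bullet> j) x = pd i (pd i u) x \<bullet> j" for i j x
    by (rule pd_compose_bounded_linear[OF bounded_linear_inner_left C1_differentiable[OF Ck_pd_2[OF u]]])
  have cu: "continuous_on UNIV u" "continuous_on UNIV (pd i u)" "continuous_on UNIV (pd i (pd i u))" for i
    using Ck_on_continuous[OF u] C1_continuous_pd[OF u1] C1_continuous_pd[OF Ck_pd_2[OF u]] by auto
  have e1: "u x \<bullet> laplacian u x = (\<Sum>i\<in>Basis. \<Sum>j\<in>Basis. (u x \<bullet> j) * (pd i (pd i u) x \<bullet> j))" for x
    unfolding laplacian_def inner_sum_right by (intro sum.cong refl euclidean_inner)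
  have e2: "(\<Sum>j\<in>Basis. (pd i u x \<bullet> j) * (pd i u x \<bullet> j)) = pd i u x \<bullet> pd i u x" for i x
    by (rule euclidean_inner[symmetric])
  have "L2_inner \<Omega> u (laplacian u)
      = (\<integral>x. (\<Sum>i\<in>Basis. \<Sum>j\<in>Basis. (u x \<bullet> j) * (pd i (pd i u) x \<bullet> j)) \<partial>lebesgue_on \<Omega>)"
    unfolding L2_inner_def e1 ..
  also have "\<dots> = (\<Sum>i\<in>Basis. \<Sum>j\<in>Basis. \<integral>x. (u x \<bullet> j) * (pd i (pd i u) x \<bullet> j) \<partial>lebesgue_on \<Omega>)"
    by (subst Bochner_Integration.integral_sum)
      (auto intro!: sum.cong Bochner_Integration.integral_sum integrable_continuous_lebesgue_on \<Omega>
        continuous_intros cu)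
  also have "\<dots> = (\<Sum>i\<in>Basis. \<Sum>j\<in>Basis. - (\<integral>x. (pd i u x \<bullet> j) * (pd i u x \<bullet> j) \<partial>lebesgue_on \<Omega>))"
  proof (intro sum.cong refl)
    fix i j :: 'a
    show "(\<integral>x. (u x \<bullet> j) * (pd i (pd i u) x \<bullet> j) \<partial>lebesgue_on \<Omega>)
        = - (\<integral>x. (pd i u x \<bullet> j) * (pd i u x \<bullet> j) \<partial>lebesgue_on \<Omega>)"
      using null_trace_by_parts[OF nt[of j] comp[of i j] \<Omega>, of i] by (simp add: p1 p2)
  qed
  also have "\<dots> = - (\<Sum>i\<in>Basis. \<integral>x. (\<Sum>j\<in>Basis. (pd i u x \<bullet> j) * (pd i u x \<bullet> j)) \<partial>lebesgue_on \<Omega>)"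
    by (subst Bochner_Integration.integral_sum)
      (auto simp: sum_negf intro!: integrable_continuous_lebesgue_on \<Omega> continuous_intros cu)
  also have "\<dots> = - (\<Sum>i\<in>Basis. L2_inner \<Omega> (pd i u) (pd i u))"
    unfolding L2_inner_def e2 ..
  finally show ?thesis .
qed

lemma L2_inner_extended_stokes:
  fixes u :: "'a::euclidean_space \<Rightarrow> 'a"
  assumes \<Omega>: "open \<Omega>" "bounded \<Omega>" and u: "Ck_on 2 UNIV u"
  defines "f \<equiv> (\<lambda>x. laplacian u x - grad (divergence u) x)"
  shows "L2_inner \<Omega> u (extended_stokes \<Omega> u)
    = - L2_inner \<Omega> u (laplacian u) + L2_inner \<Omega> u (\<lambda>x. f x - leray \<Omega> f x)"
proof -
  have L: "u \<in> L2 \<Omega>" "laplacian u \<in> L2 \<Omega>" "f \<in> L2 \<Omega>"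
    unfolding f_def using Ck_on_continuous[OF u] continuous_laplacian[OF u] continuous_grad[OF Ck_divergence[OF u]]
    by (auto intro!: L2_continuous \<Omega> L2_diff)
  have g: "(\<lambda>x. f x - leray \<Omega> f x) \<in> L2 \<Omega>"
    using L solenoidal_L2[OF leray(1)[OF \<Omega> L(3)]] by (intro L2_diff)
  have "extended_stokes \<Omega> u = (\<lambda>x. (f x - leray \<Omega> f x) - laplacian u x)"
    unfolding extended_stokes_def stokes_pressure_grad_def f_def Let_def by simp
  then show ?thesis
    using L2_inner_diff_right[OF L(1) g L(2)] by simp
qed

text \<open>Cutoffs equal to 1 on a compact exhaustion of \<open>\<Omega>\<close> converge to 1
  pointwise, so positivity of the integral survives for one of them. This turns a constant test
  field into one supported in the interior.\<close>

lemma cutoff_integral_pos: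
  fixes \<phi> :: "'a::euclidean_space \<Rightarrow> real"
  assumes \<Omega>: "open \<Omega>" and \<phi>: "integrable (lebesgue_on \<Omega>) \<phi>" "0 < (\<integral>x. \<phi> x \<partial>lebesgue_on \<Omega>)"
  obtains T K where "Ck_on k UNIV T" "compact K" "K \<subseteq> \<Omega>" "\<And>x. x \<notin> K \<Longrightarrow> T x = 0"
    "0 < (\<integral>x. T x * \<phi> x \<partial>lebesgue_on \<Omega>)"
proof -
  obtain C where C: "\<And>n::nat. compact (C n)" "\<And>n. C n \<subseteq> \<Omega>" "\<Union>(range C) = \<Omega>"
    "\<And>K. \<lbrakk>compact K; K \<subseteq> \<Omega>\<rbrakk> \<Longrightarrow> \<exists>N. \<forall>n\<ge>N. K \<subseteq> C n"
    by (rule open_Union_compact_subsets[OF \<Omega>]) blast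
  have "\<exists>T L. Ck_on k UNIV T \<and> (\<forall>x. 0 \<le> T x \<and> T x \<le> 1) \<and> (\<forall>x\<in>C n. T x = 1) \<and>
      compact L \<and> L \<subseteq> \<Omega> \<and> (\<forall>x. x \<notin> L \<longrightarrow> T x = (0::real))" for n
    by (rule smooth_Urysohn[OF C(1)[of n] \<Omega> C(2)[of n], of k]) blast
  then obtain T L where T: "\<And>n. Ck_on k UNIV (T n)" "\<And>n x. 0 \<le> T n x \<and> T n x \<le> (1::real)"
    "\<And>n x. x \<in> C n \<Longrightarrow> T n x = 1" and L: "\<And>n. compact (L n)" "\<And>n. L n \<subseteq> \<Omega>" "\<And>n x. x \<notin> L n \<Longrightarrow> T n x = 0"
    by metis
  have [measurable]: "T n \<in> borel_measurable (lebesgue_on \<Omega>)" "\<phi> \<in> borel_measurable (lebesgue_on \<Omega>)" for n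
    using \<phi>(1) Ck_on_continuous[OF T(1)[of n]] \<Omega>
    by (auto intro!: borel_measurable_lebesgue_on_continuous intro: continuous_on_subset)
  have "(\<lambda>n. \<integral>x. T n x * \<phi> x \<partial>lebesgue_on \<Omega>) \<longlonglongrightarrow> (\<integral>x. \<phi> x \<partial>lebesgue_on \<Omega>)"
  proof (rule integral_dominated_convergence[where w = "\<lambda>x. \<bar>\<phi> x\<bar>"])
    show "AE x in lebesgue_on \<Omega>. (\<lambda>n. T n x * \<phi> x) \<longlonglongrightarrow> \<phi> x"
    proof (rule AE_I2)
      fix x assume "x \<in> space (lebesgue_on \<Omega>)"
      then obtain N where "\<forall>n\<ge>N. {x} \<subseteq> C n"
        using C(4)[of "{x}"] by auto
      then have "\<forall>\<^sub>F n in sequentially. T n x * \<phi> x = \<phi> x"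
        unfolding eventually_sequentially by (intro exI[of _ N]) (simp add: T(3))
      then show "(\<lambda>n. T n x * \<phi> x) \<longlonglongrightarrow> \<phi> x"
        by (rule tendsto_eventually)
    qed
    show "AE x in lebesgue_on \<Omega>. norm (T n x * \<phi> x) \<le> \<bar>\<phi> x\<bar>" for n
      using T(2)[of n] by (intro AE_I2) (simp add: abs_mult mult_left_le_one_le)
  qed (use \<phi>(1) in auto)
  then have "\<forall>\<^sub>F n in sequentially. 0 < (\<integral>x. T n x * \<phi> x \<partial>lebesgue_on \<Omega>)"
    by (rule order_tendstoD(1)) (rule \<phi>(2))
  then obtain n where "0 < (\<integral>x. T n x * \<phi> x \<partial>lebesgue_on \<Omega>)"
    by (auto simp: eventually_sequentially)
  then show thesis
    using that[OF T(1) L(1) L(2) L(3)] by blast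
qed

text \<open>The parallelogram law with the square of \<open>f - c g\<close> dropped. It separates
  the energy of the layer from that of the perturbation without estimating their cross term.\<close>

lemma L2_inner_add_self_le:
  assumes "f \<in> L2 \<Omega>" "g \<in> L2 \<Omega>"
  shows "L2_inner \<Omega> (\<lambda>x. f x + c *\<^sub>R g x) (\<lambda>x. f x + c *\<^sub>R g x)
    \<le> 2 * L2_inner \<Omega> f f + 2 * c\<^sup>2 * L2_inner \<Omega> g g"
proof -
  note g = L2_scaleR[OF assms(2), of c]
  have "0 \<le> L2_inner \<Omega> (\<lambda>x. f x - c *\<^sub>R g x) (\<lambda>x. f x - c *\<^sub>R g x)"
    by (rule L2_inner_nonneg)
  then show ?thesis
    using assms g by (simp add: L2_inner_diff_self L2_inner_add_left L2_inner_add_right L2_add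
        L2_inner_scaleR_left L2_inner_scaleR_right L2_inner_commute[of \<Omega> g f] power2_eq_square algebra_simps)
qed

section \<open>Rotated gradients and the construction of the field\<close>

context graph_chart
begin

lemma frame_expansion: "x = (x \<bullet> e1) *\<^sub>R e1 + (x \<bullet> e2) *\<^sub>R e2"
proof -
  have ne: "e1 \<noteq> e2" "e1 \<noteq> 0" "e2 \<noteq> 0"
    using orthonormal by auto
  have ind: "independent {e1, e2}"
    using ne orthonormal e2_e1
    by (intro pairwise_orthogonal_independent) (auto simp: pairwise_def orthogonal_def)
  have "x \<in> span {e1, e2}"
    using card_ge_dim_independent[OF subset_UNIV ind] ne by auto
  from orthonormal_basis_expand[OF _ _ this]
  have "(\<Sum>v\<in>{e1, e2}. (x \<bullet> v) *\<^sub>R v) = x"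
    using orthonormal e2_e1 by (auto simp: pairwise_def orthogonal_def norm_eq_1)
  then show ?thesis
    using ne by simp
qed

text \<open>The trace of a bilinear form is the same in every orthonormal basis: expand
  \<open>i\<close> in the frame and use that the products
  \<open>(a \<bullet> i) * (c \<bullet> i)\<close> sum to \<open>a \<bullet> c\<close>. Operators
  defined through \<open>Basis\<close> can thus be computed in the frame of the chart.\<close>

lemma trace_frame:
  fixes b :: "real^2 \<Rightarrow> real^2 \<Rightarrow> 'b::real_vector"
  assumes b: "\<And>a c d. b (a + c) d = b a d + b c d" "\<And>a c d. b a (c + d) = b a c + b a d"
    "\<And>s a c. b (s *\<^sub>R a) c = s *\<^sub>R b a c" "\<And>s a c. b a (s *\<^sub>R c) = s *\<^sub>R b a c"
  shows "(\<Sum>i\<in>Basis. b i i) = b e1 e1 + b e2 e2"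
proof -
  have eq: "b i i = ((e1 \<bullet> i) * (e1 \<bullet> i)) *\<^sub>R b e1 e1 + ((e1 \<bullet> i) * (e2 \<bullet> i)) *\<^sub>R b e1 e2
      + ((e2 \<bullet> i) * (e1 \<bullet> i)) *\<^sub>R b e2 e1 + ((e2 \<bullet> i) * (e2 \<bullet> i)) *\<^sub>R b e2 e2" for i
  proof -
    have "b i i = b ((i \<bullet> e1) *\<^sub>R e1 + (i \<bullet> e2) *\<^sub>R e2) ((i \<bullet> e1) *\<^sub>R e1 + (i \<bullet> e2) *\<^sub>R e2)"
      by (rule arg_cong2[OF frame_expansion frame_expansion])
    then show ?thesis
      by (simp add: b inner_commute[of i] scaleR_add_right mult.commute add_ac)
  qed
  have "(\<Sum>i\<in>Basis. b i i) = (e1 \<bullet> e1) *\<^sub>R b e1 e1 + (e1 \<bullet> e2) *\<^sub>R b e1 e2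
      + (e2 \<bullet> e1) *\<^sub>R b e2 e1 + (e2 \<bullet> e2) *\<^sub>R b e2 e2"
    unfolding sum.cong[OF refl eq] sum.distrib scaleR_sum_left[symmetric] euclidean_inner[symmetric] ..
  then show ?thesis
    using orthonormal e2_e1 by simp
qed

definition rot :: "(real^2 \<Rightarrow> real) \<Rightarrow> real^2 \<Rightarrow> real^2" where
  "rot y x = pd e1 y x *\<^sub>R e2 - pd e2 y x *\<^sub>R e1"

lemma Ck_rot: "Ck_on (Suc k) UNIV y \<Longrightarrow> Ck_on k UNIV (rot y)"
  unfolding rot_def[abs_def] by (intro Ck_diff Ck_scaleR Ck_pd Ck_const)

lemma rot_L2: "bounded \<Omega> \<Longrightarrow> Ck_on 1 UNIV y \<Longrightarrow> rot y \<in> L2 \<Omega>"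
  using Ck_rot[of 0 y] by (intro L2_continuous open_\<Omega>) simp_all

lemma rot_diff: "Ck_on 1 UNIV y \<Longrightarrow> Ck_on 1 UNIV z \<Longrightarrow> rot (\<lambda>x. y x - z x) x = rot y x - rot z x"
  by (simp add: rot_def pd_diff[OF C1_differentiable C1_differentiable] algebra_simps)

text \<open>The product of \<open>rot y\<close> with \<open>grad q\<close> is antisymmetric in the
  two frame derivatives, and its two halves have equal integrals by
  \<open>null_trace_pd_swap\<close>.\<close>

lemma rot_solenoidal:
  assumes y: "null_trace \<Omega> y" and bounded: "bounded \<Omega>"
  shows "rot y \<in> solenoidal \<Omega>"
  unfolding solenoidal_iff
proof (intro conjI allI impI)
  have y1: "Ck_on 1 UNIV y"
    using y unfolding null_trace_def by blast
  show "rot y \<in> L2 \<Omega>"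
    by (rule rot_L2[OF bounded y1])
  fix q :: "real^2 \<Rightarrow> real" assume q: "Ck_closure 1 \<Omega> q"
  have L: "pd e y \<in> L2 \<Omega>" "pd e q \<in> L2 \<Omega>" for e
    using pd_L2[OF open_\<Omega> bounded q] L2_continuous[OF open_\<Omega> bounded C1_continuous_pd[OF y1]] by auto
  have "L2_inner \<Omega> (rot y) (grad q)
      = (\<integral>x. pd e1 y x * pd e2 q x - pd e2 y x * pd e1 q x \<partial>lebesgue_on \<Omega>)"
    unfolding L2_inner_def
  proof (intro Bochner_Integration.integral_cong refl)
    fix x assume "x \<in> space (lebesgue_on \<Omega>)"
    then have "q differentiable (at x)"
      using q by simp
    then show "rot y x \<bullet> grad q x = pd e1 y x * pd e2 q x - pd e2 y x * pd e1 q x"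
      by (simp add: rot_def inner_diff_left inner_grad)
  qed
  also have "\<dots> = (\<integral>x. pd e1 y x * pd e2 q x \<partial>lebesgue_on \<Omega>) - (\<integral>x. pd e2 y x * pd e1 q x \<partial>lebesgue_on \<Omega>)"
    using L2_integrable_inner[OF L(1) L(2)] by (intro Bochner_Integration.integral_diff) simp_all
  also have "\<dots> = 0"
    using null_trace_pd_swap[OF y q open_\<Omega> bounded, of e1 e2] by simp
  finally show "L2_inner \<Omega> (rot y) (grad q) = 0" .
qed

definition lap :: "(real^2 \<Rightarrow> real) \<Rightarrow> real^2 \<Rightarrow> real" where
  "lap f x = pd e1 (pd e1 f) x + pd e2 (pd e2 f) x"

lemma pd_rot: "Ck_on 2 UNIV f \<Longrightarrow> pd e (rot f) x = pd e (pd e1 f) x *\<^sub>R e2 - pd e (pd e2 f) x *\<^sub>R e1"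
proof -
  assume f: "Ck_on 2 UNIV f"
  have d: "pd a f differentiable (at x)" for a
    by (rule C1_differentiable[OF Ck_pd_2[OF f]])
  show ?thesis
    unfolding rot_def[abs_def]
    by (rule pd_eqI[where D = "\<lambda>e. pd e (pd e1 f) x *\<^sub>R e2 - pd e (pd e2 f) x *\<^sub>R e1"])
      (intro has_derivative_diff has_derivative_scaleR_left has_derivative_pd d)
qed

lemma divergence_rot:
  assumes f: "Ck_on 2 UNIV f"
  shows "divergence (rot f) x = 0"
proof -
  have d: "rot f differentiable (at x)"
    by (rule C1_differentiable[OF Ck_rot]) (use f in \<open>simp only: One_nat_def numeral_2_eq_2\<close>)
  have "divergence (rot f) x = pd e1 (rot f) x \<bullet> e1 + pd e2 (rot f) x \<bullet> e2"
    unfolding divergence_def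
    by (rule trace_frame[where b = "\<lambda>i j. pd i (rot f) x \<bullet> j"])
      (simp_all add: pd_add_direction[OF d] pd_scaleR_direction[OF d] inner_add)
  also have "\<dots> = pd e2 (pd e1 f) x - pd e1 (pd e2 f) x"
    using orthonormal e2_e1 by (simp add: pd_rot[OF f] inner_diff_left)
  also have "\<dots> = 0"
    by (simp add: pd_commute[OF f, of e2 e1])
  finally show ?thesis .
qed

lemma laplacian_frame:
  fixes u :: "real^2 \<Rightarrow> real^2"
  assumes u: "Ck_on 2 UNIV u"
  shows "laplacian u x = pd e1 (pd e1 u) x + pd e2 (pd e2 u) x"
proof -
  have d: "u differentiable (at y)" "pd a u differentiable (at y)" for a y
    using Ck_on_differentiable[OF u] C1_differentiable[OF Ck_pd_2[OF u]] by auto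
  have 1: "pd (a + c) u = (\<lambda>x. pd a u x + pd c u x)" "pd (s *\<^sub>R a) u = (\<lambda>x. s *\<^sub>R pd a u x)" for a c s
    using d by (auto simp: pd_add_direction pd_scaleR_direction)
  have 2: "pd e (\<lambda>x. s *\<^sub>R pd a u x) x = s *\<^sub>R pd e (pd a u) x" for e s a
    by (rule pd_compose_bounded_linear[OF bounded_linear_scaleR_right d(2)])
  show ?thesis
    unfolding laplacian_def
    by (rule trace_frame[where b = "\<lambda>i j. pd i (pd j u) x"])
      (simp_all add: pd_add_direction[OF d(2)] pd_scaleR_direction[OF d(2)] 1 2 pd_add[OF d(2) d(2)])
qed

text \<open>Mixed third derivatives are reordered by applying \<open>pd_commute\<close> once to
  \<open>f\<close>, inside an outer derivative, and once to a first derivative of \<open>f\<close>;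
  class C3 permits the latter.\<close>

lemma laplacian_rot:
  assumes f: "Ck_on 3 UNIV f"
  shows "laplacian (rot f) x = rot (lap f) x"
proof -
  have f2: "Ck_on 2 UNIV f"
    by (rule Ck_on_mono[OF f]) simp
  have p2: "Ck_on 2 UNIV (pd a f)" for a
    by (rule Ck_pd) (use f in \<open>simp only: numeral_3_eq_3 numeral_2_eq_2\<close>)
  have d: "pd a (pd c f) differentiable (at x)" for a c x
    by (rule C1_differentiable[OF Ck_pd_2[OF p2]])
  have u: "Ck_on 2 UNIV (rot f)"
    by (rule Ck_rot) (use f in \<open>simp only: numeral_3_eq_3 numeral_2_eq_2\<close>)
  have pp: "pd e (pd e (rot f)) x = pd e (pd e (pd e1 f)) x *\<^sub>R e2 - pd e (pd e (pd e2 f)) x *\<^sub>R e1" for e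
  proof -
    have "pd e (rot f) = (\<lambda>x. pd e (pd e1 f) x *\<^sub>R e2 - pd e (pd e2 f) x *\<^sub>R e1)"
      by (rule ext) (rule pd_rot[OF f2])
    then show ?thesis
      by (simp only:) (rule pd_eqI[where D = "\<lambda>c. pd c (pd e (pd e1 f)) x *\<^sub>R e2 - pd c (pd e (pd e2 f)) x *\<^sub>R e1"],
        intro has_derivative_diff has_derivative_scaleR_left has_derivative_pd d)
  qed
  have sym: "pd a (pd c f) = pd c (pd a f)" for a c
    by (rule ext) (rule pd_commute[OF f2])
  have l: "pd e (lap f) x = pd e (pd e1 (pd e1 f)) x + pd e (pd e2 (pd e2 f)) x" for e
    unfolding lap_def[abs_def] by (rule pd_add[OF d d])
  have s1: "pd e2 (pd e2 (pd e1 f)) x = pd e1 (pd e2 (pd e2 f)) x"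
    unfolding sym[of e2 e1] by (rule pd_commute[OF p2])
  have s2: "pd e1 (pd e1 (pd e2 f)) x = pd e2 (pd e1 (pd e1 f)) x"
    unfolding sym[of e1 e2] by (rule pd_commute[OF p2])
  show ?thesis
    unfolding laplacian_frame[OF u] pp rot_def l s1 s2 by (simp add: algebra_simps)
qed

end

section \<open>The layer as a solenoidal field and its perturbation\<close>

context boundary_chart
begin

text \<open>Vorticity and \<open>F\<close> agree on the graph and both vanish off the patch.
  Consequently the rotated gradient of their difference is solenoidal and invisible to the
  pressure.\<close>

lemma lap_\<psi>_minus_F_null_trace:
  assumes "0 < \<delta>" "\<delta> \<le> h"
  shows "null_trace \<Omega> (\<lambda>x. lap (\<psi> \<delta>) x - F x)"
proof (rule null_trace_chart)
  have p2: "Ck_on 2 UNIV (pd a (\<psi> \<delta>))" for a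
    by (rule Ck_pd) (use Ck_\<psi>[of \<delta>] in \<open>simp only: numeral_3_eq_3 numeral_2_eq_2\<close>)
  show "Ck_on 1 UNIV (\<lambda>x. lap (\<psi> \<delta>) x - F x)"
    unfolding lap_def by (intro Ck_diff Ck_add Ck_pd_2 p2 Ck_F)
  show "lap (\<psi> \<delta>) x - F x = 0" if "x \<notin> patch" for x
  proof -
    note closed = compact_imp_closed[OF compact_patch]
    have 1: "pd a (\<psi> \<delta>) y = 0" if "y \<notin> patch" for a y
      by (rule pd_eq_0_outside[OF closed \<psi>_outside[OF assms] that])
    have "pd b (pd a (\<psi> \<delta>)) x = 0" for a b
      by (rule pd_eq_0_outside[OF closed 1 that])
    then show ?thesis
      by (simp add: lap_def F_outside[OF that])
  qed
  show "lap (\<psi> \<delta>) x - F x = 0" if "\<rho> x = 0" for x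
    using on_graph(4)[OF assms(1) that] by (simp add: lap_def)
qed

text \<open>Every component of \<open>rot (\<psi> \<delta>)\<close>, in whatever direction, is such
  a combination; this supplies the zero trace for the Green identity.\<close>

lemma pd_\<psi>_null_trace:
  assumes "0 < \<delta>" "\<delta> \<le> h"
  shows "null_trace \<Omega> (\<lambda>x. a * pd e1 (\<psi> \<delta>) x + b * pd e2 (\<psi> \<delta>) x)"
proof (rule null_trace_chart)
  have p1: "Ck_on 1 UNIV (pd c (\<psi> \<delta>))" for c
    by (rule Ck_pd_2[OF Ck_on_mono[OF Ck_\<psi>]]) simp
  show "Ck_on 1 UNIV (\<lambda>x. a * pd e1 (\<psi> \<delta>) x + b * pd e2 (\<psi> \<delta>) x)"
    by (intro Ck_add Ck_cmult p1)
  show "a * pd e1 (\<psi> \<delta>) x + b * pd e2 (\<psi> \<delta>) x = 0" if "x \<notin> patch" for x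
    using pd_eq_0_outside[OF compact_imp_closed[OF compact_patch] \<psi>_outside[OF assms] that] by simp
  show "a * pd e1 (\<psi> \<delta>) x + b * pd e2 (\<psi> \<delta>) x = 0" if "\<rho> x = 0" for x
    using on_graph(2,3)[OF assms(1) that] by simp
qed

lemma rot_\<psi>_frontier:
  assumes "0 < \<delta>" "\<delta> \<le> h" "x \<in> frontier \<Omega>"
  shows "rot (\<psi> \<delta>) x = 0"
proof (cases "x \<in> patch")
  case True
  then have "\<rho> x = 0"
    using assms(3) patch_subset by (intro \<rho>_frontier) auto
  then show ?thesis
    using on_graph(2,3)[OF assms(1)] by (simp add: rot_def)
next
  case False
  then show ?thesis
    using pd_eq_0_outside[OF compact_imp_closed[OF compact_patch] \<psi>_outside[OF assms(1,2)]]
    by (simp add: rot_def)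
qed

lemma \<psi>_null_trace:
  assumes "0 < \<delta>" "\<delta> \<le> h"
  shows "null_trace \<Omega> (\<psi> \<delta>)"
  by (rule null_trace_chart[OF Ck_on_mono[OF Ck_\<psi>] \<psi>_outside[OF assms] on_graph(1)[OF assms(1)]]) simp

lemma grad_rot_\<psi>:
  "(\<Sum>i\<in>Basis. L2_inner \<Omega> (pd i (rot (\<psi> \<delta>))) (pd i (rot (\<psi> \<delta>)))) = (\<integral>x. hess_sq (\<psi> \<delta>) x \<partial>lebesgue_on \<Omega>)"
proof -
  let ?v = "rot (\<psi> \<delta>)"
  have \<psi>2: "Ck_on 2 UNIV (\<psi> \<delta>)"
    by (rule Ck_on_mono[OF Ck_\<psi>]) simp
  have v: "Ck_on 1 UNIV ?v"
    by (rule Ck_rot) (use \<psi>2 in \<open>simp only: One_nat_def numeral_2_eq_2\<close>)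
  have d: "?v differentiable (at x)" for x
    by (rule C1_differentiable[OF v])
  have tr: "(\<Sum>i\<in>Basis. pd i ?v x \<bullet> pd i ?v x) = hess_sq (\<psi> \<delta>) x" for x
  proof -
    have "(\<Sum>i\<in>Basis. pd i ?v x \<bullet> pd i ?v x) = pd e1 ?v x \<bullet> pd e1 ?v x + pd e2 ?v x \<bullet> pd e2 ?v x"
      by (rule trace_frame[where b = "\<lambda>i j. pd i ?v x \<bullet> pd j ?v x"])
        (simp_all add: pd_add_direction[OF d] pd_scaleR_direction[OF d] inner_add)
    moreover have "pd e ?v x \<bullet> pd e ?v x = (pd e (pd e1 (\<psi> \<delta>)) x)\<^sup>2 + (pd e (pd e2 (\<psi> \<delta>)) x)\<^sup>2" for e
      using orthonormal e2_e1
      by (simp add: pd_rot[OF \<psi>2] inner_diff_left inner_diff_right power2_eq_square)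
    ultimately show ?thesis
      unfolding hess_sq_def by (simp only: add.assoc)
  qed
  have "(\<Sum>i\<in>Basis. L2_inner \<Omega> (pd i ?v) (pd i ?v))
      = (\<integral>x. (\<Sum>i\<in>Basis. pd i ?v x \<bullet> pd i ?v x) \<partial>lebesgue_on \<Omega>)"
    unfolding L2_inner_def
    by (rule Bochner_Integration.integral_sum[symmetric])
      (intro integrable_continuous_lebesgue_on open_\<Omega> bounded_\<Omega> continuous_intros C1_continuous_pd v)
  then show ?thesis
    by (simp only: tr)
qed

lemma inner_e1_rot_F: "0 < L2_inner \<Omega> (\<lambda>_. e1) (rot F)"
  using integral_pd_e2_F_neg orthonormal by (simp add: L2_inner_def rot_def inner_diff_right)

text \<open>The constant field is the gradient of the linear function
  \<open>x \<bullet> e1\<close>.\<close>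

lemma e1_orthogonal_solenoidal:
  assumes "v \<in> solenoidal \<Omega>"
  shows "L2_inner \<Omega> (\<lambda>_. e1) v = 0"
proof -
  have "grad (\<lambda>x. x \<bullet> e1) = (\<lambda>_. e1)"
  proof
    fix x :: "real^2"
    have "pd i (\<lambda>x. x \<bullet> e1) x = e1 \<bullet> i" for i
      by (simp add: pd_bounded_linear bounded_linear_inner_left inner_commute)
    then show "grad (\<lambda>x. x \<bullet> e1) x = e1"
      by (simp add: grad_def euclidean_representation)
  qed
  moreover have "Ck_closure 1 \<Omega> (\<lambda>x. x \<bullet> e1)"
    by (rule Ck_closure_if_Ck[OF Ck_inner])
  ultimately show ?thesis
    using assms by (metis L2_inner_commute solenoidal_iff)
qed

text \<open>The case \<open>\<epsilon> = 0\<close> with strict inequality. Strictness will also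
  yield that the field is not identically zero.\<close>

lemma negative_direction:
  assumes "0 \<le> C"
  shows "\<exists>u. Ck_on 2 UNIV u \<and> (\<forall>x\<in>frontier \<Omega>. u x = 0) \<and>
      L2_inner \<Omega> u (extended_stokes \<Omega> u) < - C * L2_inner \<Omega> (divergence u) (divergence u)"
proof -
  note \<Omega> = open_\<Omega> bounded_\<Omega>
  let ?I = "L2_inner \<Omega>"
  define g where "g x = rot F x - leray \<Omega> (rot F) x" for x
  have FL: "rot F \<in> L2 \<Omega>"
    by (rule rot_L2[OF bounded_\<Omega> Ck_F])
  have eL: "(\<lambda>_. e1) \<in> L2 \<Omega>"
    by (rule L2_continuous[OF \<Omega> continuous_on_const])
  note PF = leray[OF \<Omega> FL]
  have gL: "g \<in> L2 \<Omega>"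
    unfolding g_def[abs_def] by (rule L2_diff[OF FL solenoidal_L2[OF PF(1)]])
  have "?I (\<lambda>_. e1) g = ?I (\<lambda>_. e1) (rot F)"
    unfolding g_def[abs_def] L2_inner_diff_right[OF eL FL solenoidal_L2[OF PF(1)]]
    by (simp add: e1_orthogonal_solenoidal[OF PF(1)])
  then have "0 < (\<integral>x. e1 \<bullet> g x \<partial>lebesgue_on \<Omega>)"
    using inner_e1_rot_F by (simp add: L2_inner_def)
  then obtain T K where T: "Ck_on 3 UNIV T" "compact K" "K \<subseteq> \<Omega>" "\<And>x. x \<notin> K \<Longrightarrow> T x = 0"
    "0 < (\<integral>x. T x * (e1 \<bullet> g x) \<partial>lebesgue_on \<Omega>)"
    by (rule cutoff_integral_pos[OF open_\<Omega> L2_integrable_inner[OF eL gL]]) blast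
  define w where "w x = T x *\<^sub>R e1" for x
  have w2: "Ck_on 2 UNIV w"
    unfolding w_def[abs_def] by (intro Ck_scaleR Ck_const Ck_on_mono[OF T(1)]) simp
  have w1: "Ck_on 1 UNIV w"
    by (rule Ck_on_mono[OF w2]) simp
  have wL: "w \<in> L2 \<Omega>"
    by (rule L2_continuous[OF \<Omega> Ck_on_continuous[OF w2]])
  note Pw = leray[OF \<Omega> wL]
  define wb where "wb x = w x - leray \<Omega> w x" for x
  have wbL: "wb \<in> L2 \<Omega>"
    unfolding wb_def[abs_def] by (rule L2_diff[OF wL solenoidal_L2[OF Pw(1)]])
  have wb_sol: "?I wb v = 0" if "v \<in> solenoidal \<Omega>" for v
    unfolding wb_def[abs_def] by (rule Pw(2)[OF that])
  \<comment> \<open>Self-adjointness of the complementary projection, obtained from the two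
    orthogonality relations alone.\<close>
  have wb_proj: "?I w (\<lambda>x. f x - leray \<Omega> f x) = ?I wb f" if f: "f \<in> L2 \<Omega>" for f
  proof -
    note Pf = leray[OF \<Omega> f]
    have fL: "(\<lambda>x. f x - leray \<Omega> f x) \<in> L2 \<Omega>"
      by (rule L2_diff[OF f solenoidal_L2[OF Pf(1)]])
    have "?I wb f = ?I wb (\<lambda>x. f x - leray \<Omega> f x)"
      by (simp add: L2_inner_diff_right[OF wbL f solenoidal_L2[OF Pf(1)]] wb_sol[OF Pf(1)])
    also have "\<dots> = ?I w (\<lambda>x. f x - leray \<Omega> f x)"
      unfolding wb_def[abs_def] L2_inner_diff_left[OF wL solenoidal_L2[OF Pw(1)] fL]
      using Pf(2)[OF Pw(1)] by (simp add: L2_inner_commute)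
    finally show ?thesis by simp
  qed
  define c where "c = ?I wb (rot F)"
  have c: "0 < c"
  proof -
    have "c = ?I w g"
      unfolding c_def g_def[abs_def] by (rule wb_proj[OF FL, symmetric])
    also have "\<dots> = (\<integral>x. T x * (e1 \<bullet> g x) \<partial>lebesgue_on \<Omega>)"
      by (simp add: L2_inner_def w_def)
    finally show ?thesis using T(5) by simp
  qed
  define fw where "fw x = laplacian w x - grad (divergence w) x" for x
  have fwL: "fw \<in> L2 \<Omega>"
    unfolding fw_def[abs_def]
    by (intro L2_diff L2_continuous \<Omega> continuous_laplacian continuous_grad Ck_divergence w2)
  define G where "G = (\<Sum>i\<in>Basis. ?I (pd i w) (pd i w))"
  define D where "D = ?I (divergence w) (divergence w)"
  have GD: "0 \<le> G" "0 \<le> D"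
    by (auto simp: G_def D_def intro!: sum_nonneg L2_inner_nonneg)
  \<comment> \<open>Bounds all the coefficients of \<open>t\<^sup>2\<close>: the pressure of
    \<open>w\<close>, twice its gradient energy, and the divergence term. The 1 makes division
    possible.\<close>
  define K' where "K' = \<bar>?I wb fw\<bar> + 2 * G + C * D + 1"
  have K': "0 < K'"
    using GD assms by (auto simp: K'_def intro!: add_nonneg_pos add_nonneg_nonneg)
  \<comment> \<open>The minimiser of \<open>t * c + t\<^sup>2 * K'\<close>, with minimum
    \<open>- c\<^sup>2 / (4 * K')\<close>. The width is chosen next so that twice the layer energy
    is strictly smaller than the modulus of this minimum.\<close>
  define t where "t = - c / (2 * K')"
  have "0 < c\<^sup>2 / (8 * K')"
    using c K' by simp
  then obtain \<delta> where \<delta>: "0 < \<delta>" "\<delta> \<le> h" "(\<integral>x. hess_sq (\<psi> \<delta>) x \<partial>lebesgue_on \<Omega>) < c\<^sup>2 / (8 * K')"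
    by (rule integral_hess_sq_small)
  let ?\<psi> = "\<psi> \<delta>"
  define v where "v = rot ?\<psi>"
  have v2: "Ck_on 2 UNIV v"
    unfolding v_def by (rule Ck_rot) (use Ck_\<psi>[of \<delta>] in \<open>simp only: numeral_3_eq_3 numeral_2_eq_2\<close>)
  have v1: "Ck_on 1 UNIV v"
    by (rule Ck_on_mono[OF v2]) simp
  have \<psi>2: "Ck_on 2 UNIV ?\<psi>"
    by (rule Ck_on_mono[OF Ck_\<psi>]) simp
  have v_sol: "v \<in> solenoidal \<Omega>"
    unfolding v_def by (rule rot_solenoidal[OF \<psi>_null_trace[OF \<delta>(1,2)] bounded_\<Omega>])
  have lap1: "Ck_on 1 UNIV (lap ?\<psi>)"
  proof -
    have p2: "Ck_on 2 UNIV (pd a ?\<psi>)" for a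
      by (rule Ck_pd) (use Ck_\<psi>[of \<delta>] in \<open>simp only: numeral_3_eq_3 numeral_2_eq_2\<close>)
    show ?thesis
      unfolding lap_def[abs_def] by (intro Ck_add Ck_pd_2 p2)
  qed
  have lapL: "rot (lap ?\<psi>) \<in> L2 \<Omega>"
    by (rule rot_L2[OF bounded_\<Omega> lap1])
  define u where "u x = v x + t *\<^sub>R w x" for x
  have u2: "Ck_on 2 UNIV u"
    unfolding u_def[abs_def] by (intro Ck_add Ck_scaleR Ck_const v2 w2)
  have uL: "u \<in> L2 \<Omega>" and vL: "v \<in> L2 \<Omega>"
    using L2_continuous[OF \<Omega> Ck_on_continuous[OF u2]] solenoidal_L2[OF v_sol] by auto
  have div_u: "divergence u = (\<lambda>x. t * divergence w x)"
  proof
    fix x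
    have "divergence u x = divergence v x + t * divergence w x"
      unfolding u_def[abs_def] by (rule divergence_linear_combination[OF v1 w1])
    then show "divergence u x = t * divergence w x"
      by (simp add: v_def divergence_rot[OF \<psi>2])
  qed
  have grad_div: "grad (\<lambda>x. t * divergence w x) x = t *\<^sub>R grad (divergence w) x" for x
  proof -
    have "pd i (\<lambda>x. t *\<^sub>R divergence w x) x = t *\<^sub>R pd i (divergence w) x" for i
      by (rule pd_compose_bounded_linear[OF bounded_linear_scaleR_right C1_differentiable[OF Ck_divergence[OF w2]]])
    then show ?thesis
      by (simp add: grad_def scaleR_sum_right)
  qed
  define fu where "fu x = laplacian u x - grad (divergence u) x" for x
  have fu: "fu = (\<lambda>x. rot (lap ?\<psi>) x + t *\<^sub>R fw x)"
  proof
    fix x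
    have "laplacian u x = rot (lap ?\<psi>) x + t *\<^sub>R laplacian w x"
      unfolding u_def[abs_def] laplacian_linear_combination[OF v2 w2] unfolding v_def laplacian_rot[OF Ck_\<psi>] ..
    then show "fu x = rot (lap ?\<psi>) x + t *\<^sub>R fw x"
      by (simp add: fu_def div_u grad_div fw_def scaleR_diff_right)
  qed
  have fuL: "fu \<in> L2 \<Omega>"
    unfolding fu by (intro L2_add L2_scaleR lapL fwL)
  \<comment> \<open>\<open>wb\<close> annihilates solenoidal fields, so the vorticity may be
    replaced by \<open>F\<close>. Thus the coefficient does not depend on \<open>\<delta>\<close>,
    and choosing \<open>\<delta>\<close> after \<open>t\<close> is legitimate.\<close>
  have rot_eq: "?I wb (rot (lap ?\<psi>)) = c"
  proof -
    have "rot (\<lambda>x. lap ?\<psi> x - F x) \<in> solenoidal \<Omega>"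
      by (rule rot_solenoidal[OF lap_\<psi>_minus_F_null_trace[OF \<delta>(1,2)] bounded_\<Omega>])
    moreover have "rot (\<lambda>x. lap ?\<psi> x - F x) = (\<lambda>x. rot (lap ?\<psi>) x - rot F x)"
      by (rule ext) (rule rot_diff[OF lap1 Ck_F])
    ultimately have "?I wb (\<lambda>x. rot (lap ?\<psi>) x - rot F x) = 0"
      using wb_sol by metis
    then show ?thesis
      by (simp add: L2_inner_diff_right[OF wbL lapL FL] c_def)
  qed
  \<comment> \<open>The solenoidal part \<open>v\<close> of \<open>u\<close> is orthogonal to the
    pressure gradient, so only \<open>t w\<close> is paired with it; moving the projection onto
    \<open>w\<close> splits the result into layer and perturbation.\<close>
  have pressure: "?I u (\<lambda>x. fu x - leray \<Omega> fu x) = t * c + t\<^sup>2 * ?I wb fw"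
  proof -
    note Pfu = leray[OF \<Omega> fuL]
    have pL: "(\<lambda>x. fu x - leray \<Omega> fu x) \<in> L2 \<Omega>"
      by (rule L2_diff[OF fuL solenoidal_L2[OF Pfu(1)]])
    have "?I u (\<lambda>x. fu x - leray \<Omega> fu x) = ?I v (\<lambda>x. fu x - leray \<Omega> fu x) + t * ?I w (\<lambda>x. fu x - leray \<Omega> fu x)"
      unfolding u_def[abs_def] L2_inner_add_left[OF vL L2_scaleR[OF wL] pL] L2_inner_scaleR_left ..
    also have "?I v (\<lambda>x. fu x - leray \<Omega> fu x) = 0"
      using Pfu(2)[OF v_sol] by (simp add: L2_inner_commute)
    also have "?I w (\<lambda>x. fu x - leray \<Omega> fu x) = c + t * ?I wb fw"
      unfolding wb_proj[OF fuL] unfolding fu L2_inner_add_right[OF wbL lapL L2_scaleR[OF fwL]]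
      by (simp add: rot_eq L2_inner_scaleR_right)
    finally show ?thesis
      by (simp add: power2_eq_square algebra_simps)
  qed
  have nt: "null_trace \<Omega> (\<lambda>x. u x \<bullet> j)" for j
  proof -
    have "null_trace \<Omega> (\<lambda>x. (t * (e1 \<bullet> j)) * T x)"
      using T by (intro null_trace_compact_support[OF _ T(2,3)] Ck_cmult Ck_on_mono[OF T(1)]) auto
    from null_trace_add[OF pd_\<psi>_null_trace[OF \<delta>(1,2), of "e2 \<bullet> j" "- (e1 \<bullet> j)"] this]
    show ?thesis
      by (simp add: u_def v_def w_def rot_def inner_add_left inner_diff_left algebra_simps)
  qed
  have energy: "- ?I u (laplacian u) \<le> 2 * (\<integral>x. hess_sq ?\<psi> x \<partial>lebesgue_on \<Omega>) + 2 * t\<^sup>2 * G"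
  proof -
    have pu: "pd i u = (\<lambda>x. pd i v x + t *\<^sub>R pd i w x)" for i
      unfolding u_def[abs_def]
      by (rule ext) (rule pd_linear_combination[OF C1_differentiable[OF v1] C1_differentiable[OF w1]])
    have "- ?I u (laplacian u) = (\<Sum>i\<in>Basis. ?I (pd i u) (pd i u))"
      using Green_identity[OF \<Omega> u2 nt] by simp
    also have "\<dots> \<le> (\<Sum>i\<in>Basis. 2 * ?I (pd i v) (pd i v) + 2 * t\<^sup>2 * ?I (pd i w) (pd i w))"
      unfolding pu by (intro sum_mono L2_inner_add_self_le L2_continuous \<Omega> C1_continuous_pd v1 w1)
    also have "\<dots> = 2 * (\<Sum>i\<in>Basis. ?I (pd i v) (pd i v)) + 2 * t\<^sup>2 * G"
      by (simp add: sum.distrib sum_distrib_left G_def)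
    finally show ?thesis
      unfolding v_def grad_rot_\<psi> .
  qed
  have "?I u (extended_stokes \<Omega> u) = - ?I u (laplacian u) + ?I u (\<lambda>x. fu x - leray \<Omega> fu x)"
    using L2_inner_extended_stokes[OF \<Omega> u2] by (simp add: fu_def[abs_def])
  also have "\<dots> \<le> 2 * (\<integral>x. hess_sq ?\<psi> x \<partial>lebesgue_on \<Omega>) + 2 * t\<^sup>2 * G + (t * c + t\<^sup>2 * ?I wb fw)"
    using energy by (simp add: pressure)
  also have "\<dots> < - C * (t\<^sup>2 * D)"
  proof -
    have tK: "t * c + t\<^sup>2 * K' = - (c\<^sup>2 / (4 * K'))"
      using K' by (simp add: t_def power2_eq_square field_simps)
    have "t\<^sup>2 * (?I wb fw + 2 * G + C * D) \<le> t\<^sup>2 * K'"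
      by (intro mult_left_mono) (auto simp: K'_def)
    moreover have "2 * (c\<^sup>2 / (8 * K')) = c\<^sup>2 / (4 * K')"
      by simp
    ultimately show ?thesis
      using \<delta>(3) tK by (simp add: algebra_simps)
  qed
  also have "t\<^sup>2 * D = ?I (divergence u) (divergence u)"
    unfolding div_u D_def L2_inner_def by (simp add: power2_eq_square mult_ac)
  finally have "?I u (extended_stokes \<Omega> u) < - C * ?I (divergence u) (divergence u)" .
  moreover have "u x = 0" if "x \<in> frontier \<Omega>" for x
  proof -
    have "x \<notin> \<Omega>"
      using that open_\<Omega> by (simp add: frontier_def interior_open)
    then have "w x = 0"
      using T(3,4) by (auto simp: w_def)
    then show ?thesis
      using rot_\<psi>_frontier[OF \<delta>(1,2) that] by (simp add: u_def v_def)
  qed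
  ultimately show ?thesis
    using u2 by blast
qed

end

section \<open>Existence of a chart and conclusion\<close>

lemma boundary_chart_exists:
  assumes \<Omega>: "Ck_domain 3 \<Omega>" "bounded \<Omega>"
  obtains x0 e1 e2 r \<gamma> \<alpha> h where "boundary_chart \<Omega> x0 e1 e2 r \<gamma> \<alpha> h"
proof -
  have "open \<Omega>" "\<Omega> \<noteq> {}"
    using \<Omega>(1) by (auto simp: Ck_domain_def)
  moreover have "\<Omega> \<noteq> UNIV"
    using \<Omega>(2) not_bounded_UNIV by blast
  ultimately have "frontier \<Omega> \<noteq> {}"
    by (simp add: frontier_eq_empty)
  then obtain x0 where x0: "x0 \<in> frontier \<Omega>" by blast
  then obtain r e1 e2 \<gamma> where *: "0 < r" "norm e1 = 1" "norm e2 = 1" "e1 \<bullet> e2 = 0"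
    "Ck_on 3 UNIV \<gamma>" "\<Omega> \<inter> ball x0 r = {x \<in> ball x0 r. \<gamma> (x \<bullet> e1) < x \<bullet> e2}"
    using \<Omega>(1) unfolding Ck_domain_def by blast
  interpret graph_chart \<Omega> x0 e1 e2 r \<gamma>
  proof unfold_locales
    show "e1 \<bullet> e1 = 1" "e2 \<bullet> e2 = 1"
      using *(2,3) by (simp_all add: norm_eq_1)
  qed (fact * x0 \<open>open \<Omega>\<close>)+
  have "isCont \<gamma> (x0 \<bullet> e1)"
    using Ck_on_continuous[OF *(5)] by (simp add: continuous_on_eq_continuous_at)
  from this[unfolded continuous_at_eps_delta dist_real_def, rule_format, of "r / 4"] *(1)
  have "\<exists>d>0. \<forall>s. \<bar>s - x0 \<bullet> e1\<bar> < d \<longrightarrow> \<bar>\<gamma> s - \<gamma> (x0 \<bullet> e1)\<bar> < r / 4"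
    by simp
  then obtain d where d: "0 < d" "\<And>s. \<bar>s - x0 \<bullet> e1\<bar> < d \<Longrightarrow> \<bar>\<gamma> s - \<gamma> (x0 \<bullet> e1)\<bar> < r / 4"
    by blast
  \<comment> \<open>In the box the coordinate along \<open>e1\<close> differs from that of
    \<open>x0\<close> by at most \<open>r / 4\<close>. Along \<open>e2\<close> the difference is
    below \<open>r / 2\<close>: height at most \<open>r / 4\<close> plus oscillation of
    \<open>\<gamma>\<close> below \<open>r / 4\<close>. The sum stays below \<open>r\<close>.
    Halving \<open>d\<close> makes the strict continuity estimate cover the closed box.\<close>
  have "boundary_chart \<Omega> x0 e1 e2 r \<gamma> (min (d / 2) (r / 4)) (r / 4)"
  proof unfold_locales
    fix x
    assume a: "\<bar>x \<bullet> e1 - x0 \<bullet> e1\<bar> \<le> min (d / 2) (r / 4)" and b: "\<bar>x \<bullet> e2 - \<gamma> (x \<bullet> e1)\<bar> \<le> r / 4"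
    have "\<bar>\<gamma> (x \<bullet> e1) - \<gamma> (x0 \<bullet> e1)\<bar> < r / 4"
      using a d by (intro d(2)) auto
    moreover have "x0 \<bullet> e2 = \<gamma> (x0 \<bullet> e1)"
      using \<rho>_x0 by (simp add: \<rho>_def)
    ultimately have e2: "\<bar>(x - x0) \<bullet> e2\<bar> < r / 2"
      using b by (simp add: inner_diff_left abs_if split: if_splits)
    have e1: "\<bar>(x - x0) \<bullet> e1\<bar> \<le> r / 4"
      using a by (simp add: inner_diff_left)
    have "norm (x - x0) = norm (((x - x0) \<bullet> e1) *\<^sub>R e1 + ((x - x0) \<bullet> e2) *\<^sub>R e2)"
      by (rule arg_cong[OF frame_expansion])
    also have "\<dots> \<le> \<bar>(x - x0) \<bullet> e1\<bar> + \<bar>(x - x0) \<bullet> e2\<bar>"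
      using norm_triangle_ineq[of "((x - x0) \<bullet> e1) *\<^sub>R e1" "((x - x0) \<bullet> e2) *\<^sub>R e2"] *(2,3) by simp
    also have "\<dots> < r"
      using e1 e2 *(1) by linarith
    finally show "x \<in> ball x0 r"
      by (simp add: dist_norm norm_minus_commute)
  qed (use \<Omega>(2) *(1) d in auto)
  then show thesis by (rule that)
qed

theorem proposition2p1:
  fixes \<Omega> :: "(real^2) set" and \<epsilon> C :: real
  assumes "Ck_domain 3 \<Omega>" and "bounded \<Omega>" and "simply_connected \<Omega>"
    and "\<epsilon> \<ge> 0" and "C \<ge> 0"
  shows "\<exists>u :: real^2 \<Rightarrow> real^2.
      Ck_closure 2 \<Omega> u \<and> (\<exists>x\<in>closure \<Omega>. u x \<noteq> 0) \<and> (\<forall>x\<in>frontier \<Omega>. u x = 0) \<and>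
      L2_inner \<Omega> u (extended_stokes \<Omega> u)
        \<le> \<epsilon> * (L2_norm_grad \<Omega> u)\<^sup>2 - C * (L2_norm \<Omega> (divergence u))\<^sup>2"
proof -
  obtain x0 e1 e2 r \<gamma> \<alpha> h where "boundary_chart \<Omega> x0 e1 e2 r \<gamma> \<alpha> h"
    by (rule boundary_chart_exists[OF assms(1,2)])
  from boundary_chart.negative_direction[OF this assms(5)]
  obtain u where u: "Ck_on 2 UNIV u" "\<forall>x\<in>frontier \<Omega>. u x = 0"
    "L2_inner \<Omega> u (extended_stokes \<Omega> u) < - C * L2_inner \<Omega> (divergence u) (divergence u)"
    by blast
  have "0 \<le> C * L2_inner \<Omega> (divergence u) (divergence u)"
    using assms(5) L2_inner_nonneg by (intro mult_nonneg_nonneg)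
  \<comment> \<open>The strict inequality forces a negative value, whereas a field vanishing on the
    closure would give 0, whatever representative \<open>leray\<close> chooses.\<close>
  then have "L2_inner \<Omega> u (extended_stokes \<Omega> u) \<noteq> 0"
    using u(3) by linarith
  moreover have "L2_inner \<Omega> u (extended_stokes \<Omega> u) = 0" if "\<forall>x\<in>closure \<Omega>. u x = 0"
  proof -
    have "L2_inner \<Omega> u (extended_stokes \<Omega> u) = (\<integral>x. 0 \<partial>lebesgue_on \<Omega>)"
      unfolding L2_inner_def using that closure_subset[of \<Omega>]
      by (intro Bochner_Integration.integral_cong refl) (simp add: subset_iff)
    then show ?thesis by simp
  qed
  ultimately have "\<exists>x\<in>closure \<Omega>. u x \<noteq> 0" by blast
  moreover have "0 \<le> \<epsilon> * (L2_norm_grad \<Omega> u)\<^sup>2"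
    using assms(4) by simp
  then have "L2_inner \<Omega> u (extended_stokes \<Omega> u)
      \<le> \<epsilon> * (L2_norm_grad \<Omega> u)\<^sup>2 - C * (L2_norm \<Omega> (divergence u))\<^sup>2"
    using u(3) unfolding L2_norm_sq by linarith
  ultimately show ?thesis
    using u(1,2) Ck_closure_if_Ck by blast
qed

end
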